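(* Let $(M,g)$ be a semi-Riemannian manifold of dimension $n$, let $\gamma:[a,b]\to M$ be a geodesic, and let $\mathcal P\subset M$ be a smooth connected submanifold with $\gamma(a)\in\mathcal P$, $\dot\gamma(a)\in T_{\gamma(a)}\mathcal P^\perp$, and such that $g$ restricted to $T_{\gamma(a)}\mathcal P$ is nondegenerate. Let $\ell:[a,b]\to\Lambda$ be the curve of Lagrangians associated with $\gamma$ and let $L_0$, $L_{\mathcal P}$ be the Lagrangians associated with $\{\gamma(a)\}$ and $\mathcal P$ (see context). Let $[\alpha,\beta]\subset\left]a,b\right]$ be any interval. (1) If $\big|\mu_{L_0}\big(\ell|_{[\alpha,\beta]}\big)\big|>\dim(\mathcal P)$, then there is at least one $\mathcal P$-focal instant in $[\alpha,\beta]$. (2) If $\big|\mu_{L_{\mathcal P}}\big(\ell|_{[\alpha,\beta]}\big)\big|>\dim(\mathcal P)$, then there is at least one conjugate instant in $[\alpha,\beta]$.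
   Context: Maslov index. Let $(V,\omega)$ be a $2n$-dimensional real symplectic space and $\Lambda$ the set of its Lagrangian subspaces. For $L_1\in\Lambda$, $\Lambda^0(L_1)$ is the set of Lagrangians transverse to $L_1$. If $L_0,L_1$ are transverse Lagrangians, $\varphi_{L_0,L_1}:\Lambda^0(L_1)\to\mathrm{B}_{\mathrm{sym}}(L_0)$ (symmetric bilinear forms on $L_0$) is $\varphi_{L_0,L_1}(L)=\omega(T\cdot,\cdot)|_{L_0\times L_0}$, where $T:L_0\to L_1$ is the linear map whose graph is $L$. For a symmetric bilinear form $B$, $n_-(B)$ is the maximal dimension of a subspace on which $B$ is negative definite and $n_+(B)=n_-(-B)$. For a continuous path $\ell:[a,b]\to\Lambda$ and $L_0\in\Lambda$, $\mu_{L_0}(\ell)\in\mathbb Z$ is characterized by: fixed-endpoint homotopy invariance; additivity under concatenation; and, if $\ell([a,b])\subset\Lambda^0(L_1)$ for some $L_1$ transverse to $L_0$, $\mu_{L_0}(\ell)=n_+[\varphi_{L_0,L_1}(\ell(b))]-n_+[\varphi_{L_0,L_1}(\ell(a))]$. Geometric setting. $\perp$ denotes $g$-orthogonality. Jacobi fields along $\gamma$ are solutions of $\frac{\mathrm D^2}{\mathrm dt^2}J-R(\dot\gamma,J)\dot\gamma=0$, with $R(X,Y)=[\nabla_X,\nabla_Y]-\nabla_{[X,Y]}$. Let $V=T_{\gamma(a)}M\oplus T_{\gamma(a)}M$ with symplectic form $\omega\big((v_1,w_1),(v_2,w_2)\big)=g(v_2,w_1)-g(v_1,w_2)$. For $(v,w)\in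 V$ let $J_{v,w}$ be the Jacobi field along $\gamma$ with $J(a)=v$, $\frac{\mathrm D}{\mathrm dt}J(a)=w$. The smooth curve $\ell:[a,b]\to\Lambda$ is $\ell(t)=\{(v,w)\in V: J_{v,w}(t)=0\}$. Set $L_0=\{0\}\oplus T_{\gamma(a)}M=\ell(a)$. Let $S:T_{\gamma(a)}\mathcal P\to T_{\gamma(a)}\mathcal P$ be the $g$-symmetric operator representing the second fundamental form of $\mathcal P$ at $\gamma(a)$ in the normal direction $\dot\gamma(a)$, i.e. $g(S(v),v')=g(\nabla_vV',\dot\gamma(a))$ for any local extension $V'$ of $v'$ to a field tangent to $\mathcal P$. Set $L_{\mathcal P}=\{(v,w)\in V: v\in T_{\gamma(a)}\mathcal P,\ w+S(v)\in T_{\gamma(a)}\mathcal P^\perp\}$, a Lagrangian subspace. An instant $t\in\left]a,b\right]$ is $\mathcal P$-focal if $\ell(t)\cap L_{\mathcal P}\ne\{0\}$, and conjugate if $\ell(t)\cap L_0\neq\{0\}$. *)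

theory Defs
  imports "HOL-Analysis.Analysis"
begin

section \<open>Lagrangian subspaces and the Maslov index\<close>

text \<open>Below, \<open>\<omega>\<close> stands for a symplectic form on the vector space \<open>'v\<close>.\<close>

definition lagrangian :: "('v::euclidean_space \<Rightarrow> 'v \<Rightarrow> real) \<Rightarrow> 'v set \<Rightarrow> bool" where
  "lagrangian \<omega> L \<longleftrightarrow> subspace L \<and> (\<forall>x\<in>L. \<forall>y\<in>L. \<omega> x y = 0) \<and> 2 * dim L = DIM('v)"

definition transverse :: "'v::euclidean_space set \<Rightarrow> 'v set \<Rightarrow> bool" where
  "transverse L L' \<longleftrightarrow> L \<inter> L' = {0}"

text \<open>For \<open>L\<close> and \<open>L\<^sub>0\<close> both complementary to \<open>L\<^sub>1\<close>, this is the linear map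
  \<open>T : L\<^sub>0 \<rightarrow> L\<^sub>1\<close> with \<open>L = {x + T x | x \<in> L\<^sub>0}\<close>.\<close>

definition graph_map :: "'v::euclidean_space set \<Rightarrow> 'v set \<Rightarrow> 'v set \<Rightarrow> 'v \<Rightarrow> 'v" where
  "graph_map L0 L1 L x = (THE y. y \<in> L1 \<and> x + y \<in> L)"

definition lag_chart ::
  "('v::euclidean_space \<Rightarrow> 'v \<Rightarrow> real) \<Rightarrow> 'v set \<Rightarrow> 'v set \<Rightarrow> 'v set \<Rightarrow> 'v \<Rightarrow> 'v \<Rightarrow> real" where
  "lag_chart \<omega> L0 L1 L x y = \<omega> (graph_map L0 L1 L x) y"

definition n_minus :: "'v::euclidean_space set \<Rightarrow> ('v \<Rightarrow> 'v \<Rightarrow> real) \<Rightarrow> nat" where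
  "n_minus W B = Max {dim U | U. subspace U \<and> U \<subseteq> W \<and> (\<forall>x\<in>U. x \<noteq> 0 \<longrightarrow> B x x < 0)}"

definition n_plus :: "'v::euclidean_space set \<Rightarrow> ('v \<Rightarrow> 'v \<Rightarrow> real) \<Rightarrow> nat" where
  "n_plus W B = n_minus W (\<lambda>x y. - B x y)"

text \<open>Continuity for the topology of the Lagrangian Grassmannian, in which a subspace is
  identified with the orthogonal projection onto it. The auxiliary inner product of the type
  does not influence the topology.\<close>

definition lag_continuous_on ::
  "('v::euclidean_space \<Rightarrow> 'v \<Rightarrow> real) \<Rightarrow> 's::topological_space set \<Rightarrow> ('s \<Rightarrow> 'v set) \<Rightarrow> bool" where
  "lag_continuous_on \<omega> S f \<longleftrightarrow> (\<forall>s\<in>S. lagrangian \<omega> (f s)) \<and>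
     (\<forall>x. continuous_on S (\<lambda>s. closest_point (f s) x))"

definition lag_homotopic ::
  "('v::euclidean_space \<Rightarrow> 'v \<Rightarrow> real) \<Rightarrow> real \<Rightarrow> real \<Rightarrow> (real \<Rightarrow> 'v set) \<Rightarrow> (real \<Rightarrow> 'v set) \<Rightarrow> bool" where
  "lag_homotopic \<omega> a b l l' \<longleftrightarrow>
     (\<exists>H. lag_continuous_on \<omega> ({0..1::real} \<times> {a..b}) H \<and>
        (\<forall>t\<in>{a..b}. H (0, t) = l t \<and> H (1, t) = l' t) \<and>
        (\<forall>s\<in>{0..1}. H (s, a) = l a \<and> H (s, b) = l b))"

text \<open>\<open>\<mu> L\<^sub>0 a b l\<close> is the value \<open>\<mu>\<^bsub>L\<^sub>0\<^esub>\<close> on the path \<open>l\<close> restricted to \<open>[a,b]\<close>. The three clauses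
  determine \<open>\<mu>\<close> uniquely on continuous paths; other arguments are unconstrained.\<close>

definition is_maslov_index ::
  "('v::euclidean_space \<Rightarrow> 'v \<Rightarrow> real) \<Rightarrow> ('v set \<Rightarrow> real \<Rightarrow> real \<Rightarrow> (real \<Rightarrow> 'v set) \<Rightarrow> int) \<Rightarrow> bool" where
  "is_maslov_index \<omega> \<mu> \<longleftrightarrow> (\<forall>L0 a b l. lagrangian \<omega> L0 \<longrightarrow> a \<le> b \<longrightarrow> lag_continuous_on \<omega> {a..b} l \<longrightarrow>
     (\<forall>l'. lag_homotopic \<omega> a b l l' \<longrightarrow> \<mu> L0 a b l = \<mu> L0 a b l') \<and>
     (\<forall>c\<in>{a..b}. \<mu> L0 a b l = \<mu> L0 a c l + \<mu> L0 c b l) \<and>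
     (\<forall>L1. lagrangian \<omega> L1 \<and> transverse L0 L1 \<and> (\<forall>t\<in>{a..b}. transverse (l t) L1) \<longrightarrow>
        \<mu> L0 a b l = int (n_plus L0 (lag_chart \<omega> L0 L1 (l b)))
                   - int (n_plus L0 (lag_chart \<omega> L0 L1 (l a)))))"


section \<open>Smooth manifolds and semi-Riemannian metrics\<close>

primrec C_k_on :: "nat \<Rightarrow> ('a::real_normed_vector \<Rightarrow> 'b::real_normed_vector) \<Rightarrow> 'a set \<Rightarrow> bool" where
  "C_k_on 0 f S \<longleftrightarrow> continuous_on S f"
| "C_k_on (Suc k) f S \<longleftrightarrow> (\<forall>x\<in>S. f differentiable (at x)) \<and>
     (\<forall>v. C_k_on k (\<lambda>x. frechet_derivative f (at x) v) S)"

text \<open>Only used on open subsets of Euclidean spaces.\<close>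

definition smooth_on :: "'a::real_normed_vector set \<Rightarrow> ('a \<Rightarrow> 'b::real_normed_vector) \<Rightarrow> bool" where
  "smooth_on S f \<longleftrightarrow> (\<forall>k. C_k_on k f S)"

text \<open>A chart is a pair of its domain and its coordinate map; the values of the map off the
  domain are irrelevant.\<close>

type_synonym ('m, 'n) chart = "'m set \<times> ('m \<Rightarrow> real ^ 'n)"

abbreviation cdom :: "('m, 'n::finite) chart \<Rightarrow> 'm set" where "cdom \<equiv> fst"
abbreviation cmap :: "('m, 'n::finite) chart \<Rightarrow> 'm \<Rightarrow> real ^ 'n" where "cmap \<equiv> snd"

definition cinv :: "('m, 'n::finite) chart \<Rightarrow> real ^ 'n \<Rightarrow> 'm" where
  "cinv c = inv_into (cdom c) (cmap c)"

definition is_chart :: "('m::topological_space, 'n::finite) chart \<Rightarrow> bool" where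
  "is_chart c \<longleftrightarrow> open (cdom c) \<and> open (cmap c ` cdom c) \<and>
     homeomorphism (cdom c) (cmap c ` cdom c) (cmap c) (cinv c)"

definition smooth_transition :: "('m, 'n::finite) chart \<Rightarrow> ('m, 'n) chart \<Rightarrow> bool" where
  "smooth_transition c d \<longleftrightarrow> smooth_on (cmap c ` (cdom c \<inter> cdom d)) (cmap d \<circ> cinv c)"

text \<open>The manifold is the whole type \<open>'m\<close> and has dimension \<open>CARD('n)\<close>. Each point \<open>p\<close> carries a
  preferred chart \<open>chart_at M p\<close>, through whose differential the tangent space at \<open>p\<close> is
  identified with \<open>real ^ 'n\<close>: a tangent vector at \<open>p\<close> is given by its components in that chart.
  Accordingly \<open>metric M p\<close> is the metric tensor on the tangent space at \<open>p\<close>.\<close>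

record ('m, 'n) semi_riemannian =
  charts :: "('m, 'n::finite) chart set"
  chart_at :: "'m \<Rightarrow> ('m, 'n) chart"
  metric :: "'m \<Rightarrow> real ^ 'n \<Rightarrow> real ^ 'n \<Rightarrow> real"

text \<open>\<open>charts M\<close> is a maximal smooth atlas.\<close>

definition smooth_manifold :: "('m::topological_space, 'n::finite) semi_riemannian \<Rightarrow> bool" where
  "smooth_manifold M \<longleftrightarrow>
     (\<forall>c\<in>charts M. is_chart c) \<and>
     (\<forall>c\<in>charts M. \<forall>d\<in>charts M. smooth_transition c d) \<and>
     (\<forall>c. is_chart c \<and> (\<forall>d\<in>charts M. smooth_transition c d \<and> smooth_transition d c) \<longrightarrow> c \<in> charts M) \<and>
     (\<forall>p. chart_at M p \<in> charts M \<and> p \<in> cdom (chart_at M p))"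

text \<open>\<open>tcoord M c p v\<close>: components in the chart \<open>c\<close> of the tangent vector \<open>v\<close> at \<open>p\<close>;
  \<open>tvec M c p u\<close>: the tangent vector at \<open>p\<close> with components \<open>u\<close> in the chart \<open>c\<close>.\<close>

definition tcoord ::
  "('m, 'n::finite) semi_riemannian \<Rightarrow> ('m, 'n) chart \<Rightarrow> 'm \<Rightarrow> real ^ 'n \<Rightarrow> real ^ 'n" where
  "tcoord M c p v =
     frechet_derivative (cmap c \<circ> cinv (chart_at M p)) (at (cmap (chart_at M p) p)) v"

definition tvec ::
  "('m, 'n::finite) semi_riemannian \<Rightarrow> ('m, 'n) chart \<Rightarrow> 'm \<Rightarrow> real ^ 'n \<Rightarrow> real ^ 'n" where
  "tvec M c p u = frechet_derivative (cmap (chart_at M p) \<circ> cinv c) (at (cmap c p)) u"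

definition metric_coord ::
  "('m, 'n::finite) semi_riemannian \<Rightarrow> ('m, 'n) chart \<Rightarrow> real ^ 'n \<Rightarrow> real ^ 'n \<Rightarrow> real ^ 'n \<Rightarrow> real" where
  "metric_coord M c x u v = metric M (cinv c x) (tvec M c (cinv c x) u) (tvec M c (cinv c x) v)"

definition nondegenerate_on :: "'v::real_vector set \<Rightarrow> ('v \<Rightarrow> 'v \<Rightarrow> real) \<Rightarrow> bool" where
  "nondegenerate_on W B \<longleftrightarrow> (\<forall>u\<in>W. (\<forall>v\<in>W. B u v = 0) \<longrightarrow> u = 0)"

definition semi_riemannian_manifold :: "('m::topological_space, 'n::finite) semi_riemannian \<Rightarrow> bool" where
  "semi_riemannian_manifold M \<longleftrightarrow> smooth_manifold M \<and>
     (\<forall>p. bilinear (metric M p) \<and> (\<forall>u v. metric M p u v = metric M p v u) \<and>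
          nondegenerate_on UNIV (metric M p)) \<and>
     (\<forall>c\<in>charts M. \<forall>u v. smooth_on (cmap c ` cdom c) (\<lambda>x. metric_coord M c x u v))"


section \<open>Levi-Civita connection, geodesics and Jacobi fields\<close>

text \<open>In a chart, vector fields are functions of the coordinates \<open>x\<close>. The Christoffel tensor
  \<open>\<Gamma>\<^sub>x(u,v)\<close> is \<open>\<nabla>\<^sub>u v\<close> for fields with constant components, as given by the Koszul formula
  (the bracket terms vanish).\<close>

definition christoffel ::
  "('m, 'n::finite) semi_riemannian \<Rightarrow> ('m, 'n) chart \<Rightarrow> real ^ 'n \<Rightarrow> real ^ 'n \<Rightarrow> real ^ 'n \<Rightarrow> real ^ 'n" where
  "christoffel M c x u v = (THE z. \<forall>w. 2 * metric_coord M c x z w =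
       frechet_derivative (\<lambda>y. metric_coord M c y v w) (at x) u
     + frechet_derivative (\<lambda>y. metric_coord M c y u w) (at x) v
     - frechet_derivative (\<lambda>y. metric_coord M c y u v) (at x) w)"

definition nabla ::
  "('m, 'n::finite) semi_riemannian \<Rightarrow> ('m, 'n) chart \<Rightarrow>
     (real ^ 'n \<Rightarrow> real ^ 'n) \<Rightarrow> (real ^ 'n \<Rightarrow> real ^ 'n) \<Rightarrow> real ^ 'n \<Rightarrow> real ^ 'n" where
  "nabla M c X Y x = frechet_derivative Y (at x) (X x) + christoffel M c x (X x) (Y x)"

definition lie_bracket ::
  "(real ^ 'n \<Rightarrow> real ^ 'n) \<Rightarrow> (real ^ 'n \<Rightarrow> real ^ 'n) \<Rightarrow> real ^ 'n \<Rightarrow> real ^ ('n::finite)" where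
  "lie_bracket X Y x = frechet_derivative Y (at x) (X x) - frechet_derivative X (at x) (Y x)"

definition curvature ::
  "('m, 'n::finite) semi_riemannian \<Rightarrow> ('m, 'n) chart \<Rightarrow> (real ^ 'n \<Rightarrow> real ^ 'n) \<Rightarrow>
     (real ^ 'n \<Rightarrow> real ^ 'n) \<Rightarrow> (real ^ 'n \<Rightarrow> real ^ 'n) \<Rightarrow> real ^ 'n \<Rightarrow> real ^ 'n" where
  "curvature M c X Y Z x = nabla M c X (nabla M c Y Z) x - nabla M c Y (nabla M c X Z) x
     - nabla M c (lie_bracket X Y) Z x"

text \<open>The curvature tensor at \<open>p\<close>, evaluated on the extensions of \<open>u\<close>, \<open>v\<close>, \<open>w\<close> with constant
  components in the preferred chart.\<close>

definition riemann ::
  "('m, 'n::finite) semi_riemannian \<Rightarrow> 'm \<Rightarrow> real ^ 'n \<Rightarrow> real ^ 'n \<Rightarrow> real ^ 'n \<Rightarrow> real ^ 'n" where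
  "riemann M p u v w =
     curvature M (chart_at M p) (\<lambda>_. u) (\<lambda>_. v) (\<lambda>_. w) (cmap (chart_at M p) p)"

definition differentiable_curve ::
  "('m::topological_space, 'n::finite) semi_riemannian \<Rightarrow> real set \<Rightarrow> (real \<Rightarrow> 'm) \<Rightarrow> bool" where
  "differentiable_curve M I \<gamma> \<longleftrightarrow> continuous_on I \<gamma> \<and>
     (\<forall>t\<in>I. (\<lambda>s. cmap (chart_at M (\<gamma> t)) (\<gamma> s)) differentiable (at t within I))"

definition velocity ::
  "('m, 'n::finite) semi_riemannian \<Rightarrow> real set \<Rightarrow> (real \<Rightarrow> 'm) \<Rightarrow> real \<Rightarrow> real ^ 'n" where
  "velocity M I \<gamma> t = vector_derivative (\<lambda>s. cmap (chart_at M (\<gamma> t)) (\<gamma> s)) (at t within I)"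

text \<open>\<open>Y = DX/dt\<close> for fields \<open>X\<close>, \<open>Y\<close> along \<open>\<gamma>\<close>: in every chart,
  \<open>X' = Y - \<Gamma>(\<gamma>', X)\<close> holds for the components.\<close>

definition has_cov_derivative ::
  "('m, 'n::finite) semi_riemannian \<Rightarrow> real set \<Rightarrow> (real \<Rightarrow> 'm) \<Rightarrow>
     (real \<Rightarrow> real ^ 'n) \<Rightarrow> (real \<Rightarrow> real ^ 'n) \<Rightarrow> bool" where
  "has_cov_derivative M I \<gamma> X Y \<longleftrightarrow> (\<forall>c\<in>charts M. \<forall>t\<in>I. \<gamma> t \<in> cdom c \<longrightarrow>
     ((\<lambda>s. tcoord M c (\<gamma> s) (X s)) has_vector_derivative
        tcoord M c (\<gamma> t) (Y t)
        - christoffel M c (cmap c (\<gamma> t)) (tcoord M c (\<gamma> t) (velocity M I \<gamma> t))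
            (tcoord M c (\<gamma> t) (X t)))
       (at t within I))"

definition geodesic ::
  "('m::topological_space, 'n::finite) semi_riemannian \<Rightarrow> real set \<Rightarrow> (real \<Rightarrow> 'm) \<Rightarrow> bool" where
  "geodesic M I \<gamma> \<longleftrightarrow> differentiable_curve M I \<gamma> \<and>
     has_cov_derivative M I \<gamma> (velocity M I \<gamma>) (\<lambda>_. 0)"

definition jacobi_field ::
  "('m, 'n::finite) semi_riemannian \<Rightarrow> real set \<Rightarrow> (real \<Rightarrow> 'm) \<Rightarrow>
     (real \<Rightarrow> real ^ 'n) \<Rightarrow> (real \<Rightarrow> real ^ 'n) \<Rightarrow> bool" where
  "jacobi_field M I \<gamma> J DJ \<longleftrightarrow> has_cov_derivative M I \<gamma> J DJ \<and>
     (\<exists>DDJ. has_cov_derivative M I \<gamma> DJ DDJ \<and>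
        (\<forall>t\<in>I. DDJ t - riemann M (\<gamma> t) (velocity M I \<gamma> t) (J t) (velocity M I \<gamma> t) = 0))"


section \<open>Submanifolds and the second fundamental form\<close>

text \<open>Embedded submanifolds of dimension \<open>d\<close>, via slice charts.\<close>

definition submanifold ::
  "('m, 'n::finite) semi_riemannian \<Rightarrow> nat \<Rightarrow> 'm set \<Rightarrow> bool" where
  "submanifold M d P \<longleftrightarrow> (\<forall>p\<in>P. \<exists>c\<in>charts M. \<exists>W. p \<in> cdom c \<and> subspace W \<and> dim W = d \<and>
     cmap c ` (P \<inter> cdom c) = cmap c ` cdom c \<inter> W)"

definition tangent_space_of ::
  "('m::topological_space, 'n::finite) semi_riemannian \<Rightarrow> 'm set \<Rightarrow> 'm \<Rightarrow> (real ^ 'n) set" where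
  "tangent_space_of M P p = {v. \<exists>\<sigma> :: real \<Rightarrow> 'm. range \<sigma> \<subseteq> P \<and> \<sigma> 0 = p \<and> isCont \<sigma> 0 \<and>
     ((\<lambda>s. cmap (chart_at M p) (\<sigma> s)) has_vector_derivative v) (at 0)}"

definition metric_perp ::
  "('m, 'n::finite) semi_riemannian \<Rightarrow> 'm \<Rightarrow> (real ^ 'n) set \<Rightarrow> (real ^ 'n) set" where
  "metric_perp M p W = {w. \<forall>u\<in>W. metric M p u w = 0}"

definition field_coord ::
  "('m, 'n::finite) semi_riemannian \<Rightarrow> ('m, 'n) chart \<Rightarrow> ('m \<Rightarrow> real ^ 'n) \<Rightarrow> real ^ 'n \<Rightarrow> real ^ 'n" where
  "field_coord M c X x = tcoord M c (cinv c x) (X (cinv c x))"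

definition local_tangent_extension ::
  "('m::topological_space, 'n::finite) semi_riemannian \<Rightarrow> 'm set \<Rightarrow> 'm \<Rightarrow> real ^ 'n \<Rightarrow>
     ('m \<Rightarrow> real ^ 'n) \<Rightarrow> bool" where
  "local_tangent_extension M P p v X \<longleftrightarrow> X p = v \<and>
     (\<exists>U. open U \<and> p \<in> U \<and>
        (\<forall>c\<in>charts M. smooth_on (cmap c ` (U \<inter> cdom c)) (field_coord M c X)) \<and>
        (\<forall>q\<in>P \<inter> U. X q \<in> tangent_space_of M P q))"

text \<open>\<open>\<nabla>\<^sub>v X\<close> at \<open>p\<close>, computed in the preferred chart, where \<open>v\<close> is its own component vector.\<close>

definition nabla_at ::
  "('m, 'n::finite) semi_riemannian \<Rightarrow> 'm \<Rightarrow> real ^ 'n \<Rightarrow> ('m \<Rightarrow> real ^ 'n) \<Rightarrow> real ^ 'n" where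
  "nabla_at M p v X =
     nabla M (chart_at M p) (\<lambda>_. v) (field_coord M (chart_at M p) X) (cmap (chart_at M p) p)"

text \<open>\<open>S\<close> represents the second fundamental form of \<open>P\<close> at \<open>p\<close> in the normal direction \<open>\<nu>\<close>. It is
  an operator on the tangent space of \<open>P\<close>, extended arbitrarily to a linear map of the whole type.\<close>

definition second_fundamental_operator ::
  "('m::topological_space, 'n::finite) semi_riemannian \<Rightarrow> 'm set \<Rightarrow> 'm \<Rightarrow> real ^ 'n \<Rightarrow>
     (real ^ 'n \<Rightarrow> real ^ 'n) \<Rightarrow> bool" where
  "second_fundamental_operator M P p \<nu> S \<longleftrightarrow>
     (let T = tangent_space_of M P p in
        linear S \<and> S ` T \<subseteq> T \<and>
        (\<forall>v\<in>T. \<forall>v'\<in>T. metric M p (S v) v' = metric M p v (S v')) \<and>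
        (\<forall>v\<in>T. \<forall>v'\<in>T. \<forall>X. local_tangent_extension M P p v' X \<longrightarrow>
           metric M p (S v) v' = metric M p (nabla_at M p v X) \<nu>))"


section \<open>The curve of Lagrangians of a geodesic\<close>

definition phase_form ::
  "('m, 'n::finite) semi_riemannian \<Rightarrow> 'm \<Rightarrow>
     (real ^ 'n) \<times> (real ^ 'n) \<Rightarrow> (real ^ 'n) \<times> (real ^ 'n) \<Rightarrow> real" where
  "phase_form M p z1 z2 = metric M p (fst z2) (snd z1) - metric M p (fst z1) (snd z2)"

definition lag_curve ::
  "('m, 'n::finite) semi_riemannian \<Rightarrow> (real \<Rightarrow> 'm) \<Rightarrow> real \<Rightarrow> real \<Rightarrow> real \<Rightarrow>
     ((real ^ 'n) \<times> (real ^ 'n)) set" where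
  "lag_curve M \<gamma> a b t =
     {(v, w). \<exists>J DJ. jacobi_field M {a..b} \<gamma> J DJ \<and> J a = v \<and> DJ a = w \<and> J t = 0}"

definition lag_point :: "((real ^ 'n) \<times> (real ^ 'n::finite)) set" where
  "lag_point = {0} \<times> UNIV"

definition lag_submanifold ::
  "('m::topological_space, 'n::finite) semi_riemannian \<Rightarrow> 'm set \<Rightarrow> 'm \<Rightarrow> (real ^ 'n \<Rightarrow> real ^ 'n) \<Rightarrow>
     ((real ^ 'n) \<times> (real ^ 'n)) set" where
  "lag_submanifold M P p S = {(v, w). v \<in> tangent_space_of M P p \<and>
     w + S v \<in> metric_perp M p (tangent_space_of M P p)}"

definition focal_instant ::
  "('m::topological_space, 'n::finite) semi_riemannian \<Rightarrow> (real \<Rightarrow> 'm) \<Rightarrow> real \<Rightarrow> real \<Rightarrow>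
     'm set \<Rightarrow> (real ^ 'n \<Rightarrow> real ^ 'n) \<Rightarrow> real \<Rightarrow> bool" where
  "focal_instant M \<gamma> a b P S t \<longleftrightarrow> t \<in> {a<..b} \<and>
     lag_curve M \<gamma> a b t \<inter> lag_submanifold M P (\<gamma> a) S \<noteq> {0}"

definition conjugate_instant ::
  "('m, 'n::finite) semi_riemannian \<Rightarrow> (real \<Rightarrow> 'm) \<Rightarrow> real \<Rightarrow> real \<Rightarrow> real \<Rightarrow> bool" where
  "conjugate_instant M \<gamma> a b t \<longleftrightarrow> t \<in> {a<..b} \<and> lag_curve M \<gamma> a b t \<inter> lag_point \<noteq> {0}"

end

theory Submission
  imports Defs
begin

text \<open>
  If the Lagrangians \<open>\<ell>(t)\<close> are all transverse to a Lagrangian \<open>L\<^sub>1\<close>, then, \<open>[\<alpha>,\<beta>]\<close> being compact,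
  they are also transverse to every Lagrangian close to \<open>L\<^sub>1\<close>. A small perturbation of \<open>L\<^sub>1\<close> in a
  suitable direction is moreover transverse to \<open>L\<^sub>0\<close>, so that the index \<open>\<mu>\<close> with respect to \<open>L\<^sub>0\<close> can be
  read off in a single chart, and the forms representing the \<open>\<ell>(t)\<close> there are negative definite on
  \<open>L\<^sub>0 \<inter> L\<^sub>1\<close>. Both \<open>n\<^sub>+\<close> at the ends of the path hence lie between \<open>0\<close> and the codimension of
  \<open>L\<^sub>0 \<inter> L\<^sub>1\<close> in \<open>L\<^sub>0\<close>, and \<open>\<bar>\<mu>\<bar>\<close> is at most this codimension. For the Lagrangians of the point and of
  the submanifold, in either order, it equals \<open>dim P\<close>.

  This needs \<open>\<ell>\<close> to be a continuous curve of Lagrangians: the Jacobi equation is a linear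
  differential equation along the geodesic with continuous coefficients (the curvature is a tensor),
  \<open>\<ell>(t)\<close> is the kernel of a surjective map depending continuously on \<open>t\<close>, and the symplectic form is
  constant on pairs of Jacobi fields by the pair symmetry of the curvature.
\<close>

section \<open>Calculus of smooth maps\<close>

text \<open>\<open>L1\<close> itself cannot define the chart: it may meet \<open>L0\<close>, and the
  chart clause for \<mu> asks for a reference transverse to \<open>L0\<close>. The perturbation
  sends y in \<open>L1\<close> to h y = y + \<epsilon> B y, where \<omega>(B y, x) = y \<bullet> x
  for all x in \<open>L1\<close>. If x lies in \<open>L0\<close> and \<open>L1\<close> and x + h y
  lies in \<ell>(t), the form at x is therefore \<epsilon> (y \<bullet> x). Since \<ell>(t) keeps a
  uniform distance from \<open>L1\<close>, the vector x + y of \<open>L1\<close> is shorter than y,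
  and this forces y \<bullet> x < 0.

  The geometric obstacle is that a tangent vector at p consists of its components in
  \<open>chart_at M p\<close>, a chart that may jump along \<gamma>. Components of a field along
  \<gamma> need not be continuous, so the Jacobi equation is not a single differential equation on
  \<open>real ^ 'n\<close>. It is solved chart by chart, and the pieces are joined by the
  transformation laws of the Christoffel and curvature expressions. As \<open>christoffel\<close> is
  given only implicitly, by the Koszul formula, its continuity and its derivatives are obtained by
  differentiating a linear system.\<close>

lemma smooth_on_has_derivative:
  assumes "smooth_on S f" "x \<in> S"
  shows "(f has_derivative frechet_derivative f (at x)) (at x)"
proof -
  have "C_k_on (Suc 0) f S" using assms(1) unfolding smooth_on_def by blast
  then show ?thesis using assms(2) by (simp add: frechet_derivative_works)
qed

lemma smooth_on_frechet_derivative: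
  assumes "smooth_on S f"
  shows "smooth_on S (\<lambda>x. frechet_derivative f (at x) v)"
  unfolding smooth_on_def
proof
  fix k
  have "C_k_on (Suc k) f S" using assms unfolding smooth_on_def by blast
  then show "C_k_on k (\<lambda>x. frechet_derivative f (at x) v) S" by simp
qed

lemma smooth_on_continuous_on: "smooth_on S f \<Longrightarrow> continuous_on S f"
  unfolding smooth_on_def by (metis C_k_on.simps(1))

text \<open>The second difference over the parallelogram with sides \<open>t u\<close> and
  \<open>t v\<close> is the increment of \<phi>, a difference in the direction \<open>v\<close>, as
  its base point moves along \<open>u\<close>. A second mean value along \<open>v\<close> leaves one
  value of the second derivative inside the parallelogram.\<close>

lemma mixed_difference_mean_value:
  fixes f :: "'a::real_normed_vector \<Rightarrow> real"
  assumes t: "0 < t"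
    and f1: "\<And>y. y \<in> S \<Longrightarrow> (f has_derivative f' y) (at y)"
    and f2: "\<And>y. y \<in> S \<Longrightarrow> ((\<lambda>z. f' z u) has_derivative fu y) (at y)"
    and S: "\<And>r s. \<lbrakk>r \<in> {0..t}; s \<in> {0..t}\<rbrakk> \<Longrightarrow> x + r *\<^sub>R u + s *\<^sub>R v \<in> S"
  obtains r s where "r \<in> {0..t}" "s \<in> {0..t}"
    "f (x + t *\<^sub>R u + t *\<^sub>R v) - f (x + t *\<^sub>R u) - (f (x + t *\<^sub>R v) - f x) = t * t * fu (x + r *\<^sub>R u + s *\<^sub>R v) v"
proof -
  define \<phi> where "\<phi> r = f (x + r *\<^sub>R u + t *\<^sub>R v) - f (x + r *\<^sub>R u)" for r
  have lin1: "linear (f' y)" if "y \<in> S" for y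
    using f1[OF that] has_derivative_linear by blast
  have lin2: "linear (fu y)" if "y \<in> S" for y
    using f2[OF that] has_derivative_linear by blast
  have d1: "((\<lambda>r. f (x + r *\<^sub>R u + s *\<^sub>R v)) has_derivative (\<lambda>h. h * f' (x + r *\<^sub>R u + s *\<^sub>R v) u)) (at r within X)"
    if "r \<in> {0..t}" "s \<in> {0..t}" for r s X
  proof -
    have "((\<lambda>r. x + r *\<^sub>R u + s *\<^sub>R v) has_derivative (\<lambda>h. h *\<^sub>R u)) (at r within X)"
      by (auto intro!: derivative_eq_intros)
    from has_derivative_compose[OF this f1[OF S[OF that]]] show ?thesis
      by (simp add: linear_scale[OF lin1[OF S[OF that]]])
  qed
  have "(\<phi> has_derivative (\<lambda>h. h * (f' (x + r *\<^sub>R u + t *\<^sub>R v) u - f' (x + r *\<^sub>R u) u))) (at r within {0..t})"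
    if "r \<in> {0..t}" for r
  proof -
    have z: "0 \<in> {0..t}" "t \<in> {0..t}" using t by auto
    from has_derivative_diff[OF d1[OF that z(2)] d1[OF that z(1)]] show ?thesis
      by (simp add: \<phi>_def[abs_def] algebra_simps)
  qed
  then obtain r where r: "r \<in> {0..t}" and
    e1: "\<phi> t - \<phi> 0 = (t - 0) * (f' (x + r *\<^sub>R u + t *\<^sub>R v) u - f' (x + r *\<^sub>R u) u)"
    using mvt_very_simple[of 0 t \<phi> "\<lambda>r h. h * (f' (x + r *\<^sub>R u + t *\<^sub>R v) u - f' (x + r *\<^sub>R u) u)"] t
    by force
  have "((\<lambda>s. f' (x + r *\<^sub>R u + s *\<^sub>R v) u) has_derivative (\<lambda>h. h * fu (x + r *\<^sub>R u + s *\<^sub>R v) v)) (at s within {0..t})"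
    if s: "s \<in> {0..t}" for s
  proof -
    have "((\<lambda>s. x + r *\<^sub>R u + s *\<^sub>R v) has_derivative (\<lambda>h. h *\<^sub>R v)) (at s within {0..t})"
      by (auto intro!: derivative_eq_intros)
    from has_derivative_compose[OF this f2[OF S[OF r s]]] show ?thesis
      by (simp add: linear_scale[OF lin2[OF S[OF r s]]])
  qed
  then obtain s where s: "s \<in> {0..t}" and
    e2: "f' (x + r *\<^sub>R u + t *\<^sub>R v) u - f' (x + r *\<^sub>R u + 0 *\<^sub>R v) u = (t - 0) * fu (x + r *\<^sub>R u + s *\<^sub>R v) v"
    using mvt_very_simple[of 0 t "\<lambda>s. f' (x + r *\<^sub>R u + s *\<^sub>R v) u" "\<lambda>s h. h * fu (x + r *\<^sub>R u + s *\<^sub>R v) v"] t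
    by force
  show thesis
    by (rule that[OF r s]) (use e1 e2 in \<open>simp add: \<phi>_def\<close>)
qed

text \<open>Schwarz's theorem: swapping \<open>u\<close> and \<open>v\<close> does not change the
  second difference, so the two mean values coincide, while continuity brings each of them closer
  than half the supposed gap to its value at \<open>x\<close>.\<close>

lemma symmetric_second_derivative_real:
  fixes f :: "'a::real_normed_vector \<Rightarrow> real"
  assumes S: "open S" "x \<in> S"
    and f1: "\<And>y. y \<in> S \<Longrightarrow> (f has_derivative f' y) (at y)"
    and f2: "\<And>y. y \<in> S \<Longrightarrow> ((\<lambda>z. f' z u) has_derivative fu y) (at y)"
    and f3: "\<And>y. y \<in> S \<Longrightarrow> ((\<lambda>z. f' z v) has_derivative fv y) (at y)"
    and c2: "continuous_on S (\<lambda>y. fu y v)" and c3: "continuous_on S (\<lambda>y. fv y u)"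
  shows "fu x v = fv x u"
proof (rule ccontr)
  assume ne: "fu x v \<noteq> fv x u"
  define e where "e = \<bar>fu x v - fv x u\<bar> / 2"
  have e: "e > 0" using ne by (simp add: e_def)
  obtain d1 where d1: "d1 > 0" "\<And>y. y \<in> S \<Longrightarrow> dist y x < d1 \<Longrightarrow> dist (fu y v) (fu x v) < e"
    using c2 S(2) e unfolding continuous_on_iff by metis
  obtain d2 where d2: "d2 > 0" "\<And>y. y \<in> S \<Longrightarrow> dist y x < d2 \<Longrightarrow> dist (fv y u) (fv x u) < e"
    using c3 S(2) e unfolding continuous_on_iff by metis
  obtain d3 where d3: "d3 > 0" "\<And>y. dist y x < d3 \<Longrightarrow> y \<in> S"
    using S unfolding open_dist by metis
  define d where "d = min d1 (min d2 d3)"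
  have d: "d > 0" using d1 d2 d3 by (simp add: d_def)
  define t where "t = d / (2 * (norm u + norm v + 1))"
  have t: "t > 0" using d by (simp add: t_def add_nonneg_pos)
  have near: "dist (x + r *\<^sub>R u + s *\<^sub>R v) x < d" if "r \<in> {0..t}" "s \<in> {0..t}" for r s
  proof -
    have "dist (x + r *\<^sub>R u + s *\<^sub>R v) x = norm (r *\<^sub>R u + s *\<^sub>R v)"
      by (simp add: dist_norm algebra_simps)
    also have "\<dots> \<le> r * norm u + s * norm v"
      using norm_triangle_ineq[of "r *\<^sub>R u" "s *\<^sub>R v"] that by simp
    also have "\<dots> \<le> t * norm u + t * norm v"
      using that by (intro add_mono mult_right_mono) auto
    also have "\<dots> \<le> t * (norm u + norm v + 1)" using t by (simp add: algebra_simps)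
    also have "\<dots> = d / 2"
    proof -
      have "norm u + norm v + 1 > 0" by (simp add: add_nonneg_pos)
      then show ?thesis unfolding t_def by (simp add: divide_simps)
    qed
    finally show ?thesis using d by linarith
  qed
  have inS: "x + r *\<^sub>R u + s *\<^sub>R v \<in> S" if "r \<in> {0..t}" "s \<in> {0..t}" for r s
    using d3(2) near[OF that] by (simp add: d_def)
  have inS': "x + r *\<^sub>R v + s *\<^sub>R u \<in> S" if "r \<in> {0..t}" "s \<in> {0..t}" for r s
    using inS[OF that(2,1)] by (simp add: algebra_simps)
  obtain r s where rs: "r \<in> {0..t}" "s \<in> {0..t}" and
    A: "f (x + t *\<^sub>R u + t *\<^sub>R v) - f (x + t *\<^sub>R u) - (f (x + t *\<^sub>R v) - f x) = t * t * fu (x + r *\<^sub>R u + s *\<^sub>R v) v"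
    using mixed_difference_mean_value[of t S f f' u fu x v, OF t f1 f2 inS] by metis
  obtain r' s' where rs': "r' \<in> {0..t}" "s' \<in> {0..t}" and
    B: "f (x + t *\<^sub>R v + t *\<^sub>R u) - f (x + t *\<^sub>R v) - (f (x + t *\<^sub>R u) - f x) = t * t * fv (x + r' *\<^sub>R v + s' *\<^sub>R u) u"
    using mixed_difference_mean_value[of t S f f' v fv x u, OF t f1 f3 inS'] by metis
  have "t * t * fu (x + r *\<^sub>R u + s *\<^sub>R v) v = t * t * fv (x + r' *\<^sub>R v + s' *\<^sub>R u) u"
    using A B by (simp add: algebra_simps)
  then have eq: "fu (x + r *\<^sub>R u + s *\<^sub>R v) v = fv (x + r' *\<^sub>R v + s' *\<^sub>R u) u" using t by simp
  have 1: "dist (fu (x + r *\<^sub>R u + s *\<^sub>R v) v) (fu x v) < e"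
    using d1(2) inS[OF rs] near[OF rs] by (simp add: d_def)
  have 2: "dist (fv (x + r' *\<^sub>R v + s' *\<^sub>R u) u) (fv x u) < e"
    using d2(2) inS'[OF rs'] near[OF rs'(2,1)] by (simp add: d_def algebra_simps)
  have "dist (fu x v) (fv x u) < e + e"
    using 1 2 eq dist_triangle_less_add by (metis dist_commute)
  then show False by (simp add: e_def dist_real_def)
qed

text \<open>Applied to metric coefficients, this yields the skewness of the curvature in its last
  arguments; applied to transition maps and their differentials, it cancels the higher derivatives
  in the transformation laws.\<close>

lemma symmetric_second_derivative:
  fixes f :: "'a::real_normed_vector \<Rightarrow> 'b::euclidean_space"
  assumes S: "open S" "x \<in> S" and f: "smooth_on S f"
  shows "frechet_derivative (\<lambda>y. frechet_derivative f (at y) u) (at x) v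
       = frechet_derivative (\<lambda>y. frechet_derivative f (at y) v) (at x) u"
proof (rule euclidean_eqI)
  fix b :: 'b assume "b \<in> Basis"
  let ?D = "\<lambda>w y. frechet_derivative (\<lambda>y. frechet_derivative f (at y) w) (at y)"
  have d1: "((\<lambda>y. f y \<bullet> b) has_derivative (\<lambda>h. frechet_derivative f (at y) h \<bullet> b)) (at y)" if "y \<in> S" for y
    using smooth_on_has_derivative[OF f that] by (rule has_derivative_inner_left)
  have d2: "((\<lambda>y. frechet_derivative f (at y) w \<bullet> b) has_derivative (\<lambda>h. ?D w y h \<bullet> b)) (at y)" if "y \<in> S" for y w
    using smooth_on_has_derivative[OF smooth_on_frechet_derivative[OF f] that] by (rule has_derivative_inner_left)
  have c: "continuous_on S (\<lambda>y. ?D w y z \<bullet> b)" for w z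
    by (intro continuous_intros smooth_on_continuous_on smooth_on_frechet_derivative f)
  show "?D u x v \<bullet> b = ?D v x u \<bullet> b"
    by (rule symmetric_second_derivative_real[OF S d1 d2 d2 c c])
qed

section \<open>Families of linear maps\<close>

lemma linear_sum_Basis:
  fixes f :: "'e::euclidean_space \<Rightarrow> 'f::real_vector"
  assumes "linear f"
  shows "f v = (\<Sum>i\<in>Basis. (v \<bullet> i) *\<^sub>R f i)"
  by (metis (no_types, lifting) assms euclidean_representation linear_scale linear_sum sum.cong)

text \<open>In finite dimension continuity at each fixed argument is enough, because the moving
  argument can be expanded in the standard basis.\<close>

lemma continuous_on_linear_apply:
  fixes A :: "'s::topological_space \<Rightarrow> 'e::euclidean_space \<Rightarrow> 'f::real_normed_vector"
  assumes lin: "\<And>s. s \<in> X \<Longrightarrow> linear (A s)"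
    and A: "\<And>v. continuous_on X (\<lambda>s. A s v)" and p: "continuous_on X p"
  shows "continuous_on X (\<lambda>s. A s (p s))"
proof -
  have "continuous_on X (\<lambda>s. \<Sum>i\<in>Basis. (p s \<bullet> i) *\<^sub>R A s i)"
    by (intro continuous_intros A p)
  then show ?thesis
    by (rule continuous_on_eq) (simp add: linear_sum_Basis[OF lin, symmetric])
qed

text \<open>Near \<open>s0\<close> the map \<open>g\<close> is of first order, so a factor that
  merely tends to 0 makes the product of higher order.\<close>

lemma has_derivative_scaleR_vanishing:
  fixes f :: "'s::real_normed_vector \<Rightarrow> real" and g :: "'s \<Rightarrow> 'f::real_normed_vector"
  assumes f: "(f \<longlongrightarrow> 0) (at s0 within X)" and g: "(g has_derivative g') (at s0 within X)"
    and z: "g s0 = 0"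
  shows "((\<lambda>s. f s *\<^sub>R g s) has_derivative (\<lambda>h. 0)) (at s0 within X)"
proof -
  have bl: "bounded_linear g'" using g has_derivative_bounded_linear by blast
  then obtain K where K: "\<And>h. norm (g' h) \<le> norm h * K" and "K > 0"
    using bounded_linear.pos_bounded by metis
  have 1: "((\<lambda>s. (g s - g' (s - s0)) /\<^sub>R norm (s - s0)) \<longlongrightarrow> 0) (at s0 within X)"
    using g z unfolding has_derivative_at_within by simp
  have 2: "((\<lambda>s. f s *\<^sub>R ((g s - g' (s - s0)) /\<^sub>R norm (s - s0))) \<longlongrightarrow> 0) (at s0 within X)"
    using tendsto_scaleR[OF f 1] by simp
  have 3: "((\<lambda>s. f s *\<^sub>R (g' (s - s0) /\<^sub>R norm (s - s0))) \<longlongrightarrow> 0) (at s0 within X)"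
  proof (rule Lim_null_comparison)
    show "((\<lambda>s. \<bar>f s\<bar> * K) \<longlongrightarrow> 0) (at s0 within X)"
      using tendsto_mult_right[OF tendsto_rabs_zero[OF f], of K] by simp
    have "norm (f s *\<^sub>R (g' (s - s0) /\<^sub>R norm (s - s0))) \<le> \<bar>f s\<bar> * K" for s
    proof (cases "s = s0")
      case True then show ?thesis using \<open>K > 0\<close> bl by (simp add: bounded_linear.linear linear_0)
    next
      case False
      then have "norm (g' (s - s0)) / norm (s - s0) \<le> K" using K[of "s - s0"] by (simp add: field_simps)
      then have "\<bar>f s\<bar> * (norm (g' (s - s0)) / norm (s - s0)) \<le> \<bar>f s\<bar> * K" by (intro mult_left_mono) auto
      then show ?thesis by (simp add: divide_inverse abs_mult ac_simps)
    qed
    then show "\<forall>\<^sub>F s in at s0 within X. norm (f s *\<^sub>R (g' (s - s0) /\<^sub>R norm (s - s0))) \<le> \<bar>f s\<bar> * K" by simp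
  qed
  have "((\<lambda>s. (f s *\<^sub>R g s) /\<^sub>R norm (s - s0)) \<longlongrightarrow> 0) (at s0 within X)"
    using tendsto_add[OF 2 3] by (simp add: algebra_simps)
  then show ?thesis unfolding has_derivative_at_within using z by (simp add: bounded_linear_zero)
qed

text \<open>This is the second-order term of the product rule, the increment of \<open>A\<close>
  applied to the increment of \<open>p\<close>. It asks only for continuity of \<open>p\<close> at
  \<open>s0\<close>, so it can be used in \<open>has_derivative_linear_solve\<close>, where
  \<open>p\<close> is a solution whose differentiability is still to be shown.\<close>

lemma has_derivative_linear_apply_vanishing:
  fixes A :: "'s::real_normed_vector \<Rightarrow> 'e::euclidean_space \<Rightarrow> 'f::real_normed_vector"
  assumes lin: "\<And>s. s \<in> X \<Longrightarrow> linear (A s)" and s0: "s0 \<in> X"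
    and A': "\<And>v. ((\<lambda>s. A s v) has_derivative A' v) (at s0 within X)"
    and p: "(p \<longlongrightarrow> p s0) (at s0 within X)"
  shows "((\<lambda>s. A s (p s - p s0) - A s0 (p s - p s0)) has_derivative (\<lambda>h. 0)) (at s0 within X)"
proof -
  have 1: "((\<lambda>s. \<Sum>i\<in>Basis. ((p s - p s0) \<bullet> i) *\<^sub>R (A s i - A s0 i)) has_derivative (\<lambda>h. \<Sum>i\<in>(Basis::'e set). 0)) (at s0 within X)"
  proof (rule has_derivative_sum, rule has_derivative_scaleR_vanishing)
    fix i :: 'e
    show "((\<lambda>s. (p s - p s0) \<bullet> i) \<longlongrightarrow> 0) (at s0 within X)"
      using tendsto_inner[OF tendsto_diff[OF p tendsto_const] tendsto_const, of "p s0" i] by simp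
    show "((\<lambda>s. A s i - A s0 i) has_derivative (\<lambda>h. A' i h - 0)) (at s0 within X)"
      by (intro has_derivative_diff A' has_derivative_const)
  qed simp
  have 2: "A s (p s - p s0) - A s0 (p s - p s0) = (\<Sum>i\<in>Basis. ((p s - p s0) \<bullet> i) *\<^sub>R (A s i - A s0 i))"
    if "s \<in> X" for s
    by (simp add: linear_sum_Basis[OF lin[OF that], of "p s - p s0"] linear_sum_Basis[OF lin[OF s0], of "p s - p s0"]
        scaleR_diff_right sum_subtractf)
  show ?thesis
    using has_derivative_transform[OF s0 2 1] by simp
qed

lemma has_derivative_linear_apply:
  fixes A :: "'s::real_normed_vector \<Rightarrow> 'e::euclidean_space \<Rightarrow> 'f::real_normed_vector"
  assumes lin: "\<And>s. s \<in> X \<Longrightarrow> linear (A s)" and s0: "s0 \<in> X"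
    and A': "\<And>v. ((\<lambda>s. A s v) has_derivative A' v) (at s0 within X)"
    and p: "(p has_derivative p') (at s0 within X)"
  shows "((\<lambda>s. A s (p s)) has_derivative (\<lambda>h. A' (p s0) h + A s0 (p' h))) (at s0 within X)"
proof -
  have bl: "bounded_linear (A s0)" using lin[OF s0] linear_conv_bounded_linear by blast
  have pc: "(p \<longlongrightarrow> p s0) (at s0 within X)"
    using has_derivative_continuous[OF p] by (simp add: continuous_within)
  have "((\<lambda>s. A s0 (p s - p s0)) has_derivative (\<lambda>h. A s0 (p' h - 0))) (at s0 within X)"
    by (intro bounded_linear.has_derivative[OF bl] has_derivative_diff p has_derivative_const)
  from has_derivative_add[OF has_derivative_add[OF A'[of "p s0"] this]
      has_derivative_linear_apply_vanishing[where p = p, OF lin s0 A' pc]]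
  have "((\<lambda>s. A s (p s0) + A s0 (p s - p s0) + (A s (p s - p s0) - A s0 (p s - p s0)))
    has_derivative (\<lambda>h. A' (p s0) h + A s0 (p' h))) (at s0 within X)" by simp
  then show ?thesis
    by (rule has_derivative_transform[OF s0, rotated]) (simp add: linear_diff lin)
qed

lemma has_derivative_bilinear_apply:
  fixes B :: "'s::real_normed_vector \<Rightarrow> 'e::euclidean_space \<Rightarrow> 'g::euclidean_space \<Rightarrow> 'f::real_normed_vector"
  assumes lin: "\<And>s. s \<in> X \<Longrightarrow> bilinear (B s)" and s0: "s0 \<in> X"
    and B': "\<And>u v. ((\<lambda>s. B s u v) has_derivative B' u v) (at s0 within X)"
    and p: "(p has_derivative p') (at s0 within X)" and q: "(q has_derivative q') (at s0 within X)"
  shows "((\<lambda>s. B s (p s) (q s)) has_derivative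
    (\<lambda>h. B' (p s0) (q s0) h + B s0 (p' h) (q s0) + B s0 (p s0) (q' h))) (at s0 within X)"
proof (rule has_derivative_linear_apply[OF _ s0 _ q])
  fix s assume "s \<in> X" then show "linear (B s (p s))" using lin bilinear_def by blast
next
  fix v
  show "((\<lambda>s. B s (p s) v) has_derivative (\<lambda>h. B' (p s0) v h + B s0 (p' h) v)) (at s0 within X)"
    by (rule has_derivative_linear_apply[OF _ s0 _ p, where A = "\<lambda>s u. B s u v"])
      (use lin B' bilinear_def in blast)+
qed

lemma continuous_on_bilinear_apply:
  fixes B :: "'s::topological_space \<Rightarrow> 'e::euclidean_space \<Rightarrow> 'g::euclidean_space \<Rightarrow> 'f::real_normed_vector"
  assumes lin: "\<And>s. s \<in> X \<Longrightarrow> bilinear (B s)"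
    and B: "\<And>u v. continuous_on X (\<lambda>s. B s u v)"
    and p: "continuous_on X p" and q: "continuous_on X q"
  shows "continuous_on X (\<lambda>s. B s (p s) (q s))"
proof (rule continuous_on_linear_apply[OF _ _ q])
  fix s assume "s \<in> X" then show "linear (B s (p s))" using lin bilinear_def by blast
next
  fix v show "continuous_on X (\<lambda>s. B s (p s) v)"
    by (rule continuous_on_linear_apply[OF _ _ p, where A = "\<lambda>s u. B s u v"])
      (use lin B bilinear_def in blast)+
qed

text \<open>Injectivity bounds \<open>A s0\<close> below by some c > 0. Near \<open>s0\<close> the
  maps differ from it by less than c / 2 in norm, hence are bounded below by c / 2, and the
  increment of \<open>y\<close> is controlled by the residual \<open>b s - A s (y s0)\<close>, which
  tends to 0.\<close>

lemma continuous_on_linear_solve: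
  fixes A :: "'s::topological_space \<Rightarrow> 'e::euclidean_space \<Rightarrow> 'f::euclidean_space"
  assumes lin: "\<And>s. s \<in> X \<Longrightarrow> linear (A s)" and inj: "\<And>s. s \<in> X \<Longrightarrow> inj (A s)"
    and A: "\<And>v. continuous_on X (\<lambda>s. A s v)" and b: "continuous_on X b"
    and y: "\<And>s. s \<in> X \<Longrightarrow> A s (y s) = b s"
  shows "continuous_on X y"
  unfolding continuous_on_def
proof
  fix s0 assume s0: "s0 \<in> X"
  obtain c where c: "c > 0" "\<And>v. c * norm v \<le> norm (A s0 v)"
    using linear_inj_bounded_below_pos[OF lin[OF s0] inj[OF s0]] by metis
  have "((\<lambda>s. \<Sum>i\<in>Basis. norm (A s i - A s0 i)) \<longlongrightarrow> (\<Sum>i\<in>Basis. norm (A s0 i - A s0 i))) (at s0 within X)"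
    using A s0 unfolding continuous_on_def by (intro tendsto_intros) blast
  then have "((\<lambda>s. \<Sum>i\<in>Basis. norm (A s i - A s0 i)) \<longlongrightarrow> 0) (at s0 within X)" by simp
  then have ev: "\<forall>\<^sub>F s in at s0 within X. (\<Sum>i\<in>Basis. norm (A s i - A s0 i)) < c / 2"
    using c by (intro order_tendstoD) auto
  have 1: "((\<lambda>s. (2 / c) * norm (b s - A s (y s0))) \<longlongrightarrow> (2 / c) * norm (b s0 - A s0 (y s0))) (at s0 within X)"
    using A b s0 unfolding continuous_on_def by (intro tendsto_intros) blast+
  have "((\<lambda>s. y s - y s0) \<longlongrightarrow> 0) (at s0 within X)"
  proof (rule Lim_null_comparison)
    show "((\<lambda>s. (2 / c) * norm (b s - A s (y s0))) \<longlongrightarrow> 0) (at s0 within X)"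
      using 1 y[OF s0] by simp
    have inX: "\<forall>\<^sub>F s in at s0 within X. s \<in> X" by (simp add: eventually_at_filter)
    show "\<forall>\<^sub>F s in at s0 within X. norm (y s - y s0) \<le> (2 / c) * norm (b s - A s (y s0))"
      using ev inX
    proof eventually_elim
      case (elim s)
      let ?v = "y s - y s0"
      have "norm (A s ?v - A s0 ?v) = norm (\<Sum>i\<in>Basis. (?v \<bullet> i) *\<^sub>R (A s i - A s0 i))"
        by (simp add: linear_sum_Basis[OF lin[OF elim(2)], of ?v] linear_sum_Basis[OF lin[OF s0], of ?v]
            scaleR_diff_right sum_subtractf)
      also have "\<dots> \<le> (\<Sum>i\<in>Basis. norm ?v * norm (A s i - A s0 i))"
        by (rule sum_norm_le) (auto intro!: mult_right_mono Basis_le_norm)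
      also have "\<dots> \<le> norm ?v * (c / 2)"
        unfolding sum_distrib_left[symmetric] using elim(1) by (intro mult_left_mono) auto
      finally have "c * norm ?v - norm ?v * (c / 2) \<le> norm (A s ?v)"
        using c(2)[of ?v] norm_triangle_ineq3[of "A s0 ?v" "A s ?v"] norm_minus_commute[of "A s0 ?v" "A s ?v"] by linarith
      moreover have "A s ?v = b s - A s (y s0)" using y[OF elim(2)] by (simp add: linear_diff lin elim(2))
      ultimately have "c / 2 * norm ?v \<le> norm (b s - A s (y s0))" by (simp add: mult.commute)
      then show ?case using c(1) by (simp add: field_simps)
    qed
  qed
  then show "(y \<longlongrightarrow> y s0) (at s0 within X)" using LIM_zero_iff by blast
qed

text \<open>Implicit differentiation. With the inverse \<open>G\<close> of \<open>A s0\<close>, the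
  equation becomes an explicit formula for \<open>y s\<close> up to a remainder of derivative 0, for
  which the continuity of \<open>y\<close> suffices.\<close>

lemma has_derivative_linear_solve:
  fixes A :: "'s::real_normed_vector \<Rightarrow> 'e::euclidean_space \<Rightarrow> 'e"
  assumes lin: "\<And>s. s \<in> X \<Longrightarrow> linear (A s)" and inj: "\<And>s. s \<in> X \<Longrightarrow> inj (A s)" and s0: "s0 \<in> X"
    and A: "\<And>v. continuous_on X (\<lambda>s. A s v)" and b: "continuous_on X b"
    and A': "\<And>v. ((\<lambda>s. A s v) has_derivative A' v) (at s0 within X)"
    and b': "(b has_derivative b') (at s0 within X)"
    and y: "\<And>s. s \<in> X \<Longrightarrow> A s (y s) = b s"
  obtains y' where "(y has_derivative y') (at s0 within X)" "\<And>h. A s0 (y' h) = b' h - A' (y s0) h"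
proof -
  obtain G where G: "linear G" "G \<circ> A s0 = id" "A s0 \<circ> G = id"
    using linear_injective_isomorphism[OF lin[OF s0] inj[OF s0]] by (metis ext comp_apply id_apply)
  have GA: "G (A s0 v) = v" "A s0 (G v) = v" for v using G(2,3) by (metis comp_apply id_apply)+
  have bl: "bounded_linear G" using G(1) linear_conv_bounded_linear by blast
  have yc: "(y \<longlongrightarrow> y s0) (at s0 within X)"
    using continuous_on_linear_solve[OF lin inj A b y] s0 unfolding continuous_on_def by blast
  have 1: "((\<lambda>s. y s0 + G (b s - A s (y s0) - (A s (y s - y s0) - A s0 (y s - y s0))))
     has_derivative (\<lambda>h. 0 + G (b' h - A' (y s0) h - 0))) (at s0 within X)"
    by (intro has_derivative_add has_derivative_const bounded_linear.has_derivative[OF bl] has_derivative_diff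
        b' A' has_derivative_linear_apply_vanishing[where p = y, OF lin s0 A' yc])
  have 2: "y s = y s0 + G (b s - A s (y s0) - (A s (y s - y s0) - A s0 (y s - y s0)))" if "s \<in> X" for s
  proof -
    have "b s - A s (y s0) - (A s (y s - y s0) - A s0 (y s - y s0)) = A s0 (y s - y s0)"
      using y[OF that] by (simp add: linear_diff lin that)
    then show ?thesis by (simp add: GA)
  qed
  have "(y has_derivative (\<lambda>h. G (b' h - A' (y s0) h))) (at s0 within X)"
    using has_derivative_transform[OF s0 2 1] by simp
  then show thesis by (rule that) (simp add: GA)
qed

section \<open>Nondegenerate bilinear forms\<close>

text \<open>The Riesz representative of \<open>B z\<close>. It turns identities tested against all
  vectors into one vector equation, so that the results on linear systems apply.\<close>

definition form_vector :: "('v::euclidean_space \<Rightarrow> 'v \<Rightarrow> real) \<Rightarrow> 'v \<Rightarrow> 'v" where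
  "form_vector B z = (\<Sum>i\<in>Basis. B z i *\<^sub>R i)"

lemma inner_form_vector:
  assumes "bilinear B"
  shows "form_vector B z \<bullet> v = B z v"
proof -
  have "linear (B z)" using assms bilinear_def by blast
  from linear_sum_Basis[OF this, of v] show ?thesis
    by (simp add: form_vector_def inner_sum_left inner_commute[of v] mult.commute)
qed

lemma linear_form_vector:
  assumes "bilinear B"
  shows "linear (form_vector B)"
  by (rule linearI) (simp_all add: form_vector_def bilinear_ladd[OF assms] bilinear_lmul[OF assms]
      scaleR_left_distrib sum.distrib scaleR_sum_right)

lemma inj_form_vector:
  fixes B :: "'v::euclidean_space \<Rightarrow> 'v \<Rightarrow> real"
  assumes "bilinear B" "\<And>x. (\<And>y. B x y = 0) \<Longrightarrow> x = 0"
  shows "inj (form_vector B)"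
proof -
  have "z = 0" if "form_vector B z = 0" for z
    using assms(2)[of z] inner_form_vector[OF assms(1), of z] that by simp
  then show ?thesis using linear_injective_0[OF linear_form_vector[OF assms(1)]] by blast
qed

lemma form_vector_eq_iff:
  assumes "bilinear B"
  shows "form_vector B z = (\<Sum>i\<in>Basis. f i *\<^sub>R i) \<longleftrightarrow> (\<forall>i\<in>Basis. B z i = f i)"
  unfolding euclidean_eq_iff[of "form_vector B z"]
  by (simp add: inner_form_vector[OF assms])

lemma ex1_form_represents:
  fixes B :: "'v::euclidean_space \<Rightarrow> 'v \<Rightarrow> real"
  assumes "bilinear B" "\<And>x. (\<And>y. B x y = 0) \<Longrightarrow> x = 0" "linear f"
  shows "\<exists>!z. \<forall>w. B z w = f w"
proof -
  have "surj (form_vector B)"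
    by (rule linear_inj_imp_surj[OF linear_form_vector[OF assms(1)] inj_form_vector[OF assms(1,2)]])
  then obtain z where z: "form_vector B z = (\<Sum>i\<in>Basis. f i *\<^sub>R i)" by (metis surjD)
  have "B z w = f w" for w
    using inner_form_vector[OF assms(1), of z w] linear_sum_Basis[OF assms(3), of w]
    by (simp add: z inner_sum_left inner_commute[of w] mult.commute)
  moreover have "z' = z" if "\<forall>w. B z' w = f w" for z'
    using assms(2)[of "z' - z"] that calculation by (simp add: bilinear_lsub[OF assms(1)])
  ultimately show ?thesis by blast
qed

section \<open>Linear ordinary differential equations\<close>

text \<open>Picard iteration: K (y - x) \<le> 1/2 makes the integral operator \<open>T\<close> halve
  uniform distances, so the increments of the iterates are dominated by a geometric series.\<close>

lemma linear_ode_exists_short: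
  fixes A :: "real \<Rightarrow> 'e::euclidean_space \<Rightarrow> 'e"
  assumes xy: "x \<le> y" and lin: "\<And>t. t \<in> {x..y} \<Longrightarrow> linear (A t)"
    and A: "\<And>v. continuous_on {x..y} (\<lambda>t. A t v)"
    and K: "\<And>t v. t \<in> {x..y} \<Longrightarrow> norm (A t v) \<le> K * norm v" "0 \<le> K" "K * (y - x) \<le> 1 / 2"
  obtains w where "w x = w0" "\<And>t. t \<in> {x..y} \<Longrightarrow> (w has_vector_derivative A t (w t)) (at t within {x..y})"
proof -
  define T where "T w t = w0 + integral {x..t} (\<lambda>s. A s (w s))" for w t
  define W where "W = rec_nat (\<lambda>t. w0) (\<lambda>k. T)"
  have W0: "W 0 = (\<lambda>t. w0)" and WS: "W (Suc k) = T (W k)" for k by (simp_all add: W_def)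
  have cA: "continuous_on {x..y} (\<lambda>s. A s (w s))" if "continuous_on {x..y} w" for w
    by (rule continuous_on_linear_apply[OF lin A that])
  have dT: "(T w has_vector_derivative A t (w t)) (at t within {x..y})"
    if "continuous_on {x..y} w" "t \<in> {x..y}" for w t
    using has_vector_derivative_add[OF has_vector_derivative_const integral_has_vector_derivative[OF cA[OF that(1)] that(2)], of w0]
    by (simp add: T_def[abs_def])
  have cT: "continuous_on {x..y} (T w)" if "continuous_on {x..y} w" for w
    using dT[OF that] by (rule continuous_on_vector_derivative)
  have cW: "continuous_on {x..y} (W k)" for k
    by (induction k) (simp_all add: W0 WS cT)
  have contr: "norm (T w t - T w' t) \<le> B / 2"
    if w: "continuous_on {x..y} w" "continuous_on {x..y} w'" and t: "t \<in> {x..y}"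
      and B: "\<And>s. s \<in> {x..y} \<Longrightarrow> norm (w s - w' s) \<le> B" for w w' t B
  proof -
    have sub: "{x..t} \<subseteq> {x..y}" using t by auto
    have i: "(\<lambda>s. A s (w s)) integrable_on {x..t}" "(\<lambda>s. A s (w' s)) integrable_on {x..t}"
      using w cA continuous_on_subset[OF _ sub] integrable_continuous_interval by blast+
    have Bnn: "0 \<le> B" using B[OF t] norm_ge_zero order_trans by blast
    have "T w t - T w' t = integral {x..t} (\<lambda>s. A s (w s) - A s (w' s))"
      by (simp add: T_def integral_diff[OF i])
    also have "norm \<dots> \<le> (K * B) * (t - x)"
    proof (rule integral_bound)
      show "x \<le> t" using t by simp
      show "continuous_on {x..t} (\<lambda>s. A s (w s) - A s (w' s))"
        by (intro continuous_on_diff continuous_on_subset[OF _ sub] cA w)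
      fix s assume "s \<in> {x..t}"
      then have s: "s \<in> {x..y}" using sub by auto
      have "A s (w s) - A s (w' s) = A s (w s - w' s)" using linear_diff[OF lin[OF s]] by metis
      then show "norm (A s (w s) - A s (w' s)) \<le> K * B"
        using K(1)[OF s, of "w s - w' s"] mult_left_mono[OF B[OF s] K(2)] by simp
    qed
    also have "\<dots> \<le> (K * B) * (y - x)" using t K Bnn by (intro mult_left_mono) auto
    also have "\<dots> = (K * (y - x)) * B" by simp
    also have "\<dots> \<le> 1 / 2 * B" using K(3) Bnn by (rule mult_right_mono)
    finally show ?thesis by simp
  qed
  have "compact ((\<lambda>t. W 1 t - W 0 t) ` {x..y})"
    by (intro compact_continuous_image continuous_on_diff cW compact_Icc)
  from compact_imp_bounded[OF this] obtain M where M: "\<And>t. t \<in> {x..y} \<Longrightarrow> norm (W 1 t - W 0 t) \<le> M"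
    unfolding bounded_iff by blast
  have geo: "norm (W (Suc k) t - W k t) \<le> M * (1 / 2) ^ k" if "t \<in> {x..y}" for k t
    using that
  proof (induction k arbitrary: t)
    case 0 then show ?case using M[OF 0] by simp
  next
    case (Suc k)
    have "norm (T (W (Suc k)) t - T (W k) t) \<le> M * (1 / 2) ^ k / 2"
      by (rule contr[OF cW cW Suc.prems Suc.IH])
    then show ?case by (simp add: WS)
  qed
  define w where "w t = w0 + (\<Sum>k. W (Suc k) t - W k t)" for t
  have "uniform_limit {x..y} (\<lambda>n t. \<Sum>k<n. W (Suc k) t - W k t) (\<lambda>t. \<Sum>k. W (Suc k) t - W k t) sequentially"
    by (rule Weierstrass_m_test[OF geo]) (auto intro!: summable_mult summable_geometric)
  then have "uniform_limit {x..y} (\<lambda>n t. w0 + (\<Sum>k<n. W (Suc k) t - W k t)) w sequentially"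
    unfolding w_def by (intro uniform_limit_intros)
  moreover have "w0 + (\<Sum>k<n. W (Suc k) t - W k t) = W n t" for n t
    by (induction n) (simp_all add: W0 algebra_simps)
  ultimately have lim: "uniform_limit {x..y} W w sequentially" by simp
  have cw: "continuous_on {x..y} w"
    by (rule uniform_limit_theorem[OF _ lim]) (simp_all add: cW)
  have fix_eq: "T w t = w t" if t: "t \<in> {x..y}" for t
  proof (rule ccontr)
    assume "T w t \<noteq> w t"
    then have e: "norm (T w t - w t) / 2 > 0" by simp
    have "\<forall>\<^sub>F n in sequentially. \<forall>s\<in>{x..y}. dist (W n s) (w s) < norm (T w t - w t) / 2"
      using lim e unfolding uniform_limit_iff by blast
    then obtain N where N: "\<And>n s. n \<ge> N \<Longrightarrow> s \<in> {x..y} \<Longrightarrow> dist (W n s) (w s) < norm (T w t - w t) / 2"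
      unfolding eventually_sequentially by blast
    \<comment> \<open>With D the norm of \<open>T w t - w t\<close>, contraction turns D/2 into D/4,
      and the next iterate is within D/2 of the limit; hence D < 3D/4.\<close>
    have "norm (T w t - T (W N) t) \<le> (norm (T w t - w t) / 2) / 2"
      using N[of N] by (intro contr cw cW t) (simp add: dist_norm norm_minus_commute less_imp_le)
    moreover have "norm (W (Suc N) t - w t) < norm (T w t - w t) / 2" using N[of "Suc N" t] t by (simp add: dist_norm)
    moreover have "norm (T w t - w t) \<le> norm (T w t - T (W N) t) + norm (W (Suc N) t - w t)"
      using norm_triangle_ineq[of "T w t - T (W N) t" "W (Suc N) t - w t"] by (simp add: WS)
    ultimately show False using e by linarith
  qed
  show thesis
  proof (rule that)
    show "w x = w0" using fix_eq[of x] xy by (simp add: T_def)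
    show "(w has_vector_derivative A t (w t)) (at t within {x..y})" if "t \<in> {x..y}" for t
      by (rule has_vector_derivative_transform[OF that _ dT[OF cw that]]) (simp add: fix_eq)
  qed
qed

text \<open>At a maximum m of the norm of \<open>w\<close>, the mean value inequality from
  \<open>s\<close> bounds this norm by half of itself. As \<open>s\<close> may be any point of the
  interval, zeros propagate forward and backward.\<close>

lemma linear_ode_zero_short:
  fixes A :: "real \<Rightarrow> 'e::euclidean_space \<Rightarrow> 'e"
  assumes K: "\<And>t v. t \<in> {x..y} \<Longrightarrow> norm (A t v) \<le> K * norm v" "0 \<le> K" "K * (y - x) \<le> 1 / 2"
    and w: "\<And>t. t \<in> {x..y} \<Longrightarrow> (w has_vector_derivative A t (w t)) (at t within {x..y})"
    and s: "s \<in> {x..y}" "w s = 0" and t: "t \<in> {x..y}"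
  shows "w t = 0"
proof -
  have "continuous_on {x..y} w" using w by (rule continuous_on_vector_derivative)
  then have "continuous_on {x..y} (\<lambda>t. norm (w t))" by (rule continuous_on_norm)
  then obtain m where m: "m \<in> {x..y}" "\<And>t. t \<in> {x..y} \<Longrightarrow> norm (w t) \<le> norm (w m)"
    using continuous_attains_sup[of "{x..y}" "\<lambda>t. norm (w t)"] t by auto
  have "norm (w m - w s) \<le> (K * norm (w m)) * norm (m - s)"
  proof (rule differentiable_bound[of "{x..y}" w "\<lambda>t h. h *\<^sub>R A t (w t)"])
    fix t assume t: "t \<in> {x..y}"
    then show "(w has_derivative (\<lambda>h. h *\<^sub>R A t (w t))) (at t within {x..y})"
      using w by (simp add: has_vector_derivative_def)
    have "norm (A t (w t)) \<le> K * norm (w m)"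
      using K(1)[OF t, of "w t"] mult_left_mono[OF m(2)[OF t] K(2)] by simp
    then show "onorm (\<lambda>h. h *\<^sub>R A t (w t)) \<le> K * norm (w m)"
      by (intro onorm_le) (simp add: mult.commute mult_left_mono)
  qed (use m s in auto)
  also have "\<dots> \<le> (K * norm (w m)) * (y - x)"
    using m(1) s(1) K(2) by (intro mult_left_mono) auto
  also have "\<dots> = (K * (y - x)) * norm (w m)" by simp
  also have "\<dots> \<le> 1 / 2 * norm (w m)" using K(3) by (intro mult_right_mono) auto
  finally have "norm (w m) \<le> 0" using s(2) by simp
  then show ?thesis using m(2)[OF t] by simp
qed

lemma has_vector_derivative_within_Un:
  assumes "(f has_vector_derivative f') (at x within S)" "(f has_vector_derivative f') (at x within T)"
  shows "(f has_vector_derivative f') (at x within (S \<union> T))"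
  using assms unfolding has_vector_derivative_def has_derivative_at_within
  by (auto simp: at_within_union intro: filterlim_sup)

text \<open>A linear differential equation on a bundle over \<open>{a..b}\<close>: the fibre over \<open>t\<close> is read in the
  trivialisations \<open>F c t\<close>, defined for \<open>t\<close> in \<open>D c\<close>, where the equation is \<open>w' = A c t w\<close>.\<close>

locale linear_ode_bundle =
  fixes a b :: real and C :: "'c set" and D :: "'c \<Rightarrow> real set"
    and F A :: "'c \<Rightarrow> real \<Rightarrow> 'e::euclidean_space \<Rightarrow> 'e"
  assumes ab: "a \<le> b"
    and D_open: "c \<in> C \<Longrightarrow> openin (top_of_set {a..b}) (D c)"
    and D_cover: "t \<in> {a..b} \<Longrightarrow> \<exists>c\<in>C. t \<in> D c"
    and F_linear: "\<lbrakk>c \<in> C; t \<in> D c\<rbrakk> \<Longrightarrow> linear (F c t)"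
    and F_inj: "\<lbrakk>c \<in> C; t \<in> D c\<rbrakk> \<Longrightarrow> inj (F c t)"
    and A_linear: "\<lbrakk>c \<in> C; t \<in> D c\<rbrakk> \<Longrightarrow> linear (A c t)"
    and A_continuous: "c \<in> C \<Longrightarrow> continuous_on (D c) (\<lambda>t. A c t v)"
    and change: "\<lbrakk>c \<in> C; d \<in> C; t \<in> D c; t \<in> D d; t \<in> X; X \<subseteq> {a..b};
        ((\<lambda>s. F c s (Z s)) has_vector_derivative A c t (F c t (Z t))) (at t within X)\<rbrakk>
      \<Longrightarrow> ((\<lambda>s. F d s (Z s)) has_vector_derivative A d t (F d t (Z t))) (at t within X)"
begin

text \<open>Derivatives are taken within \<open>X\<close>, hence are one-sided at the ends of an
  interval; this allows solutions on adjacent intervals to be glued.\<close>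

definition sol :: "real set \<Rightarrow> (real \<Rightarrow> 'e) \<Rightarrow> bool" where
  "sol X Z \<longleftrightarrow> (\<forall>t\<in>X. \<forall>c\<in>C. t \<in> D c \<longrightarrow>
     ((\<lambda>s. F c s (Z s)) has_vector_derivative A c t (F c t (Z t))) (at t within X))"

lemma sol_subset: "sol X Z \<Longrightarrow> Y \<subseteq> X \<Longrightarrow> sol Y Z"
  unfolding sol_def by (blast intro: has_vector_derivative_within_subset)

lemma D_near:
  assumes "c \<in> C" "t \<in> D c"
  obtains e where "e > 0" "\<And>s. s \<in> {a..b} \<Longrightarrow> dist s t < e \<Longrightarrow> s \<in> D c"
  using D_open[OF assms(1)] assms(2) unfolding openin_euclidean_subtopology_iff by metis

lemma sol_transform:
  assumes "sol X Z" "X \<subseteq> {a..b}" "\<And>t. t \<in> X \<Longrightarrow> Z' t = Z t"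
  shows "sol X Z'"
  unfolding sol_def
proof (intro ballI impI)
  fix t c assume t: "t \<in> X" "c \<in> C" "t \<in> D c"
  then have "((\<lambda>s. F c s (Z s)) has_vector_derivative A c t (F c t (Z t))) (at t within X)"
    using assms(1) unfolding sol_def by blast
  from has_vector_derivative_transform[OF t(1) _ this]
  show "((\<lambda>s. F c s (Z' s)) has_vector_derivative A c t (F c t (Z' t))) (at t within X)"
    using assms(3) t(1) by auto
qed

lemma sol_add:
  assumes "sol X Z" "sol X Z'" "X \<subseteq> {a..b}"
  shows "sol X (\<lambda>t. Z t + Z' t)"
  unfolding sol_def
proof (intro ballI impI)
  fix t c assume t: "t \<in> X" "c \<in> C" "t \<in> D c"
  obtain e where e: "e > 0" "\<And>s. s \<in> {a..b} \<Longrightarrow> dist s t < e \<Longrightarrow> s \<in> D c"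
    using D_near[OF t(2,3)] by metis
  have "((\<lambda>s. F c s (Z s) + F c s (Z' s)) has_vector_derivative
      A c t (F c t (Z t)) + A c t (F c t (Z' t))) (at t within X)"
    using assms t unfolding sol_def by (intro has_vector_derivative_add) blast+
  then have "((\<lambda>s. F c s (Z s + Z' s)) has_vector_derivative
      A c t (F c t (Z t)) + A c t (F c t (Z' t))) (at t within X)"
    by (rule has_vector_derivative_transform_within[OF _ e(1) t(1)])
      (use e(2) assms(3) F_linear[OF t(2)] linear_add in \<open>metis subsetD\<close>)
  then show "((\<lambda>s. F c s (Z s + Z' s)) has_vector_derivative A c t (F c t (Z t + Z' t))) (at t within X)"
    by (simp add: linear_add F_linear A_linear t)
qed

lemma sol_scaleR:
  assumes "sol X Z" "X \<subseteq> {a..b}"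
  shows "sol X (\<lambda>t. r *\<^sub>R Z t)"
  unfolding sol_def
proof (intro ballI impI)
  fix t c assume t: "t \<in> X" "c \<in> C" "t \<in> D c"
  obtain e where e: "e > 0" "\<And>s. s \<in> {a..b} \<Longrightarrow> dist s t < e \<Longrightarrow> s \<in> D c"
    using D_near[OF t(2,3)] by metis
  have "((\<lambda>s. r *\<^sub>R F c s (Z s)) has_vector_derivative r *\<^sub>R A c t (F c t (Z t))) (at t within X)"
    using assms t unfolding sol_def
    by (intro bounded_linear.has_vector_derivative[OF bounded_linear_scaleR_right]) blast
  then have "((\<lambda>s. F c s (r *\<^sub>R Z s)) has_vector_derivative r *\<^sub>R A c t (F c t (Z t))) (at t within X)"
    by (rule has_vector_derivative_transform_within[OF _ e(1) t(1)])
      (use e(2) assms(2) F_linear[OF t(2)] linear_scale in \<open>metis subsetD\<close>)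
  then show "((\<lambda>s. F c s (r *\<^sub>R Z s)) has_vector_derivative A c t (F c t (r *\<^sub>R Z t))) (at t within X)"
    by (simp add: linear_scale F_linear A_linear t)
qed

text \<open>By openness of the domain and continuity of the coefficients, one trivialisation and one
  constant serve all short intervals around \<open>t\<close>. This is the local hypothesis of the
  bisection principle \<open>Bolzano\<close>, which carries the short-time results over to long
  intervals.\<close>

lemma local_chart:
  assumes "t \<in> {a..b}"
  obtains c K \<delta> where "c \<in> C" "0 \<le> K" "0 < \<delta>"
    "\<And>x y. \<lbrakk>a \<le> x; x \<le> t; t \<le> y; y \<le> b; y - x < \<delta>\<rbrakk> \<Longrightarrow> {x..y} \<subseteq> D c \<and> K * (y - x) \<le> 1 / 2 \<and>
       (\<forall>s\<in>{x..y}. \<forall>v. norm (A c s v) \<le> K * norm v)"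
proof -
  obtain c where c: "c \<in> C" "t \<in> D c" using D_cover[OF assms] by blast
  obtain e where e: "e > 0" "\<And>s. s \<in> {a..b} \<Longrightarrow> dist s t < e \<Longrightarrow> s \<in> D c"
    using D_near[OF c] by metis
  define k where "k s = (\<Sum>i\<in>Basis. norm (A c s i))" for s
  have k: "norm (A c s v) \<le> k s * norm v" if "s \<in> D c" for s v
  proof -
    have "norm (A c s v) \<le> (\<Sum>i\<in>Basis. norm v * norm (A c s i))"
      unfolding linear_sum_Basis[OF A_linear[OF c(1) that], of v]
      by (rule sum_norm_le) (auto intro!: mult_right_mono Basis_le_norm)
    then show ?thesis by (simp add: k_def sum_distrib_left[symmetric] mult.commute)
  qed
  have "continuous_on (D c) k" unfolding k_def by (intro continuous_intros A_continuous c)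
  then obtain e' where e': "e' > 0" "\<And>s. s \<in> D c \<Longrightarrow> dist s t < e' \<Longrightarrow> dist (k s) (k t) < 1"
    using c(2) unfolding continuous_on_iff by (meson zero_less_one)
  define K where "K = k t + 1"
  have knn: "k s \<ge> 0" for s by (simp add: k_def sum_nonneg)
  have K: "K > 0" using knn[of t] by (simp add: K_def)
  show thesis
  proof (rule that[OF c(1)])
    show "0 \<le> K" using K by simp
    show "0 < min (min e e') (1 / (2 * K))" using e e' K by simp
    fix x y assume xy: "a \<le> x" "x \<le> t" "t \<le> y" "y \<le> b" "y - x < min (min e e') (1 / (2 * K))"
    have near: "s \<in> {a..b}" "dist s t < e" "dist s t < e'" if "s \<in> {x..y}" for s
      using that xy by (auto simp: dist_real_def)
    have sub: "{x..y} \<subseteq> D c" using near e(2) by blast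
    have "K * (y - x) \<le> K * (1 / (2 * K))" using xy K by (intro mult_left_mono) auto
    also have "\<dots> = 1 / 2" using K by simp
    finally have 1: "K * (y - x) \<le> 1 / 2" .
    have "norm (A c s v) \<le> K * norm v" if s: "s \<in> {x..y}" for s v
    proof -
      have "k s \<le> K" using e'(2)[of s] near(3)[OF s] sub s unfolding K_def dist_real_def
        by (smt (verit) subsetD)
      then show ?thesis using k[of s v] sub s mult_right_mono[of "k s" K "norm v"]
        by (meson norm_ge_zero order_trans subsetD)
    qed
    then show "{x..y} \<subseteq> D c \<and> K * (y - x) \<le> 1 / 2 \<and> (\<forall>s\<in>{x..y}. \<forall>v. norm (A c s v) \<le> K * norm v)"
      using sub 1 by blast
  qed
qed

text \<open>An equivalence between the two ends is transitive, as \<open>Bolzano\<close> requires.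
  Its forward direction gives uniqueness of solutions, its backward direction the injectivity of the
  flow.\<close>

lemma sol_zero_iff:
  assumes "a \<le> x" "x \<le> y" "y \<le> b" "sol {x..y} Z"
  shows "Z x = 0 \<longleftrightarrow> Z y = 0"
proof -
  have "x \<le> x \<longrightarrow> x \<le> y \<longrightarrow> y \<le> y \<longrightarrow> (Z x = 0 \<longleftrightarrow> Z y = 0)"
    using assms(2)
  proof (induction rule: Bolzano[where P = "\<lambda>p q. x \<le> p \<longrightarrow> p \<le> q \<longrightarrow> q \<le> y \<longrightarrow> (Z p = 0 \<longleftrightarrow> Z q = 0)"])
    case (trans p q r) then show ?case by auto
  next
    case (local t)
    then have "t \<in> {a..b}" using assms by auto
    then obtain c K \<delta> where c: "c \<in> C" "0 \<le> K" "0 < \<delta>" and loc: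
      "\<And>x y. \<lbrakk>a \<le> x; x \<le> t; t \<le> y; y \<le> b; y - x < \<delta>\<rbrakk> \<Longrightarrow> {x..y} \<subseteq> D c \<and> K * (y - x) \<le> 1 / 2 \<and>
       (\<forall>s\<in>{x..y}. \<forall>v. norm (A c s v) \<le> K * norm v)"
      using local_chart by metis
    have "Z p = 0 \<longleftrightarrow> Z q = 0" if pq: "p \<le> t" "t \<le> q" "q - p < \<delta>" "x \<le> p" "q \<le> y" for p q
    proof -
      have l: "{p..q} \<subseteq> D c" "K * (q - p) \<le> 1 / 2" "\<And>s v. s \<in> {p..q} \<Longrightarrow> norm (A c s v) \<le> K * norm v"
        using loc[of p q] pq assms by auto
      have "sol {p..q} Z" using sol_subset[OF assms(4)] pq by auto
      then have d: "((\<lambda>s. F c s (Z s)) has_vector_derivative A c s (F c s (Z s))) (at s within {p..q})"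
        if "s \<in> {p..q}" for s using that l(1) c(1) unfolding sol_def by blast
      have Fz: "F c s (Z s) = 0 \<longleftrightarrow> Z s = 0" if "s \<in> {p..q}" for s
        using F_linear[OF c(1)] F_inj[OF c(1)] l(1) that linear_injective_0 linear_0 by (metis subsetD)
      have pq': "p \<in> {p..q}" "q \<in> {p..q}" using pq by auto
      show ?thesis
        using linear_ode_zero_short[where w = "\<lambda>s. F c s (Z s)", OF l(3) c(2) l(2) d] pq' Fz by blast
    qed
    then show ?case using c(3) by blast
  qed
  then show ?thesis using assms(2) by simp
qed

text \<open>At \<open>q\<close> the two one-sided derivatives agree, since both are the right-hand
  side of the equation at the common value.\<close>

lemma sol_glue:
  assumes "a \<le> p" "p \<le> q" "q \<le> r" "r \<le> b" "sol {p..q} Z1" "sol {q..r} Z2" "Z1 q = Z2 q"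
  shows "sol {p..r} (\<lambda>t. if t \<le> q then Z1 t else Z2 t)" (is "sol _ ?Z")
proof -
  have s1: "sol {p..q} ?Z" by (rule sol_transform[OF assms(5)]) (use assms in auto)
  have s2: "sol {q..r} ?Z" by (rule sol_transform[OF assms(6)]) (use assms in auto)
  show ?thesis
    unfolding sol_def
  proof (intro ballI impI)
    fix t c assume t: "t \<in> {p..r}" "c \<in> C" "t \<in> D c"
    have 1: "((\<lambda>s. F c s (?Z s)) has_vector_derivative A c t (F c t (?Z t))) (at t within {p..q})" if "t \<le> q"
      using s1[unfolded sol_def, rule_format, OF _ t(2,3)] t(1) that by auto
    have 2: "((\<lambda>s. F c s (?Z s)) has_vector_derivative A c t (F c t (?Z t))) (at t within {q..r})" if "q \<le> t"
      using s2[unfolded sol_def, rule_format, OF _ t(2,3)] t(1) that by auto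
    consider "t < q" | "t = q" | "q < t" by linarith
    then show "((\<lambda>s. F c s (?Z s)) has_vector_derivative A c t (F c t (?Z t))) (at t within {p..r})"
    proof cases
      case 1
      have "at t within {p..q} = at t within {p..r}"
        by (rule at_within_nhd[of t "{..<q}"]) (use 1 assms in auto)
      then show ?thesis using \<open>t \<le> q \<Longrightarrow> _\<close> 1 by simp
    next
      case 2
      have "{p..r} = {p..q} \<union> {q..r}" using assms by auto
      then show ?thesis
        using has_vector_derivative_within_Un[OF \<open>t \<le> q \<Longrightarrow> _\<close> \<open>q \<le> t \<Longrightarrow> _\<close>] 2 by simp
    next
      case 3
      have "at t within {q..r} = at t within {p..r}"
        by (rule at_within_nhd[of t "{q<..}"]) (use 3 assms in auto)
      then show ?thesis using \<open>q \<le> t \<Longrightarrow> _\<close> 3 by simp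
    qed
  qed
qed

lemma sol_exists: "\<exists>Z. Z a = v \<and> sol {a..b} Z"
proof -
  \<comment> \<open>Quantifying over all initial values makes the property transitive: the second
    piece starts at the end value of the first.\<close>
  have "a \<le> a \<longrightarrow> a \<le> b \<longrightarrow> b \<le> b \<longrightarrow> (\<forall>v. \<exists>Z. Z a = v \<and> sol {a..b} Z)"
    using ab
  proof (induction rule: Bolzano[where P = "\<lambda>p q. a \<le> p \<longrightarrow> p \<le> q \<longrightarrow> q \<le> b \<longrightarrow> (\<forall>v. \<exists>Z. Z p = v \<and> sol {p..q} Z)"])
    case (trans p q r)
    show ?case
    proof (intro impI allI)
      fix v assume pr: "a \<le> p" "p \<le> r" "r \<le> b"
      obtain Z1 where Z1: "Z1 p = v" "sol {p..q} Z1" using trans pr by (meson order_trans)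
      obtain Z2 where Z2: "Z2 q = Z1 q" "sol {q..r} Z2" using trans pr by (meson order_trans)
      show "\<exists>Z. Z p = v \<and> sol {p..r} Z"
        using sol_glue[OF pr(1) trans(3,4) pr(3) Z1(2) Z2(2)] Z1 Z2 trans(3)
        by (intro exI[of _ "\<lambda>t. if t \<le> q then Z1 t else Z2 t"]) simp
    qed
  next
    case (local t)
    then have "t \<in> {a..b}" by auto
    then obtain c K \<delta> where c: "c \<in> C" "0 \<le> K" "0 < \<delta>" and loc:
      "\<And>x y. \<lbrakk>a \<le> x; x \<le> t; t \<le> y; y \<le> b; y - x < \<delta>\<rbrakk> \<Longrightarrow> {x..y} \<subseteq> D c \<and> K * (y - x) \<le> 1 / 2 \<and>
       (\<forall>s\<in>{x..y}. \<forall>v. norm (A c s v) \<le> K * norm v)"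
      using local_chart by metis
    have "\<exists>Z. Z p = v \<and> sol {p..q} Z" if pq: "p \<le> t" "t \<le> q" "q - p < \<delta>" "a \<le> p" "q \<le> b" for p q v
    proof -
      have l: "{p..q} \<subseteq> D c" "K * (q - p) \<le> 1 / 2" "\<And>s v. s \<in> {p..q} \<Longrightarrow> norm (A c s v) \<le> K * norm v"
        using loc[of p q] pq by auto
      have "p \<le> q" using pq by simp
      obtain w where w: "w p = F c p v"
        "\<And>s. s \<in> {p..q} \<Longrightarrow> (w has_vector_derivative A c s (w s)) (at s within {p..q})"
        using linear_ode_exists_short[OF \<open>p \<le> q\<close> A_linear[OF c(1)] continuous_on_subset[OF A_continuous[OF c(1)] l(1)] l(3) c(2) l(2)] l(1)
        by (metis subsetD)
      have inv: "F c s (inv (F c s) u) = u" "inv (F c s) (F c s u) = u" if "s \<in> D c" for s u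
        using F_inj[OF c(1) that] linear_injective_imp_surjective[OF F_linear[OF c(1) that]]
        by (simp_all add: surj_f_inv_f)
      \<comment> \<open>The solution is found in the single trivialisation \<open>c\<close> and
        pulled back to the fibres; \<open>change\<close> then gives the equation in every other
        trivialisation.\<close>
      define Z where "Z s = inv (F c s) (w s)" for s
      have FZ: "F c s (Z s) = w s" if "s \<in> {p..q}" for s using inv l(1) that by (auto simp: Z_def)
      have "Z p = v" using w(1) inv l(1) pq by (simp add: Z_def subset_iff)
      moreover have "sol {p..q} Z"
        unfolding sol_def
      proof (intro ballI impI)
        fix s d assume s: "s \<in> {p..q}" "d \<in> C" "s \<in> D d"
        have "((\<lambda>r. F c r (Z r)) has_vector_derivative A c s (F c s (Z s))) (at s within {p..q})"
          unfolding FZ[OF s(1)] by (rule has_vector_derivative_transform[OF s(1) FZ w(2)[OF s(1)]])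
        then show "((\<lambda>r. F d r (Z r)) has_vector_derivative A d s (F d s (Z s))) (at s within {p..q})"
          by (rule change[OF c(1) s(2) _ s(3,1), rotated 2]) (use l(1) s(1) pq in auto)
      qed
      ultimately show ?thesis by blast
    qed
    then show ?case using c(3) by blast
  qed
  then show ?thesis using ab by blast
qed

text \<open>By \<open>flow_unique\<close> the choice of \<open>Z\<close> does not affect the values
  on \<open>{a..b}\<close>.\<close>

definition flow :: "'e \<Rightarrow> real \<Rightarrow> 'e" where
  "flow v = (SOME Z. Z a = v \<and> sol {a..b} Z)"

lemma flow: "flow v a = v" "sol {a..b} (flow v)"
  using someI_ex[OF sol_exists[of v]] by (simp_all add: flow_def)

lemma flow_unique:
  assumes "sol {a..b} Z" "t \<in> {a..b}"
  shows "Z t = flow (Z a) t"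
proof -
  have "sol {a..b} (\<lambda>t. Z t + (-1) *\<^sub>R flow (Z a) t)"
    by (intro sol_add sol_scaleR assms flow) auto
  then have "sol {a..t} (\<lambda>t. Z t + (-1) *\<^sub>R flow (Z a) t)" by (rule sol_subset) (use assms in auto)
  then show ?thesis using sol_zero_iff[of a t "\<lambda>t. Z t + (-1) *\<^sub>R flow (Z a) t"] assms flow(1) by simp
qed

lemma flow_linear:
  assumes "t \<in> {a..b}"
  shows "linear (\<lambda>v. flow v t)"
proof (rule linearI)
  fix u v
  have "sol {a..b} (\<lambda>t. flow u t + flow v t)" by (intro sol_add flow) auto
  from flow_unique[OF this assms] show "flow (u + v) t = flow u t + flow v t" by (simp add: flow)
next
  fix r u
  have "sol {a..b} (\<lambda>t. r *\<^sub>R flow u t)" by (intro sol_scaleR flow) auto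
  from flow_unique[OF this assms] show "flow (r *\<^sub>R u) t = r *\<^sub>R flow u t" by (simp add: flow)
qed

lemma flow_inj:
  assumes "t \<in> {a..b}"
  shows "inj (\<lambda>v. flow v t)"
proof -
  have "v = 0" if "flow v t = 0" for v
    using sol_zero_iff[of a t "flow v"] sol_subset[OF flow(2), of "{a..t}"] assms that flow(1) by auto
  then show ?thesis using linear_injective_0[OF flow_linear[OF assms]] by blast
qed

end

section \<open>Maslov index of paths transverse to a Lagrangian\<close>

text \<open>Joint continuity from separate continuity, thanks to the Lipschitz constant 1 that is
  common to all \<open>t\<close>. It is meant for the projections onto the subspaces of a path,
  whose continuity is given pointwise only.\<close>

lemma continuous_on_nonexpansive_family:
  fixes f :: "'s::topological_space \<Rightarrow> 'a::metric_space \<Rightarrow> 'b::metric_space"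
  assumes f: "\<And>y. continuous_on T (\<lambda>t. f t y)"
    and lip: "\<And>t y y'. t \<in> T \<Longrightarrow> dist (f t y) (f t y') \<le> dist y y'"
  shows "continuous_on (T \<times> Y) (\<lambda>p. f (fst p) (snd p))"
  unfolding continuous_on_def
proof
  fix p assume p: "p \<in> T \<times> Y"
  obtain t y where ty: "p = (t, y)" "t \<in> T" "y \<in> Y" using p by auto
  let ?F = "at p within T \<times> Y"
  have "((\<lambda>q. dist (f (fst q) (snd q)) (f t y)) \<longlongrightarrow> 0) ?F"
  proof (rule tendsto_sandwich)
    show "((\<lambda>q. 0) \<longlongrightarrow> (0::real)) ?F" by simp
    show "\<forall>\<^sub>F q in ?F. 0 \<le> dist (f (fst q) (snd q)) (f t y)" by simp
    have "dist (f (fst q) (snd q)) (f t y) \<le> dist (snd q) y + dist (f (fst q) y) (f t y)"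
      if "q \<in> T \<times> Y" for q
      using lip[of "fst q" "snd q" y] that dist_triangle[of "f (fst q) (snd q)" "f t y" "f (fst q) y"] by auto
    then show "\<forall>\<^sub>F q in ?F. dist (f (fst q) (snd q)) (f t y) \<le> dist (snd q) y + dist (f (fst q) y) (f t y)"
      by (simp add: eventually_at_filter)
    have "continuous_on (T \<times> Y) (\<lambda>q. f (fst q) y)"
      by (rule continuous_on_compose2[OF f, of _ fst]) (auto intro: continuous_intros)
    then have "((\<lambda>q. f (fst q) y) \<longlongrightarrow> f t y) ?F"
      using p ty unfolding continuous_on_def by fastforce
    moreover have "(snd \<longlongrightarrow> y) ?F" using ty by (auto intro!: tendsto_eq_intros)
    ultimately have "((\<lambda>q. dist (snd q) y + dist (f (fst q) y) (f t y)) \<longlongrightarrow> dist y y + dist (f t y) (f t y)) ?F"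
      by (intro tendsto_intros)
    then show "((\<lambda>q. dist (snd q) y + dist (f (fst q) y) (f t y)) \<longlongrightarrow> 0) ?F" by simp
  qed
  then show "((\<lambda>q. f (fst q) (snd q)) \<longlongrightarrow> f (fst p) (snd p)) ?F"
    using ty tendsto_dist_iff by auto
qed

text \<open>The distance from a unit vector of \<open>L\<close> to \<open>l t\<close> is a positive
  continuous function on a compact product, hence has a positive minimum; homogeneity extends the
  bound to all of \<open>L\<close>.\<close>

lemma transverse_family_bound:
  fixes l :: "'s::topological_space \<Rightarrow> 'v::euclidean_space set"
  assumes T: "compact T" and sub: "\<And>t. t \<in> T \<Longrightarrow> subspace (l t)" and L: "subspace L"
    and cont: "\<And>x. continuous_on T (\<lambda>t. closest_point (l t) x)"
    and tr: "\<And>t. t \<in> T \<Longrightarrow> l t \<inter> L \<subseteq> {0}"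
  obtains c where "c > 0" "\<And>t x y. \<lbrakk>t \<in> T; x \<in> l t; y \<in> L\<rbrakk> \<Longrightarrow> c * norm y \<le> norm (y - x)"
proof -
  define Y where "Y = L \<inter> sphere 0 1"
  have lt: "convex (l t)" "closed (l t)" "l t \<noteq> {}" if "t \<in> T" for t
    using sub[OF that] subspace_imp_convex closed_subspace subspace_0 by auto
  have "compact Y" unfolding Y_def
    using compact_sphere closed_subspace[OF L] by (simp add: closed_Int_compact)
  then have cTY: "compact (T \<times> Y)" using T by (rule compact_Times[rotated])
  have "continuous_on (T \<times> Y) (\<lambda>p. closest_point (l (fst p)) (snd p))"
    by (rule continuous_on_nonexpansive_family[OF cont closest_point_lipschitz]) (use lt in auto)
  then have cf: "continuous_on (T \<times> Y) (\<lambda>p. norm (snd p - closest_point (l (fst p)) (snd p)))"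
    by (intro continuous_intros)
  show thesis
  proof (cases "T \<times> Y = {}")
    case True
    \<comment> \<open>Here \<open>T\<close> is empty or \<open>L\<close> is zero, and any positive
      constant will do.\<close>
    have "y = 0" if "y \<in> L" "t \<in> T" for y t
    proof (rule ccontr)
      assume "y \<noteq> 0"
      then have "y /\<^sub>R norm y \<in> Y" using that L by (simp add: Y_def subspace_scale)
      then show False using True that by auto
    qed
    then show thesis by (intro that[of 1]) (simp, metis mult_1 norm_ge_zero norm_zero)
  next
    case False
    obtain p where p: "p \<in> T \<times> Y" and
      pm: "\<And>q. q \<in> T \<times> Y \<Longrightarrow> norm (snd p - closest_point (l (fst p)) (snd p)) \<le> norm (snd q - closest_point (l (fst q)) (snd q))"
      using continuous_attains_inf[OF cTY False cf] by blast
    define c where "c = norm (snd p - closest_point (l (fst p)) (snd p))"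
    have "c > 0"
    proof (rule ccontr)
      assume "\<not> c > 0"
      then have "snd p = closest_point (l (fst p)) (snd p)" by (simp add: c_def)
      moreover have "closest_point (l (fst p)) (snd p) \<in> l (fst p)"
        using lt p by (auto intro: closest_point_in_set)
      ultimately have "snd p \<in> l (fst p) \<inter> L" using p by (auto simp: Y_def)
      then have "snd p = 0" using tr p by fastforce
      then show False using p by (auto simp: Y_def)
    qed
    moreover have "c * norm y \<le> norm (y - x)" if "t \<in> T" "x \<in> l t" "y \<in> L" for t x y
    proof (cases "y = 0")
      case False
      have yY: "y /\<^sub>R norm y \<in> Y" using False that L by (simp add: Y_def subspace_scale)
      have xl: "x /\<^sub>R norm y \<in> l t" using sub that by (simp add: subspace_scale)
      have "c \<le> norm (y /\<^sub>R norm y - closest_point (l t) (y /\<^sub>R norm y))"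
        using pm[of "(t, y /\<^sub>R norm y)"] yY that by (simp add: c_def)
      also have "\<dots> \<le> norm (y /\<^sub>R norm y - x /\<^sub>R norm y)"
        using closest_point_le[OF lt(2)[OF that(1)] xl, of "y /\<^sub>R norm y"] by (simp add: dist_norm)
      also have "\<dots> = norm (y - x) / norm y"
        by (simp add: scaleR_diff_right[symmetric] divide_inverse mult.commute)
      finally show ?thesis using False by (simp add: field_simps)
    qed simp
    ultimately show thesis by (rule that)
  qed
qed

section \<open>Complementary subspaces and indices of forms\<close>

lemma subspace_complement_decomposition:
  fixes A B :: "'v::euclidean_space set"
  assumes "subspace A" "subspace B" "A \<inter> B = {0}" "dim A + dim B = DIM('v)"
  obtains x y where "x \<in> A" "y \<in> B" "v = x + y"
proof -
  have "dim {x + y |x y. x \<in> A \<and> y \<in> B} = DIM('v)"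
    using dim_sums_Int[OF assms(1,2)] assms(3,4) by simp
  moreover have "subspace {x + y |x y. x \<in> A \<and> y \<in> B}" using assms by (simp add: subspace_sums)
  then have "span {x + y |x y. x \<in> A \<and> y \<in> B} = {x + y |x y. x \<in> A \<and> y \<in> B}"
    by (simp only: span_eq_iff)
  ultimately have "{x + y |x y. x \<in> A \<and> y \<in> B} = UNIV"
    by (simp only: dim_eq_full)
  then show thesis using that by blast
qed

lemma subspace_complement_projection:
  fixes A B :: "'v::euclidean_space set"
  assumes AB: "subspace A" "subspace B" "A \<inter> B = {0}" "dim A + dim B = DIM('v)"
  obtains p where "linear p" "\<And>v. p v \<in> B" "\<And>v. v - p v \<in> A"
proof -
  have "\<exists>y. y \<in> B \<and> v - y \<in> A" for v
    using subspace_complement_decomposition[OF AB, of v] by (metis add_diff_cancel_right')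
  then obtain p where p: "\<And>v. p v \<in> B" "\<And>v. v - p v \<in> A" by metis
  have uniq: "p v = y" if "y \<in> B" "v - y \<in> A" for v y
  proof -
    have "p v - y \<in> B" using p that AB by (simp add: subspace_diff)
    moreover have "(v - y) - (v - p v) \<in> A" by (rule subspace_diff[OF AB(1) that(2) p(2)])
    ultimately have "p v - y \<in> A \<inter> B" by simp
    then show ?thesis using AB(3) by simp
  qed
  have "linear p"
  proof (rule linearI)
    fix u v
    have "(u - p u) + (v - p v) \<in> A" by (rule subspace_add[OF AB(1) p(2) p(2)])
    then show "p (u + v) = p u + p v" by (intro uniq) (simp_all add: subspace_add AB p algebra_simps)
  next
    fix r u
    have "r *\<^sub>R (u - p u) \<in> A" by (rule subspace_scale[OF AB(1) p(2)])
    then show "p (r *\<^sub>R u) = r *\<^sub>R p u" by (intro uniq) (simp_all add: subspace_scale AB p algebra_simps)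
  qed
  then show thesis using p that by blast
qed

text \<open>A subspace on which \<open>B\<close> is positive definite meets \<open>K\<close> only in
  0, so its dimension and that of \<open>K\<close> add up to at most \<open>dim W\<close>.\<close>

lemma n_plus_le:
  fixes W K :: "'v::euclidean_space set"
  assumes W: "subspace W" and K: "subspace K" "K \<subseteq> W" and neg: "\<And>x. x \<in> K \<Longrightarrow> x \<noteq> 0 \<Longrightarrow> B x x < 0"
  shows "n_plus W B \<le> dim W - dim K"
proof -
  let ?S = "{dim U |U. subspace U \<and> U \<subseteq> W \<and> (\<forall>x\<in>U. x \<noteq> 0 \<longrightarrow> - B x x < 0)}"
  \<comment> \<open>\<open>Max\<close> says something only about a finite nonempty set: dimensions
    are bounded, and the zero subspace always competes.\<close>
  have "?S \<subseteq> {..DIM('v)}" using dim_subset_UNIV by auto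
  then have fin: "finite ?S" using finite_subset by blast
  have "dim ({0} :: 'v set) \<in> ?S" using W by (auto simp: subspace_0 intro!: exI[of _ "{0}"])
  then have ne: "?S \<noteq> {}" by blast
  have "dim U \<le> dim W - dim K"
    if U: "subspace U" "U \<subseteq> W" "\<forall>x\<in>U. x \<noteq> 0 \<longrightarrow> - B x x < 0" for U
  proof -
    have "x = 0" if "x \<in> U" "x \<in> K" for x
      using U(3) neg[OF that(2)] that(1) by force
    then have "U \<inter> K \<subseteq> {0}" by blast
    then have "dim (U \<inter> K) = 0" by simp
    then have sum: "dim {x + y |x y. x \<in> U \<and> y \<in> K} = dim U + dim K"
      using dim_sums_Int[OF U(1) K(1)] by linarith
    have "{x + y |x y. x \<in> U \<and> y \<in> K} \<subseteq> W" using U(2) K(2) subspace_add[OF W] by blast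
    from dim_subset[OF this] show ?thesis using sum by linarith
  qed
  then have "\<forall>k\<in>?S. k \<le> dim W - dim K" by auto
  then show ?thesis unfolding n_plus_def n_minus_def using Max_le_iff[OF fin ne] by blast
qed

section \<open>Symplectic linear algebra and the bound on the index\<close>

locale symplectic_form =
  fixes \<omega> :: "'v::euclidean_space \<Rightarrow> 'v \<Rightarrow> real"
  assumes bilin: "bilinear \<omega>" and antisym: "\<omega> x y = - \<omega> y x" and nondeg: "(\<And>y. \<omega> x y = 0) \<Longrightarrow> x = 0"
begin

lemmas form_simps = bilinear_ladd[OF bilin] bilinear_radd[OF bilin] bilinear_lmul[OF bilin] bilinear_rmul[OF bilin]
  bilinear_lsub[OF bilin] bilinear_rsub[OF bilin] bilinear_lzero[OF bilin] bilinear_rzero[OF bilin]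

text \<open>Expressing the auxiliary inner product through \<omega> provides the definite form that
  fixes the direction of the perturbation.\<close>

lemma riesz_map:
  obtains \<Omega> where "linear \<Omega>" "\<And>y v. \<omega> (\<Omega> y) v = y \<bullet> v"
proof -
  have "inj (form_vector \<omega>)" by (rule inj_form_vector[OF bilin nondeg])
  then obtain \<Omega> where \<Omega>: "linear \<Omega>" "\<And>y. form_vector \<omega> (\<Omega> y) = y"
    using linear_injective_isomorphism[OF linear_form_vector[OF bilin]] by blast
  show thesis
    by (rule that[OF \<Omega>(1)]) (simp add: inner_form_vector[OF bilin, symmetric] \<Omega>(2))
qed

lemma lagrangian_decomposition:
  assumes "lagrangian \<omega> A" "lagrangian \<omega> B" "transverse A B"
  shows "subspace A" "subspace B" "A \<inter> B = {0}" "dim A + dim B = DIM('v)"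
  using assms unfolding lagrangian_def transverse_def by auto

text \<open>Complementarity of \<open>L\<close> and \<open>L1\<close> makes the \<open>THE\<close>
  in \<open>graph_map\<close> meaningful: the decomposition x = l + m gives the value -m.\<close>

lemma graph_map:
  assumes "lagrangian \<omega> L1" "lagrangian \<omega> L" "transverse L L1"
  shows "graph_map L0 L1 L x \<in> L1" "x + graph_map L0 L1 L x \<in> L"
proof -
  note d = lagrangian_decomposition[OF assms(2,1,3)]
  obtain l m where lm: "l \<in> L" "m \<in> L1" "x = l + m"
    using subspace_complement_decomposition[OF d] by metis
  have "\<exists>!y. y \<in> L1 \<and> x + y \<in> L"
  proof (rule ex1I[of _ "- m"])
    show "- m \<in> L1 \<and> x + - m \<in> L" using lm d(2) by (simp add: subspace_neg)
    fix y assume y: "y \<in> L1 \<and> x + y \<in> L"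
    then have "(x + y) - l \<in> L" using d(1) lm(1) by (blast intro: subspace_diff)
    moreover have "y + m \<in> L1" using y d(2) lm(2) by (blast intro: subspace_add)
    ultimately have "y + m \<in> L \<inter> L1" using lm(3) by (simp add: add.commute)
    then show "y = - m" using d(3) by (simp add: eq_neg_iff_add_eq_0)
  qed
  from theI'[OF this] show "graph_map L0 L1 L x \<in> L1" "x + graph_map L0 L1 L x \<in> L"
    unfolding graph_map_def by blast+
qed

text \<open>The perturbation of \<open>L1\<close> is \<open>{y + \<epsilon> B y | y \<in> L1}\<close> for small \<open>\<epsilon> > 0\<close>, where \<open>B\<close> maps into
  \<open>L2\<close> and \<open>\<omega> (B y) y' = y \<bullet> y'\<close> on \<open>L1\<close>.\<close>

lemma maslov_index_bound:
  assumes L0: "lagrangian \<omega> L0" and L1: "lagrangian \<omega> L1" and L2: "lagrangian \<omega> L2" "transverse L1 L2"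
    and mu: "is_maslov_index \<omega> \<mu>" and ab: "\<alpha> \<le> \<beta>" and l: "lag_continuous_on \<omega> {\<alpha>..\<beta>} l"
    and tr: "\<And>t. t \<in> {\<alpha>..\<beta>} \<Longrightarrow> transverse (l t) L1"
  shows "\<bar>\<mu> L0 \<alpha> \<beta> l\<bar> \<le> int (dim L0 - dim (L0 \<inter> L1))"
proof -
  note d = lagrangian_decomposition[OF L1 L2]
  have iso: "\<omega> x y = 0" if "lagrangian \<omega> L" "x \<in> L" "y \<in> L" for L x y
    using that unfolding lagrangian_def by blast
  have s0: "subspace L0" using L0 lagrangian_def by blast
  define K where "K = L0 \<inter> L1"
  have K: "subspace K" unfolding K_def using s0 d(1) by (rule subspace_inter)
  have lt: "lagrangian \<omega> (l t)" if "t \<in> {\<alpha>..\<beta>}" for t using l that unfolding lag_continuous_on_def by blast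
  obtain \<Omega> where \<Omega>: "linear \<Omega>" "\<And>y v. \<omega> (\<Omega> y) v = y \<bullet> v" using riesz_map by blast
  obtain p where p: "linear p" "\<And>v. p v \<in> L2" "\<And>v. v - p v \<in> L1"
    using subspace_complement_projection[OF d] by blast
  \<comment> \<open>Projecting to \<open>L2\<close> along \<open>L1\<close> changes
    \<open>\<Omega> y\<close> by a vector of \<open>L1\<close>, which pairs to 0 with
    \<open>L1\<close>. So \<open>B\<close> takes values in the isotropic \<open>L2\<close> and still
    represents the inner product on \<open>L1\<close>.\<close>
  define B where "B y = p (\<Omega> y)" for y
  have linB: "linear B" unfolding B_def using linear_compose[OF \<Omega>(1) p(1)] by (simp add: comp_def)
  have B2: "B y \<in> L2" for y by (simp add: B_def p)
  have \<omega>B: "\<omega> (B y) x = y \<bullet> x" if "x \<in> L1" for x y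
  proof -
    have "\<omega> (\<Omega> y - B y) x = 0" using iso[OF L1 p(3) that] by (simp add: B_def)
    then show ?thesis using \<Omega>(2) by (simp add: form_simps)
  qed
  obtain M where M: "M > 0" "\<And>y. norm (B y) \<le> M * norm y"
    using linear_bounded_pos[OF linB] by blast
  \<comment> \<open>Compactness of the interval enters here, as a uniform gap between the path and
    \<open>L1\<close>.\<close>
  obtain c1 where c1: "c1 > 0" "\<And>t x y. \<lbrakk>t \<in> {\<alpha>..\<beta>}; x \<in> l t; y \<in> L1\<rbrakk> \<Longrightarrow> c1 * norm y \<le> norm (y - x)"
  proof (rule transverse_family_bound[of "{\<alpha>..\<beta>}" l L1])
    show "\<And>x. continuous_on {\<alpha>..\<beta>} (\<lambda>t. closest_point (l t) x)" using l unfolding lag_continuous_on_def by blast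
    show "\<And>t. t \<in> {\<alpha>..\<beta>} \<Longrightarrow> subspace (l t)" using lt lagrangian_def by blast
    show "\<And>t. t \<in> {\<alpha>..\<beta>} \<Longrightarrow> l t \<inter> L1 \<subseteq> {0}" using tr transverse_def by blast
  qed (use d in auto)
  \<comment> \<open>The vectors of \<open>L1\<close> orthogonal to \<open>K\<close> meet
    \<open>L0\<close> only in 0, so they too have a gap, \<open>c2\<close>. In \<open>tr_0\<close>
    the sign of the perturbation handles the directions of \<open>K\<close> and its smallness
    handles \<open>L1K\<close>.\<close>
  define L1K where "L1K = L1 \<inter> {y. \<forall>x\<in>K. orthogonal x y}"
  have sL1K: "subspace L1K"
    unfolding L1K_def by (intro subspace_inter d subspace_orthogonal_to_vectors)
  have L0K: "L0 \<inter> L1K \<subseteq> {0}" unfolding L1K_def K_def orthogonal_def using inner_eq_zero_iff by blast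
  obtain c2 where c2: "c2 > 0" "\<And>x y. \<lbrakk>x \<in> L0; y \<in> L1K\<rbrakk> \<Longrightarrow> c2 * norm y \<le> norm (y - x)"
    by (rule transverse_family_bound[of "{0::real}" "\<lambda>_. L0" L1K]) (use s0 sL1K L0K in auto)
  \<comment> \<open>Then \<epsilon> M is half of the smaller gap, so h moves each nonzero vector by
    less than either gap allows.\<close>
  define \<epsilon> where "\<epsilon> = min c1 c2 / (2 * M)"
  have \<epsilon>: "\<epsilon> > 0" using c1 c2 M by (simp add: \<epsilon>_def)
  have "\<epsilon> * M = min c1 c2 / 2" using M by (simp add: \<epsilon>_def)
  then have \<epsilon>M: "\<epsilon> * M < c1" "\<epsilon> * M < c2" using c1 c2 by auto
  define h where "h y = y + \<epsilon> *\<^sub>R B y" for y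
  have linh: "linear h" unfolding h_def
    by (intro linear_compose_add linear_ident linear_compose_scale_right linB)
  have hB: "norm (h y - y) \<le> \<epsilon> * M * norm y" for y
    using M(2)[of y] \<epsilon> by (simp add: h_def mult_left_mono)
  define L' where "L' = h ` L1"
  have tr_l: "y = 0" if "t \<in> {\<alpha>..\<beta>}" "y \<in> L1" "h y \<in> l t" for t y
  proof (rule ccontr)
    assume "y \<noteq> 0"
    have "c1 * norm y \<le> \<epsilon> * M * norm y"
      using c1(2)[OF that(1,3,2)] hB[of y] by (simp add: norm_minus_commute)
    then show False using \<epsilon>M(1) \<open>y \<noteq> 0\<close> by simp
  qed
  have tr_0: "y = 0" if "y \<in> L1" "h y \<in> L0" for y
  proof (rule ccontr)
    assume "y \<noteq> 0"
    \<comment> \<open>Both \<open>h y\<close> and x lie in \<open>L0\<close>, so their pairing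
      \<epsilon> (y \<bullet> x) vanishes.\<close>
    have "orthogonal x y" if x: "x \<in> K" for x
    proof -
      have x': "x \<in> L0" "x \<in> L1" using x by (auto simp: K_def)
      have "\<omega> (h y) x = 0" using iso[OF L0 \<open>h y \<in> L0\<close> x'(1)] .
      then have "\<epsilon> * (y \<bullet> x) = 0" using iso[OF L1 \<open>y \<in> L1\<close> x'(2)] \<omega>B[OF x'(2), of y] by (simp add: h_def form_simps)
      then show ?thesis using \<epsilon> by (simp add: orthogonal_def inner_commute)
    qed
    then have "y \<in> L1K" using that by (simp add: L1K_def)
    then have "c2 * norm y \<le> \<epsilon> * M * norm y"
      using c2(2)[OF that(2)] hB[of y] by (simp add: norm_minus_commute) (meson order_trans)
    then show False using \<epsilon>M(2) \<open>y \<noteq> 0\<close> by simp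
  qed
  have inj: "inj_on h (span L1)"
  proof -
    have "y = 0" if "y \<in> L1" "h y = 0" for y
      using tr_0[OF that(1)] that(2) s0 by (simp add: subspace_0)
    then show ?thesis
      using linear_injective_on_subspace_0[OF linh d(1)] d(1) by (simp add: span_eq_iff[THEN iffD2])
  qed
  have lag': "lagrangian \<omega> L'"
    unfolding lagrangian_def
  proof (intro conjI ballI)
    show "subspace L'" unfolding L'_def by (rule linear_subspace_image[OF linh d(1)])
    show "2 * dim L' = DIM('v)" unfolding L'_def dim_image_eq[OF linh inj] using L1 lagrangian_def by blast
    fix u v assume "u \<in> L'" "v \<in> L'"
    then obtain y z where yz: "y \<in> L1" "z \<in> L1" "u = h y" "v = h z" by (auto simp: L'_def)
    \<comment> \<open>The terms of first order in \<epsilon> are y \<bullet> z - z \<bullet> y = 0;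
      those of order 0 and 2 vanish because \<open>L1\<close> and \<open>L2\<close> are
      isotropic.\<close>
    have "\<omega> y (B z) = - (z \<bullet> y)" using antisym[of y "B z"] \<omega>B[OF yz(1)] by simp
    then show "\<omega> u v = 0"
      using iso[OF L1 yz(1,2)] iso[OF L2(1) B2 B2] \<omega>B[OF yz(2)]
      by (simp add: yz(3,4) h_def form_simps inner_commute)
  qed
  have zero: "0 \<in> L'" using lag' subspace_0 unfolding lagrangian_def by blast
  have trL0: "transverse L0 L'"
    using zero tr_0 s0 linear_0[OF linh] by (auto simp: transverse_def L'_def subspace_0)
  have trl: "transverse (l t) L'" if "t \<in> {\<alpha>..\<beta>}" for t
    using zero tr_l[OF that] lt[OF that] linear_0[OF linh]
    by (auto simp: transverse_def L'_def lagrangian_def subspace_0)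
  have neg: "lag_chart \<omega> L0 L' (l t) x x < 0" if t: "t \<in> {\<alpha>..\<beta>}" and x: "x \<in> K" "x \<noteq> 0" for t x
  proof -
    have gm: "graph_map L0 L' (l t) x \<in> L'" "x + graph_map L0 L' (l t) x \<in> l t"
      by (rule graph_map[OF lag' lt[OF t] trl[OF t]])+
    then obtain y where y: "y \<in> L1" "graph_map L0 L' (l t) x = h y" unfolding L'_def by auto
    have xL: "x \<in> L1" using x by (simp add: K_def)
    have "\<omega> (h y) x = \<epsilon> * (y \<bullet> x)" using iso[OF L1 y(1) xL] \<omega>B[OF xL] by (simp add: h_def form_simps)
    moreover have "y \<noteq> 0"
    proof
      assume "y = 0"
      then have "x \<in> l t" using gm(2) y(2) linear_0[OF linh] by simp
      then show False using tr[OF t] xL x(2) unfolding transverse_def by blast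
    qed
    \<comment> \<open>The vector x + y of \<open>L1\<close> differs from x + h y, a vector of the
      path, only by \<epsilon> B y. The gap \<open>c1\<close> makes it shorter than y, and y
      \<bullet> (x + y) < y \<bullet> y follows by Cauchy-Schwarz.\<close>
    moreover have "y \<bullet> x < 0"
    proof -
      have "c1 * norm (x + y) \<le> norm (x + y - (x + h y))"
        by (rule c1(2)[OF t gm(2)[unfolded y(2)] subspace_add[OF d(1) xL y(1)]])
      also have "\<dots> \<le> \<epsilon> * M * norm y" using hB[of y] by (simp add: norm_minus_commute)
      also have "\<dots> < c1 * norm y" using \<epsilon>M \<open>y \<noteq> 0\<close> by simp
      finally have "norm (x + y) < norm y" using c1(1) by simp
      then have "norm y * norm (x + y) < norm y * norm y" using \<open>y \<noteq> 0\<close> by simp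
      moreover have "y \<bullet> (x + y) \<le> norm y * norm (x + y)" by (rule norm_cauchy_schwarz)
      ultimately show ?thesis by (simp add: inner_add_right dot_square_norm power2_eq_square)
    qed
    ultimately show ?thesis using \<epsilon> by (simp add: lag_chart_def y(2) mult_pos_neg)
  qed
  have np: "n_plus L0 (lag_chart \<omega> L0 L' (l t)) \<le> dim L0 - dim K" if "t \<in> {\<alpha>..\<beta>}" for t
    by (rule n_plus_le[OF s0 K _ neg[OF that]]) (simp add: K_def)
  have "\<mu> L0 \<alpha> \<beta> l = int (n_plus L0 (lag_chart \<omega> L0 L' (l \<beta>))) - int (n_plus L0 (lag_chart \<omega> L0 L' (l \<alpha>)))"
    using mu[unfolded is_maslov_index_def] L0 ab l lag' trL0 trl by blast
  then show ?thesis using np[of \<alpha>] np[of \<beta>] ab unfolding K_def by simp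
qed

end

section \<open>Charts and tangent vectors\<close>

locale semi_riem =
  fixes M :: "('m::topological_space, 'n::finite) semi_riemannian"
  assumes semi_riemannian: "semi_riemannian_manifold M"
begin

lemma smooth_manifold: "smooth_manifold M"
  using semi_riemannian semi_riemannian_manifold_def by blast

definition overlap :: "('m, 'n) chart \<Rightarrow> ('m, 'n) chart \<Rightarrow> (real ^ 'n) set" where
  "overlap c d = cmap c ` (cdom c \<inter> cdom d)"

definition Dtr :: "('m, 'n) chart \<Rightarrow> ('m, 'n) chart \<Rightarrow> real ^ 'n \<Rightarrow> real ^ 'n \<Rightarrow> real ^ 'n" where
  "Dtr c d x = frechet_derivative (cmap d \<circ> cinv c) (at x)"

lemma chart_at: "chart_at M p \<in> charts M" "p \<in> cdom (chart_at M p)"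
  using smooth_manifold unfolding smooth_manifold_def by blast+

context
  fixes c assumes c: "c \<in> charts M"
begin

lemma is_chart: "is_chart c"
  using c smooth_manifold unfolding smooth_manifold_def by blast

lemma open_cdom: "open (cdom c)" and open_image: "open (cmap c ` cdom c)"
  and homeo: "homeomorphism (cdom c) (cmap c ` cdom c) (cmap c) (cinv c)"
  using is_chart unfolding is_chart_def by blast+

lemma cinv_cmap: "p \<in> cdom c \<Longrightarrow> cinv c (cmap c p) = p"
  using homeo by (rule homeomorphism_apply1)

lemma open_overlap: "open (overlap c d)" if d: "open (cdom d)"
proof -
  have "open (cmap c ` cdom c \<inter> cinv c -` cdom d)"
    using homeomorphism_cont2[OF homeo] open_image d by (rule continuous_open_preimage)
  moreover have "cmap c ` cdom c \<inter> cinv c -` cdom d = overlap c d"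
    unfolding overlap_def using cinv_cmap by (auto intro!: imageI)
  ultimately show ?thesis by simp
qed

end

lemma open_overlap': "c \<in> charts M \<Longrightarrow> d \<in> charts M \<Longrightarrow> open (overlap c d)"
  using open_overlap open_cdom by blast

lemma overlapE:
  assumes "x \<in> overlap c d"
  obtains p where "p \<in> cdom c" "p \<in> cdom d" "x = cmap c p"
  using assms unfolding overlap_def by blast

lemma overlapI: "p \<in> cdom c \<Longrightarrow> p \<in> cdom d \<Longrightarrow> cmap c p \<in> overlap c d"
  unfolding overlap_def by blast

lemma transition_smooth:
  assumes "c \<in> charts M" "d \<in> charts M"
  shows "smooth_on (overlap c d) (cmap d \<circ> cinv c)"
  using assms smooth_manifold unfolding smooth_manifold_def smooth_transition_def overlap_def by blast

lemma transition_has_derivative: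
  assumes "c \<in> charts M" "d \<in> charts M" "x \<in> overlap c d"
  shows "((cmap d \<circ> cinv c) has_derivative Dtr c d x) (at x)"
  unfolding Dtr_def by (rule smooth_on_has_derivative[OF transition_smooth[OF assms(1,2)] assms(3)])

lemma Dtr_linear:
  assumes "c \<in> charts M" "d \<in> charts M" "x \<in> overlap c d"
  shows "linear (Dtr c d x)"
  using transition_has_derivative[OF assms] has_derivative_linear by blast

lemma Dtr_smooth:
  assumes "c \<in> charts M" "d \<in> charts M"
  shows "smooth_on (overlap c d) (\<lambda>x. Dtr c d x v)"
  unfolding Dtr_def by (rule smooth_on_frechet_derivative[OF transition_smooth[OF assms]])

text \<open>\<open>tcoord\<close> and \<open>tvec\<close> are the transition differentials from and
  to the preferred chart, so this cocycle rule yields both their mutual inversion and their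
  behaviour under change of chart.\<close>

lemma Dtr_chain:
  assumes cde: "c \<in> charts M" "d \<in> charts M" "e \<in> charts M"
    and p: "p \<in> cdom c" "p \<in> cdom d" "p \<in> cdom e"
  shows "Dtr d e (cmap d p) (Dtr c d (cmap c p) v) = Dtr c e (cmap c p) v"
proof -
  have x: "(cmap d \<circ> cinv c) (cmap c p) = cmap d p" using cinv_cmap[OF cde(1) p(1)] by simp
  have 1: "((cmap d \<circ> cinv c) has_derivative Dtr c d (cmap c p)) (at (cmap c p))"
    by (intro transition_has_derivative cde overlapI p)
  have 2: "((cmap e \<circ> cinv d) has_derivative Dtr d e ((cmap d \<circ> cinv c) (cmap c p))) (at ((cmap d \<circ> cinv c) (cmap c p)))"
    unfolding x by (intro transition_has_derivative cde overlapI p)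
  from has_derivative_compose[OF 1 2]
  have "((cmap e \<circ> cinv c) has_derivative
      (\<lambda>v. Dtr d e ((cmap d \<circ> cinv c) (cmap c p)) (Dtr c d (cmap c p) v))) (at (cmap c p))"
    by (rule has_derivative_transform_within_open[OF _ open_overlap'[OF cde(1,2)] overlapI[OF p(1,2)]])
      (auto elim!: overlapE simp: cinv_cmap cde)
  moreover have "((cmap e \<circ> cinv c) has_derivative Dtr c e (cmap c p)) (at (cmap c p))"
    by (intro transition_has_derivative cde overlapI p)
  ultimately show ?thesis unfolding x by (metis has_derivative_unique)
qed

lemma Dtr_self:
  assumes "c \<in> charts M" "p \<in> cdom c"
  shows "Dtr c c (cmap c p) v = v"
proof -
  have "((\<lambda>y. y) has_derivative (\<lambda>v. v)) (at (cmap c p))" by (rule has_derivative_ident)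
  then have "((cmap c \<circ> cinv c) has_derivative (\<lambda>v. v)) (at (cmap c p))"
    by (rule has_derivative_transform_within_open[OF _ open_overlap'[OF assms(1,1)] overlapI[OF assms(2,2)]])
      (auto elim!: overlapE simp: cinv_cmap assms)
  moreover have "((cmap c \<circ> cinv c) has_derivative Dtr c c (cmap c p)) (at (cmap c p))"
    by (intro transition_has_derivative assms overlapI)
  ultimately show ?thesis by (metis has_derivative_unique)
qed

lemma Dtr_inverse:
  assumes "c \<in> charts M" "d \<in> charts M" "p \<in> cdom c" "p \<in> cdom d"
  shows "Dtr d c (cmap d p) (Dtr c d (cmap c p) v) = v"
  using Dtr_chain[OF assms(1,2,1) assms(3,4,3)] Dtr_self[OF assms(1,3)] by simp

lemma tcoord_Dtr: "tcoord M c p v = Dtr (chart_at M p) c (cmap (chart_at M p) p) v"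
  by (simp add: tcoord_def Dtr_def)

lemma tvec_Dtr: "tvec M c p u = Dtr c (chart_at M p) (cmap c p) u"
  by (simp add: tvec_def Dtr_def)

lemma tcoord_change:
  assumes "c \<in> charts M" "d \<in> charts M" "p \<in> cdom c" "p \<in> cdom d"
  shows "Dtr c d (cmap c p) (tcoord M c p v) = tcoord M d p v"
  unfolding tcoord_Dtr by (intro Dtr_chain assms chart_at)

lemma tcoord_linear: "c \<in> charts M \<Longrightarrow> p \<in> cdom c \<Longrightarrow> linear (tcoord M c p)"
  unfolding tcoord_Dtr[abs_def] using Dtr_linear chart_at overlapI by blast

lemma tvec_linear: "c \<in> charts M \<Longrightarrow> p \<in> cdom c \<Longrightarrow> linear (tvec M c p)"
  unfolding tvec_Dtr[abs_def] using Dtr_linear chart_at overlapI by blast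

lemma tvec_tcoord: "c \<in> charts M \<Longrightarrow> p \<in> cdom c \<Longrightarrow> tvec M c p (tcoord M c p v) = v"
  unfolding tcoord_Dtr tvec_Dtr by (intro Dtr_inverse chart_at)

lemma tcoord_tvec: "c \<in> charts M \<Longrightarrow> p \<in> cdom c \<Longrightarrow> tcoord M c p (tvec M c p v) = v"
  unfolding tcoord_Dtr tvec_Dtr by (intro Dtr_inverse chart_at)

lemma tvec_change:
  assumes "c \<in> charts M" "d \<in> charts M" "p \<in> cdom c" "p \<in> cdom d"
  shows "tvec M d p (Dtr c d (cmap c p) v) = tvec M c p v"
  unfolding tvec_Dtr by (intro Dtr_chain assms chart_at)

lemma tcoord_chart_at: "tcoord M (chart_at M p) p v = v"
  unfolding tcoord_Dtr by (intro Dtr_self chart_at)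

section \<open>The metric and the Christoffel tensor in a chart\<close>

abbreviation g where "g \<equiv> metric_coord M"
abbreviation \<Gamma> where "\<Gamma> \<equiv> christoffel M"

lemma metric: "bilinear (metric M p)" "metric M p u v = metric M p v u"
  "(\<And>v. metric M p u v = 0) \<Longrightarrow> u = 0"
  using semi_riemannian unfolding semi_riemannian_manifold_def nondegenerate_on_def by blast+

lemma g_cmap:
  assumes "c \<in> charts M" "p \<in> cdom c"
  shows "g c (cmap c p) u v = metric M p (tvec M c p u) (tvec M c p v)"
  by (simp add: metric_coord_def cinv_cmap assms)

lemma metric_tcoord:
  assumes "c \<in> charts M" "p \<in> cdom c"
  shows "metric M p u v = g c (cmap c p) (tcoord M c p u) (tcoord M c p v)"
  by (simp add: g_cmap tvec_tcoord assms)

lemma g_change: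
  assumes "c \<in> charts M" "d \<in> charts M" "p \<in> cdom c" "p \<in> cdom d"
  shows "g d (cmap d p) (Dtr c d (cmap c p) u) (Dtr c d (cmap c p) v) = g c (cmap c p) u v"
  by (simp add: g_cmap tvec_change assms)

lemma g_sym: "g c x u v = g c x v u"
  unfolding metric_coord_def by (rule metric)

definition dg where "dg c x h u v = frechet_derivative (\<lambda>y. g c y u v) (at x) h"

lemma dg_sym: "dg c x h u v = dg c x h v u"
  unfolding dg_def using g_sym[of c] by metis

context
  fixes c assumes c: "c \<in> charts M"
begin

lemma g_bilinear: "x \<in> cmap c ` cdom c \<Longrightarrow> bilinear (g c x)"
proof -
  assume "x \<in> cmap c ` cdom c"
  then obtain p where p: "p \<in> cdom c" "x = cmap c p" by blast
  note t = tvec_linear[OF c p(1)] and m = metric(1)[of p]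
  have "linear (\<lambda>v. metric M p (tvec M c p u) (tvec M c p v))" for u
    using linear_compose[OF t, of "metric M p (tvec M c p u)"] m unfolding bilinear_def comp_def by blast
  moreover have "linear (\<lambda>u. metric M p (tvec M c p u) (tvec M c p v))" for v
    using linear_compose[OF t, of "\<lambda>w. metric M p w (tvec M c p v)"] m unfolding bilinear_def comp_def by blast
  ultimately show ?thesis unfolding bilinear_def p(2) g_cmap[OF c p(1)] by blast
qed

lemma g_nondeg: "x \<in> cmap c ` cdom c \<Longrightarrow> (\<And>v. g c x u v = 0) \<Longrightarrow> u = 0"
proof -
  assume "x \<in> cmap c ` cdom c" and z: "\<And>v. g c x u v = 0"
  then obtain p where p: "p \<in> cdom c" "x = cmap c p" by blast
  have "metric M p (tvec M c p u) w = 0" for w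
    using z[of "tcoord M c p w"] unfolding p(2) g_cmap[OF c p(1)] tvec_tcoord[OF c p(1)] .
  then have "tvec M c p u = 0" by (rule metric)
  then show "u = 0" using tcoord_tvec[OF c p(1), of u] linear_0[OF tcoord_linear[OF c p(1)]] by simp
qed

lemma g_smooth: "smooth_on (cmap c ` cdom c) (\<lambda>x. g c x u v)"
  using semi_riemannian c unfolding semi_riemannian_manifold_def by blast

lemma dg_smooth: "smooth_on (cmap c ` cdom c) (\<lambda>x. dg c x h u v)"
  unfolding dg_def by (rule smooth_on_frechet_derivative[OF g_smooth])

context
  fixes x assumes x: "x \<in> cmap c ` cdom c"
begin

lemma g_has_derivative: "((\<lambda>y. g c y u v) has_derivative (\<lambda>h. dg c x h u v)) (at x)"
  unfolding dg_def using smooth_on_has_derivative[OF g_smooth x] by simp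

lemma dg_linear1: "linear (\<lambda>h. dg c x h u v)"
  using g_has_derivative has_derivative_linear by blast

text \<open>\<open>dg\<close> differentiates one coefficient function at a time, so its linearity in
  \<open>u\<close> and \<open>v\<close> must come from uniqueness of derivatives.\<close>

lemma g_eq_imp_dg_eq:
  assumes "\<And>y. y \<in> cmap c ` cdom c \<Longrightarrow> f y = g c y u v" "(f has_derivative f') (at x)"
  shows "dg c x h u v = f' h"
proof -
  have "((\<lambda>y. g c y u v) has_derivative f') (at x)"
    by (rule has_derivative_transform_within_open[OF assms(2) open_image[OF c] x assms(1)])
  then show ?thesis using g_has_derivative has_derivative_unique by metis
qed

lemma dg_linear2: "linear (\<lambda>u. dg c x h u v)"
proof (rule linearI)
  show "dg c x h (u + u') v = dg c x h u v + dg c x h u' v" for u u'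
    by (rule g_eq_imp_dg_eq[where f = "\<lambda>y. g c y u v + g c y u' v"])
      (auto intro!: has_derivative_add g_has_derivative simp: bilinear_ladd[OF g_bilinear])
  show "dg c x h (r *\<^sub>R u) v = r *\<^sub>R dg c x h u v" for r u
    by (rule g_eq_imp_dg_eq[where f = "\<lambda>y. r *\<^sub>R g c y u v"])
      (auto intro!: has_derivative_mult_right g_has_derivative simp: bilinear_lmul[OF g_bilinear])
qed

lemma dg_linear3: "linear (\<lambda>v. dg c x h u v)"
  using dg_linear2[of h u] dg_sym by simp

lemmas g_simps = bilinear_ladd[OF g_bilinear[OF x]] bilinear_radd[OF g_bilinear[OF x]]
  bilinear_lmul[OF g_bilinear[OF x]] bilinear_rmul[OF g_bilinear[OF x]]
  bilinear_lsub[OF g_bilinear[OF x]] bilinear_rsub[OF g_bilinear[OF x]]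

text \<open>The right-hand side is linear in \<open>w\<close> and the metric is nondegenerate; this
  makes the \<open>THE\<close> in \<open>christoffel\<close> meaningful.\<close>

lemma koszul_ex1: "\<exists>!z. \<forall>w. 2 * g c x z w = dg c x u v w + dg c x v u w - dg c x w u v"
proof -
  have "linear (\<lambda>w. (dg c x u v w + dg c x v u w - dg c x w u v) / 2)"
    by (rule linearI)
      (simp_all add: linear_add[OF dg_linear3] linear_add[OF dg_linear1]
        linear_scale[OF dg_linear3] linear_scale[OF dg_linear1] field_simps)
  from ex1_form_represents[OF g_bilinear[OF x] g_nondeg[OF x] this] show ?thesis by (simp add: field_simps)
qed

lemma koszul: "2 * g c x (\<Gamma> c x u v) w = dg c x u v w + dg c x v u w - dg c x w u v"
  using theI'[OF koszul_ex1[of u v]] unfolding christoffel_def dg_def by blast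

lemma christoffel_unique:
  assumes "\<And>w. 2 * g c x z w = dg c x u v w + dg c x v u w - dg c x w u v"
  shows "\<Gamma> c x u v = z"
  using koszul_ex1[of u v] koszul[of u v] assms by blast

lemma christoffel_sym: "\<Gamma> c x u v = \<Gamma> c x v u"
  by (rule christoffel_unique) (simp add: koszul dg_sym[of c x _ u v])

lemma christoffel_linear1: "linear (\<lambda>u. \<Gamma> c x u v)"
proof (rule linearI)
  show "\<Gamma> c x (u + u') v = \<Gamma> c x u v + \<Gamma> c x u' v" for u u'
    by (rule christoffel_unique)
      (use linear_add[OF dg_linear1] linear_add[OF dg_linear2] koszul[of u v] koszul[of u' v] in
        \<open>simp add: g_simps distrib_left\<close>)
  show "\<Gamma> c x (r *\<^sub>R u) v = r *\<^sub>R \<Gamma> c x u v" for r u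
  proof (rule christoffel_unique)
    fix w
    have "2 * g c x (r *\<^sub>R \<Gamma> c x u v) w = r * (2 * g c x (\<Gamma> c x u v) w)" by (simp add: g_simps)
    then show "2 * g c x (r *\<^sub>R \<Gamma> c x u v) w = dg c x (r *\<^sub>R u) v w + dg c x v (r *\<^sub>R u) w - dg c x w (r *\<^sub>R u) v"
      using linear_scale[OF dg_linear1] linear_scale[OF dg_linear2] by (simp add: koszul algebra_simps)
  qed
qed

lemma christoffel_bilinear: "bilinear (\<Gamma> c x)"
  unfolding bilinear_def using christoffel_linear1 christoffel_sym by simp

text \<open>In the sum of the Koszul formulas for (h, u, v) and (h, v, u) all terms cancel except
  twice the derivative along \<open>h\<close>.\<close>

lemma metric_compatible: "dg c x h u v = g c x (\<Gamma> c x h u) v + g c x u (\<Gamma> c x h v)"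
  using koszul[of h u v] koszul[of h v u] dg_sym[of c x _ u v] dg_sym[of c x _ h v] dg_sym[of c x _ h u]
    g_sym[of c x u "\<Gamma> c x h v"] by simp

end

end

end

section \<open>Curvature\<close>

text \<open>The classical octahedron argument: four instances of the Bianchi identity are combined,
  and the skew symmetries identify their terms up to sign. \<open>linarith\<close> receives all
  instances explicitly.\<close>

lemma pair_symmetry:
  fixes R :: "'a \<Rightarrow> 'a \<Rightarrow> 'a \<Rightarrow> 'a \<Rightarrow> real"
  assumes "\<And>a b c d. R a b c d = - R b a c d" "\<And>a b c d. R a b c d = - R a b d c"
    and "\<And>a b c d. R a b c d + R b c a d + R c a b d = 0"
  shows "R a b c d = R c d a b"
  using assms(3)[of a b c d] assms(3)[of b c d a] assms(3)[of c d a b] assms(3)[of d a b c]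
    assms(1)[of c d a b] assms(1)[of d a b c] assms(1)[of a c d b] assms(1)[of b d c a] assms(1)[of c a b d]
    assms(1)[of d b c a] assms(1)[of a d c b] assms(1)[of b c a d]
    assms(2)[of a b c d] assms(2)[of b c a d] assms(2)[of c a b d] assms(2)[of c d b a] assms(2)[of d b c a]
    assms(2)[of d a c b] assms(2)[of a c d b] assms(2)[of a b d c] assms(2)[of b d a c] assms(2)[of d a b c] assms(2)[of b c d a]
    assms(2)[of c d a b] assms(2)[of a c b d] assms(2)[of b d c a]
  by linarith

context semi_riem begin

definition D\<Gamma> where "D\<Gamma> c x h u v = frechet_derivative (\<lambda>y. \<Gamma> c y u v) (at x) h"

text \<open>The right-hand side of the linear system for the Christoffel tensor whose coefficient is
  \<open>form_vector (g c x)\<close>. \<open>Dkoszul\<close> and \<open>Dform\<close> are the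
  derivatives of the right-hand side and of the coefficient.\<close>

definition koszul_vector where
  "koszul_vector c x u v = (\<Sum>i\<in>Basis. ((dg c x u v i + dg c x v u i - dg c x i u v) / 2) *\<^sub>R i)"

definition Dkoszul where
  "Dkoszul c x u v h = (\<Sum>i\<in>Basis. ((frechet_derivative (\<lambda>y. dg c y u v i) (at x) h
     + frechet_derivative (\<lambda>y. dg c y v u i) (at x) h
     - frechet_derivative (\<lambda>y. dg c y i u v) (at x) h) / 2) *\<^sub>R i)"

definition Dform where "Dform c x z h = (\<Sum>i\<in>Basis. dg c x h z i *\<^sub>R i)"

context
  fixes c assumes c: "c \<in> charts M"
begin

lemma form_christoffel:
  assumes "x \<in> cmap c ` cdom c"
  shows "form_vector (g c x) (\<Gamma> c x u v) = koszul_vector c x u v"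
proof -
  have "g c x (\<Gamma> c x u v) i = (dg c x u v i + dg c x v u i - dg c x i u v) / 2" for i
    using koszul[OF c assms, of u v i] by simp
  then show ?thesis unfolding koszul_vector_def form_vector_eq_iff[OF g_bilinear[OF c assms]] by blast
qed

lemma continuous_form: "continuous_on (cmap c ` cdom c) (\<lambda>x. form_vector (g c x) z)"
  unfolding form_vector_def by (intro continuous_intros smooth_on_continuous_on g_smooth c)

lemma continuous_koszul_vector: "continuous_on (cmap c ` cdom c) (\<lambda>x. koszul_vector c x u v)"
  unfolding koszul_vector_def by (intro continuous_intros smooth_on_continuous_on dg_smooth c) simp

lemma continuous_Dkoszul: "continuous_on (cmap c ` cdom c) (\<lambda>x. Dkoszul c x u v h)"
  unfolding Dkoszul_def
  by (intro continuous_intros smooth_on_continuous_on smooth_on_frechet_derivative dg_smooth c) simp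

lemma continuous_Dform: "continuous_on (cmap c ` cdom c) (\<lambda>x. Dform c x z h)"
  unfolding Dform_def by (intro continuous_intros smooth_on_continuous_on dg_smooth c)

lemma continuous_christoffel: "continuous_on (cmap c ` cdom c) (\<lambda>x. \<Gamma> c x u v)"
  by (rule continuous_on_linear_solve[where A = "\<lambda>x. form_vector (g c x)",
        OF linear_form_vector[OF g_bilinear[OF c]] inj_form_vector[OF g_bilinear[OF c] g_nondeg[OF c]]
        continuous_form continuous_koszul_vector form_christoffel])

lemma koszul_vector_has_derivative:
  assumes "x \<in> cmap c ` cdom c"
  shows "((\<lambda>y. koszul_vector c y u v) has_derivative Dkoszul c x u v) (at x)"
proof -
  have d: "((\<lambda>y. dg c y h u v) has_derivative frechet_derivative (\<lambda>y. dg c y h u v) (at x)) (at x)" for h u v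
    by (rule smooth_on_has_derivative[OF dg_smooth[OF c] assms])
  show ?thesis unfolding koszul_vector_def Dkoszul_def[abs_def]
    by (intro has_derivative_sum has_derivative_scaleR_left bounded_linear.has_derivative[OF bounded_linear_divide]
        has_derivative_add has_derivative_diff d)
qed

lemma form_has_derivative:
  assumes "x \<in> cmap c ` cdom c"
  shows "((\<lambda>y. form_vector (g c y) z) has_derivative Dform c x z) (at x)"
  unfolding form_vector_def Dform_def[abs_def]
  by (intro has_derivative_sum has_derivative_scaleR_left g_has_derivative c assms)

context
  fixes x assumes x: "x \<in> cmap c ` cdom c"
begin

text \<open>Implicit differentiation of \<open>form_christoffel\<close>. The second fact presents
  \<open>D\<Gamma>\<close> in turn as the solution of a linear system with continuous data, from
  which \<open>continuous_D\<Gamma>\<close> is obtained.\<close>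

lemma christoffel_derivative:
  "((\<lambda>y. \<Gamma> c y u v) has_derivative (\<lambda>h. D\<Gamma> c x h u v)) (at x)"
  "form_vector (g c x) (D\<Gamma> c x h u v) = Dkoszul c x u v h - Dform c x (\<Gamma> c x u v) h"
proof -
  note w = at_within_open[OF x open_image[OF c]]
  have 1: "((\<lambda>y. form_vector (g c y) z) has_derivative Dform c x z) (at x within cmap c ` cdom c)" for z
    unfolding w by (rule form_has_derivative[OF x])
  have 2: "((\<lambda>y. koszul_vector c y u v) has_derivative Dkoszul c x u v) (at x within cmap c ` cdom c)"
    unfolding w by (rule koszul_vector_has_derivative[OF x])
  obtain y' where y0: "((\<lambda>y. \<Gamma> c y u v) has_derivative y') (at x within cmap c ` cdom c)" and y1:
    "\<And>h. form_vector (g c x) (y' h) = Dkoszul c x u v h - Dform c x (\<Gamma> c x u v) h"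
    by (rule has_derivative_linear_solve[where A = "\<lambda>x. form_vector (g c x)",
        OF linear_form_vector[OF g_bilinear[OF c]] inj_form_vector[OF g_bilinear[OF c] g_nondeg[OF c]]
        x continuous_form continuous_koszul_vector 1 2 form_christoffel]) (assumption+, blast)
  note y' = y0[unfolded w] y1
  have "y' = (\<lambda>h. D\<Gamma> c x h u v)"
    unfolding D\<Gamma>_def using frechet_derivative_at[OF y'(1)] by simp
  with y' show "((\<lambda>y. \<Gamma> c y u v) has_derivative (\<lambda>h. D\<Gamma> c x h u v)) (at x)"
    "form_vector (g c x) (D\<Gamma> c x h u v) = Dkoszul c x u v h - Dform c x (\<Gamma> c x u v) h" by auto
qed

lemma D\<Gamma>_eqI:
  assumes "\<And>y. y \<in> cmap c ` cdom c \<Longrightarrow> f y = \<Gamma> c y u v" "(f has_derivative f') (at x)"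
  shows "D\<Gamma> c x h u v = f' h"
proof -
  have "((\<lambda>y. \<Gamma> c y u v) has_derivative f') (at x)"
    by (rule has_derivative_transform_within_open[OF assms(2) open_image[OF c] x assms(1)])
  then show ?thesis using christoffel_derivative(1) has_derivative_unique by metis
qed

lemma D\<Gamma>_linear1: "linear (\<lambda>h. D\<Gamma> c x h u v)"
  using christoffel_derivative(1) has_derivative_linear by blast

lemma D\<Gamma>_sym: "D\<Gamma> c x h u v = D\<Gamma> c x h v u"
  by (rule D\<Gamma>_eqI[OF christoffel_sym[OF c] christoffel_derivative(1)])

lemma D\<Gamma>_linear2: "linear (\<lambda>u. D\<Gamma> c x h u v)"
proof (rule linearI)
  show "D\<Gamma> c x h (u + u') v = D\<Gamma> c x h u v + D\<Gamma> c x h u' v" for u u'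
    by (rule D\<Gamma>_eqI[where f = "\<lambda>y. \<Gamma> c y u v + \<Gamma> c y u' v"])
      (auto intro!: has_derivative_add christoffel_derivative(1) simp: bilinear_ladd[OF christoffel_bilinear[OF c]])
  show "D\<Gamma> c x h (r *\<^sub>R u) v = r *\<^sub>R D\<Gamma> c x h u v" for r u
    by (rule D\<Gamma>_eqI[where f = "\<lambda>y. r *\<^sub>R \<Gamma> c y u v"])
      (auto intro!: has_derivative_scaleR_right christoffel_derivative(1) simp: bilinear_lmul[OF christoffel_bilinear[OF c]])
qed

lemma D\<Gamma>_linear3: "linear (\<lambda>v. D\<Gamma> c x h u v)"
  using D\<Gamma>_linear2[of h u] D\<Gamma>_sym by simp

end

lemma continuous_D\<Gamma>: "continuous_on (cmap c ` cdom c) (\<lambda>x. D\<Gamma> c x h u v)"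
proof (rule continuous_on_linear_solve[where A = "\<lambda>x. form_vector (g c x)",
        OF linear_form_vector[OF g_bilinear[OF c]] inj_form_vector[OF g_bilinear[OF c] g_nondeg[OF c]]
        continuous_form _ christoffel_derivative(2)])
  show "continuous_on (cmap c ` cdom c) (\<lambda>x. Dkoszul c x u v h - Dform c x (\<Gamma> c x u v) h)"
  proof (rule continuous_on_diff[OF continuous_Dkoszul])
    show "continuous_on (cmap c ` cdom c) (\<lambda>x. Dform c x (\<Gamma> c x u v) h)"
    proof (rule continuous_on_linear_apply[where A = "\<lambda>x z. Dform c x z h", OF _ continuous_Dform continuous_christoffel])
      fix x assume x: "x \<in> cmap c ` cdom c"
      show "linear (\<lambda>z. Dform c x z h)"
        by (rule linearI) (simp_all add: Dform_def linear_add[OF dg_linear2[OF c x]] linear_scale[OF dg_linear2[OF c x]]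
            scaleR_left_distrib sum.distrib scaleR_sum_right)
    qed
  qed
qed

end

definition Rc where
  "Rc c x u v w = D\<Gamma> c x u v w - D\<Gamma> c x v u w + \<Gamma> c x u (\<Gamma> c x v w) - \<Gamma> c x v (\<Gamma> c x u w)"

text \<open>For constant fields the bracket is zero, and a covariant derivative along the zero field
  vanishes.\<close>

lemma curvature_Rc:
  assumes c: "c \<in> charts M" and x: "x \<in> cmap c ` cdom c"
  shows "curvature M c (\<lambda>_. u) (\<lambda>_. v) (\<lambda>_. w) x = Rc c x u v w"
  using bilinear_lzero[OF christoffel_bilinear[OF c x]]
  by (simp add: curvature_def nabla_def[abs_def] lie_bracket_def[abs_def] Rc_def D\<Gamma>_def)

lemma riemann_Rc: "riemann M p u v w = Rc (chart_at M p) (cmap (chart_at M p) p) u v w"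
  unfolding riemann_def by (rule curvature_Rc) (auto intro: chart_at)

context
  fixes c x assumes c: "c \<in> charts M" and x: "x \<in> cmap c ` cdom c"
begin

lemma Rc_linear:
  "linear (\<lambda>u. Rc c x u v w)" "linear (\<lambda>v. Rc c x u v w)" "linear (\<lambda>w. Rc c x u v w)"
  using christoffel_bilinear[OF c x]
  by (auto intro!: linearI simp: Rc_def bilinear_ladd bilinear_radd bilinear_lmul bilinear_rmul
      linear_add[OF D\<Gamma>_linear1[OF c x]] linear_add[OF D\<Gamma>_linear2[OF c x]] linear_add[OF D\<Gamma>_linear3[OF c x]]
      linear_scale[OF D\<Gamma>_linear1[OF c x]] linear_scale[OF D\<Gamma>_linear2[OF c x]] linear_scale[OF D\<Gamma>_linear3[OF c x]]
      algebra_simps)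

lemma Rc_skew12: "Rc c x u v w = - Rc c x v u w"
  by (simp add: Rc_def)

lemma Rc_bianchi: "Rc c x u v w + Rc c x v w u + Rc c x w u v = 0"
  unfolding Rc_def
  using D\<Gamma>_sym[OF c x, of u v w] D\<Gamma>_sym[OF c x, of v u w] D\<Gamma>_sym[OF c x, of w u v]
    christoffel_sym[OF c x, of u v] christoffel_sym[OF c x, of v w] christoffel_sym[OF c x, of u w] by simp

text \<open>Metric compatibility gives the first derivative of g(w, w) as twice g(\<Gamma>(v, w),
  w); it is used once more when this is differentiated.\<close>

lemma second_derivative_metric:
  "frechet_derivative (\<lambda>y. frechet_derivative (\<lambda>y. g c y w w) (at y) v) (at x) u
   = 2 * (g c x (\<Gamma> c x u (\<Gamma> c x v w)) w + g c x (\<Gamma> c x v w) (\<Gamma> c x u w) + g c x (D\<Gamma> c x u v w) w)"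
proof -
  have "((\<lambda>y. g c y (\<Gamma> c y v w) w) has_derivative
      (\<lambda>u. dg c x u (\<Gamma> c x v w) w + g c x (D\<Gamma> c x u v w) w)) (at x within cmap c ` cdom c)"
  proof (rule has_derivative_linear_apply[where A = "\<lambda>y z. g c y z w", OF _ x])
    show "linear (\<lambda>z. g c y z w)" if "y \<in> cmap c ` cdom c" for y
      using g_bilinear[OF c that] bilinear_def by blast
    show "((\<lambda>y. g c y z w) has_derivative (\<lambda>h. dg c x h z w)) (at x within cmap c ` cdom c)" for z
      by (rule has_derivative_at_withinI[OF g_has_derivative[OF c x]])
    show "((\<lambda>y. \<Gamma> c y v w) has_derivative (\<lambda>u. D\<Gamma> c x u v w)) (at x within cmap c ` cdom c)"
      by (rule has_derivative_at_withinI[OF christoffel_derivative(1)[OF c x]])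
  qed
  then have "((\<lambda>y. g c y (\<Gamma> c y v w) w) has_derivative
      (\<lambda>u. dg c x u (\<Gamma> c x v w) w + g c x (D\<Gamma> c x u v w) w)) (at x)"
    unfolding at_within_open[OF x open_image[OF c]] .
  from has_derivative_mult_right[OF this, of 2]
  have "((\<lambda>y. dg c y v w w) has_derivative
      (\<lambda>u. 2 * (dg c x u (\<Gamma> c x v w) w + g c x (D\<Gamma> c x u v w) w))) (at x)"
    by (rule has_derivative_transform_within_open[OF _ open_image[OF c] x])
      (simp add: metric_compatible[OF c] g_sym)
  then have "frechet_derivative (\<lambda>y. dg c y v w w) (at x) u = 2 * (dg c x u (\<Gamma> c x v w) w + g c x (D\<Gamma> c x u v w) w)"
    by (simp add: frechet_derivative_at[symmetric])
  then show ?thesis unfolding metric_compatible[OF c x, of u "\<Gamma> c x v w"] by (simp add: dg_def)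
qed

text \<open>Exchanging u and v does not change the second derivative of g(w, w), and the difference
  of the two expressions for it is twice g(R(u, v) w, w). Polarisation then gives
  \<open>g_Rc_skew\<close>.\<close>

lemma g_Rc_diagonal: "g c x (Rc c x u v w) w = 0"
proof -
  have s: "smooth_on (cmap c ` cdom c) (\<lambda>y. g c y w w)" by (rule g_smooth[OF c])
  have "frechet_derivative (\<lambda>y. frechet_derivative (\<lambda>y. g c y w w) (at y) v) (at x) u =
      frechet_derivative (\<lambda>y. frechet_derivative (\<lambda>y. g c y w w) (at y) u) (at x) v"
    by (rule symmetric_second_derivative[OF open_image[OF c] x s])
  then show ?thesis unfolding second_derivative_metric Rc_def
    using g_sym[of c x "\<Gamma> c x v w" "\<Gamma> c x u w"] by (simp add: g_simps[OF c x])
qed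

lemma g_Rc_skew: "g c x (Rc c x u v w) z = - g c x (Rc c x u v z) w"
  using g_Rc_diagonal[of u v "w + z"] g_Rc_diagonal[of u v w] g_Rc_diagonal[of u v z]
  by (simp add: linear_add[OF Rc_linear(3)] g_simps[OF c x])

text \<open>The operator v \<mapsto> R(u, v) u is self-adjoint: a special case of pair symmetry, and
  the reason why the symplectic form is constant on pairs of Jacobi fields.\<close>

lemma g_Rc_sym: "g c x (Rc c x u v u) w = g c x (Rc c x u w u) v"
proof (rule pair_symmetry[where R = "\<lambda>u v w z. g c x (Rc c x u v w) z"])
  fix a b d z
  show "g c x (Rc c x a b d) z = - g c x (Rc c x b a d) z"
    using Rc_skew12[of a b d] bilinear_lneg[OF g_bilinear[OF c x]] by metis
  show "g c x (Rc c x a b d) z = - g c x (Rc c x a b z) d" by (rule g_Rc_skew)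
  show "g c x (Rc c x a b d) z + g c x (Rc c x b d a) z + g c x (Rc c x d a b) z = 0"
    using Rc_bianchi[of a b d] by (simp add: g_simps(1)[OF c x, symmetric] bilinear_lzero[OF g_bilinear[OF c x]])
qed

end

section \<open>Change of charts\<close>

text \<open>The second derivative of the transition map, that is, the inhomogeneous term in the
  transformation of the Christoffel tensor.\<close>

definition Htr where "Htr c d x u v = frechet_derivative (\<lambda>y. Dtr c d y v) (at x) u"

context
  fixes c d assumes c: "c \<in> charts M" and d: "d \<in> charts M"
begin

lemma Dtr_has_derivative:
  assumes "x \<in> overlap c d"
  shows "((\<lambda>y. Dtr c d y v) has_derivative (\<lambda>u. Htr c d x u v)) (at x)"
  unfolding Htr_def using smooth_on_has_derivative[OF Dtr_smooth[OF c d] assms] by simp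

lemma Htr_sym: "x \<in> overlap c d \<Longrightarrow> Htr c d x u v = Htr c d x v u"
  unfolding Htr_def Dtr_def
  by (rule symmetric_second_derivative[OF open_overlap'[OF c d] _ transition_smooth[OF c d]])

lemma Htr_has_derivative:
  assumes "x \<in> overlap c d"
  shows "((\<lambda>y. Htr c d y u v) has_derivative (\<lambda>h. frechet_derivative (\<lambda>y. Htr c d y u v) (at x) h)) (at x)"
  unfolding Htr_def
  using smooth_on_has_derivative[OF smooth_on_frechet_derivative[OF Dtr_smooth[OF c d]] assms] by simp

lemma DHtr_sym:
  assumes "x \<in> overlap c d"
  shows "frechet_derivative (\<lambda>y. Htr c d y u v) (at x) h = frechet_derivative (\<lambda>y. Htr c d y h v) (at x) u"
  unfolding Htr_def
  by (rule symmetric_second_derivative[OF open_overlap'[OF c d] assms Dtr_smooth[OF c d]])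

lemma overlap_image: "x \<in> overlap c d \<Longrightarrow> x \<in> cmap c ` cdom c"
  "x \<in> overlap c d \<Longrightarrow> (cmap d \<circ> cinv c) x \<in> cmap d ` cdom d"
  by (auto elim!: overlapE simp: cinv_cmap[OF c])

context
  fixes p assumes p: "p \<in> cdom c" "p \<in> cdom d"
begin

lemma dg_change:
  "dg c (cmap c p) h u v = dg d (cmap d p) (Dtr c d (cmap c p) h) (Dtr c d (cmap c p) u) (Dtr c d (cmap c p) v)
    + g d (cmap d p) (Htr c d (cmap c p) h u) (Dtr c d (cmap c p) v)
    + g d (cmap d p) (Dtr c d (cmap c p) u) (Htr c d (cmap c p) h v)"
proof -
  let ?x = "cmap c p" and ?\<phi> = "cmap d \<circ> cinv c"
  have \<phi>x: "?\<phi> ?x = cmap d p" by (simp add: cinv_cmap[OF c p(1)])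
  have x: "?x \<in> overlap c d" by (rule overlapI[OF p])
  note w = at_within_open[OF x open_overlap'[OF c d]]
  have y: "cmap d p \<in> cmap d ` cdom d" using p by simp
  have "((\<lambda>y. g d (?\<phi> y) (Dtr c d y u) (Dtr c d y v)) has_derivative
    (\<lambda>h. dg d (cmap d p) (Dtr c d ?x h) (Dtr c d ?x u) (Dtr c d ?x v)
      + g d (?\<phi> ?x) (Htr c d ?x h u) (Dtr c d ?x v) + g d (?\<phi> ?x) (Dtr c d ?x u) (Htr c d ?x h v)))
    (at ?x within overlap c d)"
  proof (rule has_derivative_bilinear_apply[where B = "\<lambda>y. g d (?\<phi> y)", OF _ x], goal_cases)
    case (1 s) then show ?case by (rule g_bilinear[OF d overlap_image(2)])
  next
    case (2 u v)
    have "((\<lambda>y. g d y u v) has_derivative (\<lambda>h. dg d (cmap d p) h u v)) (at (?\<phi> ?x))"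
      unfolding \<phi>x by (rule g_has_derivative[OF d y])
    from has_derivative_compose[OF transition_has_derivative[OF c d x] this]
    show ?case unfolding w .
  qed (simp_all only: w Dtr_has_derivative[OF x])
  then have "((\<lambda>y. g d (?\<phi> y) (Dtr c d y u) (Dtr c d y v)) has_derivative
    (\<lambda>h. dg d (cmap d p) (Dtr c d ?x h) (Dtr c d ?x u) (Dtr c d ?x v)
      + g d (?\<phi> ?x) (Htr c d ?x h u) (Dtr c d ?x v) + g d (?\<phi> ?x) (Dtr c d ?x u) (Htr c d ?x h v))) (at ?x)"
    unfolding w .
  then have "((\<lambda>y. g c y u v) has_derivative
    (\<lambda>h. dg d (cmap d p) (Dtr c d ?x h) (Dtr c d ?x u) (Dtr c d ?x v)
      + g d (?\<phi> ?x) (Htr c d ?x h u) (Dtr c d ?x v) + g d (?\<phi> ?x) (Dtr c d ?x u) (Htr c d ?x h v))) (at ?x)"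
    by (rule has_derivative_transform_within_open[OF _ open_overlap'[OF c d] x])
      (auto elim!: overlapE simp: cinv_cmap[OF c] g_change[OF c d])
  from fun_cong[OF frechet_derivative_at[OF this], of h] show ?thesis unfolding dg_def[of c] \<phi>x by simp
qed

text \<open>The pullback of the right-hand side satisfies the Koszul formula of \<open>c\<close>. Of
  the six \<open>Htr\<close> terms that \<open>dg_change\<close> produces there, four cancel by
  symmetry and two coincide.\<close>

lemma christoffel_change:
  "Dtr c d (cmap c p) (\<Gamma> c (cmap c p) u v) =
    \<Gamma> d (cmap d p) (Dtr c d (cmap c p) u) (Dtr c d (cmap c p) v) + Htr c d (cmap c p) u v"
proof -
  let ?\<Phi> = "Dtr c d (cmap c p)" and ?H = "Htr c d (cmap c p)"
  have x: "cmap c p \<in> overlap c d" by (rule overlapI[OF p])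
  have xc: "cmap c p \<in> cmap c ` cdom c" and xd: "cmap d p \<in> cmap d ` cdom d" using p by auto
  let ?z = "Dtr d c (cmap d p) (\<Gamma> d (cmap d p) (?\<Phi> u) (?\<Phi> v) + ?H u v)"
  have \<Phi>z: "?\<Phi> ?z = \<Gamma> d (cmap d p) (?\<Phi> u) (?\<Phi> v) + ?H u v" by (rule Dtr_inverse[OF d c p(2,1)])
  have "\<Gamma> c (cmap c p) u v = ?z"
  proof (rule christoffel_unique[OF c xc])
    fix w
    have "2 * g c (cmap c p) ?z w = 2 * g d (cmap d p) (\<Gamma> d (cmap d p) (?\<Phi> u) (?\<Phi> v) + ?H u v) (?\<Phi> w)"
      unfolding g_change[OF c d p, symmetric, of ?z w] \<Phi>z ..
    also have "\<dots> = 2 * g d (cmap d p) (\<Gamma> d (cmap d p) (?\<Phi> u) (?\<Phi> v)) (?\<Phi> w) + 2 * g d (cmap d p) (?H u v) (?\<Phi> w)"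
      by (simp add: g_simps[OF d xd])
    also have "\<dots> = dg c (cmap c p) u v w + dg c (cmap c p) v u w - dg c (cmap c p) w u v"
      unfolding koszul[OF d xd] dg_change Htr_sym[OF x, of v u] Htr_sym[OF x, of w u] Htr_sym[OF x, of w v]
      using g_sym[of d "cmap d p" "?\<Phi> u"] g_sym[of d "cmap d p" "?\<Phi> v"] by simp
    finally show "2 * g c (cmap c p) ?z w = dg c (cmap c p) u v w + dg c (cmap c p) v u w - dg c (cmap c p) w u v" .
  qed
  then show ?thesis using \<Phi>z by simp
qed

end

text \<open>The point is fixed anew so that \<open>christoffel_change\<close> is available at all
  points of the overlap, as is needed to differentiate it.\<close>

context
  fixes p assumes p: "p \<in> cdom c" "p \<in> cdom d"
begin

text \<open>The two sides of \<open>christoffel_change\<close> are differentiated separately by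
  product rules, and uniqueness of the derivative equates the results.\<close>

lemma D\<Gamma>_change:
  "Dtr c d (cmap c p) (D\<Gamma> c (cmap c p) h u v) =
    D\<Gamma> d (cmap d p) (Dtr c d (cmap c p) h) (Dtr c d (cmap c p) u) (Dtr c d (cmap c p) v)
    + \<Gamma> d (cmap d p) (Htr c d (cmap c p) h u) (Dtr c d (cmap c p) v)
    + \<Gamma> d (cmap d p) (Dtr c d (cmap c p) u) (Htr c d (cmap c p) h v)
    + frechet_derivative (\<lambda>y. Htr c d y u v) (at (cmap c p)) h
    - Htr c d (cmap c p) h (\<Gamma> c (cmap c p) u v)"
proof -
  let ?x = "cmap c p" and ?\<phi> = "cmap d \<circ> cinv c"
  have \<phi>x: "?\<phi> ?x = cmap d p" by (simp add: cinv_cmap[OF c p(1)])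
  have x: "?x \<in> overlap c d" by (rule overlapI[OF p])
  note w = at_within_open[OF x open_overlap'[OF c d]]
  have xc: "?x \<in> cmap c ` cdom c" and y: "cmap d p \<in> cmap d ` cdom d" using p by auto
  have "((\<lambda>y. \<Gamma> d (?\<phi> y) (Dtr c d y u) (Dtr c d y v)) has_derivative
    (\<lambda>h. D\<Gamma> d (cmap d p) (Dtr c d ?x h) (Dtr c d ?x u) (Dtr c d ?x v)
      + \<Gamma> d (?\<phi> ?x) (Htr c d ?x h u) (Dtr c d ?x v) + \<Gamma> d (?\<phi> ?x) (Dtr c d ?x u) (Htr c d ?x h v)))
    (at ?x within overlap c d)"
  proof (rule has_derivative_bilinear_apply[where B = "\<lambda>y. \<Gamma> d (?\<phi> y)", OF _ x], goal_cases)
    case (1 s) then show ?case by (rule christoffel_bilinear[OF d overlap_image(2)])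
  next
    case (2 u v)
    have "((\<lambda>y. \<Gamma> d y u v) has_derivative (\<lambda>h. D\<Gamma> d (cmap d p) h u v)) (at (?\<phi> ?x))"
      unfolding \<phi>x by (rule christoffel_derivative(1)[OF d y])
    from has_derivative_compose[OF transition_has_derivative[OF c d x] this]
    show ?case unfolding w .
  qed (simp_all only: w Dtr_has_derivative[OF x])
  from has_derivative_add[OF this[unfolded w] Htr_has_derivative[OF x, of u v]]
  have 1: "((\<lambda>y. Dtr c d y (\<Gamma> c y u v)) has_derivative
    (\<lambda>h. D\<Gamma> d (cmap d p) (Dtr c d ?x h) (Dtr c d ?x u) (Dtr c d ?x v)
      + \<Gamma> d (?\<phi> ?x) (Htr c d ?x h u) (Dtr c d ?x v) + \<Gamma> d (?\<phi> ?x) (Dtr c d ?x u) (Htr c d ?x h v)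
      + frechet_derivative (\<lambda>y. Htr c d y u v) (at ?x) h)) (at ?x)"
    by (rule has_derivative_transform_within_open[OF _ open_overlap'[OF c d] x])
      (auto elim!: overlapE simp: cinv_cmap[OF c] christoffel_change)
  have "((\<lambda>y. Dtr c d y (\<Gamma> c y u v)) has_derivative
    (\<lambda>h. Htr c d ?x h (\<Gamma> c ?x u v) + Dtr c d ?x (D\<Gamma> c ?x h u v))) (at ?x within overlap c d)"
    by (rule has_derivative_linear_apply[OF Dtr_linear[OF c d] x])
      (simp_all only: w Dtr_has_derivative[OF x] christoffel_derivative(1)[OF c xc])
  from has_derivative_unique[OF this[unfolded w] 1] have
    "Htr c d ?x h (\<Gamma> c ?x u v) + Dtr c d ?x (D\<Gamma> c ?x h u v) =
      D\<Gamma> d (cmap d p) (Dtr c d ?x h) (Dtr c d ?x u) (Dtr c d ?x v)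
      + \<Gamma> d (?\<phi> ?x) (Htr c d ?x h u) (Dtr c d ?x v) + \<Gamma> d (?\<phi> ?x) (Dtr c d ?x u) (Htr c d ?x h v)
      + frechet_derivative (\<lambda>y. Htr c d y u v) (at ?x) h" by metis
  then show ?thesis unfolding \<phi>x by (simp add: algebra_simps)
qed

text \<open>Antisymmetrising \<open>D\<Gamma>_change\<close> removes the third derivatives of the
  transition map; its \<open>Htr\<close> terms cancel against those from the quadratic part. So the
  curvature, defined in preferred charts, may be computed in any chart.\<close>

lemma Rc_change:
  "Dtr c d (cmap c p) (Rc c (cmap c p) u v w) =
    Rc d (cmap d p) (Dtr c d (cmap c p) u) (Dtr c d (cmap c p) v) (Dtr c d (cmap c p) w)"
proof -
  let ?x = "cmap c p"
  have x: "?x \<in> overlap c d" by (rule overlapI[OF p])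
  have y: "cmap d p \<in> cmap d ` cdom d" using p by auto
  note L = Dtr_linear[OF c d x]
  show ?thesis
    unfolding Rc_def linear_add[OF L] linear_diff[OF L] D\<Gamma>_change christoffel_change[OF p]
      bilinear_radd[OF christoffel_bilinear[OF d y]]
    using DHtr_sym[OF x, of v w u] Htr_sym[OF x, of u v]
      christoffel_sym[OF d y, of "Htr c d ?x u w" "Dtr c d ?x v"]
    by (simp add: algebra_simps)
qed

end

end

lemma tcoord_riemann:
  assumes "c \<in> charts M" "p \<in> cdom c"
  shows "tcoord M c p (riemann M p u v w) = Rc c (cmap c p) (tcoord M c p u) (tcoord M c p v) (tcoord M c p w)"
  unfolding tcoord_Dtr riemann_Rc by (intro Rc_change assms chart_at)

end

section \<open>Kernels of continuous families of surjections\<close>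

lemma closest_point_subspace_eqI:
  fixes V :: "'e::euclidean_space set"
  assumes V: "subspace V" and p: "p \<in> V" "\<And>k. k \<in> V \<Longrightarrow> (z - p) \<bullet> k = 0"
  shows "closest_point V z = p"
proof (rule closest_point_unique[symmetric])
  show "convex V" "closed V" using V by (auto simp: subspace_imp_convex closed_subspace)
  show "\<forall>k\<in>V. dist z p \<le> dist z k"
  proof
    fix k assume k: "k \<in> V"
    have "orthogonal (z - p) (p - k)" using p(2)[OF subspace_diff[OF V p(1) k]] by (simp add: orthogonal_def)
    from norm_add_Pythagorean[OF this] have "(norm (z - p))\<^sup>2 \<le> (norm (z - k))\<^sup>2" by simp
    then show "dist z p \<le> dist z k" unfolding dist_norm by (rule power2_le_imp_le) simp
  qed
qed (rule p)

text \<open>With the adjoint \<open>Y t\<close> of \<open>X t\<close>, surjectivity makes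
  \<open>X t \<circ> Y t\<close> invertible. The projection subtracts from \<open>x\<close> its
  component in the range of \<open>Y t\<close>, found from a linear system that depends continuously
  on \<open>t\<close>.\<close>

lemma continuous_on_kernel_projection:
  fixes X :: "'s::topological_space \<Rightarrow> 'e::euclidean_space \<Rightarrow> 'f::euclidean_space"
  assumes lin: "\<And>t. t \<in> T \<Longrightarrow> linear (X t)" and sur: "\<And>t. t \<in> T \<Longrightarrow> surj (X t)"
    and cont: "\<And>z. continuous_on T (\<lambda>t. X t z)"
  shows "continuous_on T (\<lambda>t. closest_point {z. X t z = 0} x)"
proof -
  define Y where "Y t y = (\<Sum>i\<in>Basis. (X t i \<bullet> y) *\<^sub>R i)" for t y
  have Y: "Y t y \<bullet> z = y \<bullet> X t z" if "t \<in> T" for t y z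
    by (simp add: Y_def inner_sum_left linear_sum_Basis[OF lin[OF that], of z] inner_sum_right
        inner_commute[of z] inner_commute[of y] mult.commute)
  have linY: "linear (Y t)" for t
    by (rule linearI) (simp_all add: Y_def inner_add_right scaleR_left_distrib sum.distrib scaleR_sum_right)
  have contY: "continuous_on T (\<lambda>t. Y t y)" for y unfolding Y_def by (intro continuous_intros cont)
  have linN: "linear (\<lambda>y. X t (Y t y))" if "t \<in> T" for t
    using linear_compose[OF linY lin[OF that]] by (simp add: comp_def)
  have injN: "inj (\<lambda>y. X t (Y t y))" if t: "t \<in> T" for t
  proof -
    have "y = 0" if "X t (Y t y) = 0" for y
    proof -
      have "Y t y \<bullet> Y t y = 0" unfolding Y[OF t] that by simp
      then have "y \<bullet> X t z = 0" for z using Y[OF t, of y z] by simp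
      moreover obtain z where "y = X t z" using sur[OF t] by (metis surjD)
      ultimately show ?thesis by (metis inner_eq_zero_iff)
    qed
    then show ?thesis using linear_injective_0[OF linN[OF t]] by blast
  qed
  define y where "y t = inv (\<lambda>y. X t (Y t y)) (X t x)" for t
  have y: "X t (Y t (y t)) = X t x" if "t \<in> T" for t
    unfolding y_def using linear_inj_imp_surj[OF linN[OF that] injN[OF that]]
    by (rule surj_f_inv_f[where f = "\<lambda>y. X t (Y t y)"])
  have "continuous_on T y"
    by (rule continuous_on_linear_solve[where A = "\<lambda>t y. X t (Y t y)", OF linN injN _ cont y])
      (auto intro: continuous_on_linear_apply[OF lin cont contY])
  then have "continuous_on T (\<lambda>t. x - Y t (y t))"
    by (intro continuous_intros continuous_on_linear_apply[OF linY contY])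
  moreover have "closest_point {z. X t z = 0} x = x - Y t (y t)" if t: "t \<in> T" for t
  proof (rule closest_point_subspace_eqI)
    show "subspace {z. X t z = 0}" by (rule linear_subspace_kernel[OF lin[OF t]])
    show "x - Y t (y t) \<in> {z. X t z = 0}" using y[OF t] by (simp add: linear_diff lin t)
  qed (use Y[OF t] in simp)
  ultimately show ?thesis by (simp cong: continuous_on_cong)
qed

section \<open>Fields along a geodesic\<close>

context semi_riem begin

text \<open>Velocities are defined in the preferred chart of the current point; the chain rule
  carries them to \<open>c\<close>. The set \<open>X\<close> allows both \<gamma> on
  \<open>{a..b}\<close> and curves inside a submanifold.\<close>

lemma curve_in_chart:
  fixes \<sigma> :: "real \<Rightarrow> 'm"
  assumes c: "c \<in> charts M" and t: "t \<in> X" "\<sigma> t \<in> cdom c"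
    and cont: "continuous (at t within X) \<sigma>"
    and d: "((\<lambda>s. cmap (chart_at M (\<sigma> t)) (\<sigma> s)) has_vector_derivative v) (at t within X)"
  shows "((\<lambda>s. cmap c (\<sigma> s)) has_vector_derivative tcoord M c (\<sigma> t) v) (at t within X)"
proof -
  let ?e = "chart_at M (\<sigma> t)"
  note e = chart_at[of "\<sigma> t"]
  have o: "cmap ?e (\<sigma> t) \<in> overlap ?e c" by (rule overlapI[OF e(2) t(2)])
  have "((\<lambda>s. (cmap c \<circ> cinv ?e) (cmap ?e (\<sigma> s))) has_derivative
      (\<lambda>h. Dtr ?e c (cmap ?e (\<sigma> t)) (h *\<^sub>R v))) (at t within X)"
    using has_derivative_compose[OF d[unfolded has_vector_derivative_def] transition_has_derivative[OF e(1) c o]] .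
  then have 1: "((\<lambda>s. (cmap c \<circ> cinv ?e) (cmap ?e (\<sigma> s))) has_vector_derivative tcoord M c (\<sigma> t) v) (at t within X)"
    by (simp add: has_vector_derivative_def tcoord_Dtr linear_scale[OF Dtr_linear[OF e(1) c o]])
  have "(\<sigma> \<longlongrightarrow> \<sigma> t) (at t within X)" using cont by (simp add: continuous_within)
  from topological_tendstoD[OF this open_cdom[OF e(1)] e(2)]
  obtain r where r: "r > 0" "\<And>s. s \<in> X \<Longrightarrow> s \<noteq> t \<Longrightarrow> dist s t < r \<Longrightarrow> \<sigma> s \<in> cdom ?e"
    unfolding eventually_at by auto
  show ?thesis
  proof (rule has_vector_derivative_transform_within[OF 1 r(1) t(1)])
    fix s assume "s \<in> X" "dist s t < r"
    then have "\<sigma> s \<in> cdom ?e" using r(2) e(2) by (cases "s = t") auto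
    then show "(cmap c \<circ> cinv ?e) (cmap ?e (\<sigma> s)) = cmap c (\<sigma> s)" by (simp add: cinv_cmap[OF e(1)])
  qed
qed

end

locale semi_riem_geodesic = semi_riem M
  for M :: "('m::topological_space, 'n::finite) semi_riemannian" +
  fixes \<gamma> :: "real \<Rightarrow> 'm" and a b :: real
  assumes ab: "a < b" and geo: "geodesic M {a..b} \<gamma>"
begin

abbreviation "vel \<equiv> velocity M {a..b} \<gamma>"
abbreviation "pos c t \<equiv> cmap c (\<gamma> t)"
abbreviation "vc c t \<equiv> tcoord M c (\<gamma> t) (vel t)"

definition dom :: "('m, 'n) chart \<Rightarrow> real set" where
  "dom c = {a..b} \<inter> \<gamma> -` cdom c"

text \<open>The covariant derivative at one time and in one chart, within an arbitrary set: the
  local form in which independence of the chart must be known for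
  \<open>linear_ode_bundle\<close>.\<close>

definition cov_at where
  "cov_at c X t J Y \<longleftrightarrow> ((\<lambda>s. tcoord M c (\<gamma> s) (J s)) has_vector_derivative
     tcoord M c (\<gamma> t) Y - \<Gamma> c (pos c t) (vc c t) (tcoord M c (\<gamma> t) (J t))) (at t within X)"

lemma has_cov_derivative_iff:
  "has_cov_derivative M {a..b} \<gamma> X Y \<longleftrightarrow> (\<forall>c\<in>charts M. \<forall>t\<in>dom c. cov_at c {a..b} t X (Y t))"
  unfolding has_cov_derivative_def cov_at_def dom_def by auto

lemma \<gamma>_continuous: "continuous_on {a..b} \<gamma>"
  using geo unfolding geodesic_def differentiable_curve_def by blast

lemma openin_dom: "c \<in> charts M \<Longrightarrow> openin (top_of_set {a..b}) (dom c)"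
  unfolding dom_def by (intro continuous_openin_preimage_gen \<gamma>_continuous open_cdom)

lemma domD: "t \<in> dom c \<Longrightarrow> t \<in> {a..b}" "t \<in> dom c \<Longrightarrow> \<gamma> t \<in> cdom c"
  unfolding dom_def by auto

lemma dom_chart_at: "t \<in> {a..b} \<Longrightarrow> t \<in> dom (chart_at M (\<gamma> t))"
  unfolding dom_def using chart_at by simp

lemma pos_image: "t \<in> dom c \<Longrightarrow> pos c t \<in> cmap c ` cdom c"
  using domD by blast

lemma pos_has_derivative:
  assumes c: "c \<in> charts M" and t: "t \<in> dom c"
  shows "(pos c has_vector_derivative vc c t) (at t within {a..b})"
proof (rule curve_in_chart[where \<sigma> = \<gamma>, OF c domD(1)[OF t] domD(2)[OF t]])
  show "continuous (at t within {a..b}) \<gamma>" using \<gamma>_continuous domD(1)[OF t] continuous_on_eq_continuous_within by blast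
  have "(\<lambda>s. cmap (chart_at M (\<gamma> t)) (\<gamma> s)) differentiable (at t within {a..b})"
    using geo domD(1)[OF t] unfolding geodesic_def differentiable_curve_def by blast
  then show "((\<lambda>s. cmap (chart_at M (\<gamma> t)) (\<gamma> s)) has_vector_derivative vel t) (at t within {a..b})"
    unfolding velocity_def by (rule vector_derivative_works[THEN iffD1])
qed

lemma continuous_pos:
  assumes "c \<in> charts M"
  shows "continuous_on (dom c) (pos c)"
proof (rule continuous_on_vector_derivative)
  fix t assume t: "t \<in> dom c"
  show "(pos c has_vector_derivative vc c t) (at t within dom c)"
    using pos_has_derivative[OF assms t] by (rule has_vector_derivative_within_subset) (auto dest: domD)
qed

text \<open>Continuity of the velocity comes from the geodesic equation, which exhibits a derivative
  of its components.\<close>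

lemma continuous_vc:
  assumes "c \<in> charts M"
  shows "continuous_on (dom c) (vc c)"
proof (rule continuous_on_vector_derivative)
  fix t assume t: "t \<in> dom c"
  have "has_cov_derivative M {a..b} \<gamma> vel (\<lambda>_. 0)" using geo geodesic_def by blast
  then have "cov_at c {a..b} t vel 0" using assms t unfolding has_cov_derivative_iff by blast
  then show "(vc c has_vector_derivative tcoord M c (\<gamma> t) 0 - \<Gamma> c (pos c t) (vc c t) (vc c t)) (at t within dom c)"
    unfolding cov_at_def by (rule has_vector_derivative_within_subset) (auto dest: domD)
qed

text \<open>As \<open>dom c\<close> is relatively open, product rules whose hypotheses hold only
  inside the chart can be applied there without changing the derivative.\<close>

lemma at_within_dom:
  assumes "c \<in> charts M" "t \<in> dom c" "X \<subseteq> {a..b}"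
  shows "at t within (X \<inter> dom c) = at t within X"
proof -
  obtain U where "open U" "dom c = {a..b} \<inter> U" using openin_dom[OF assms(1)] openin_open by metis
  then show ?thesis using assms by (intro at_within_nhd[of t U]) auto
qed

lemma Dtr_along:
  assumes c: "c \<in> charts M" "d \<in> charts M" and t: "t \<in> dom c" "t \<in> dom d" and X: "X \<subseteq> {a..b}"
  shows "((\<lambda>s. Dtr c d (pos c s) v) has_derivative (\<lambda>h. h *\<^sub>R Htr c d (pos c t) (vc c t) v)) (at t within X)"
proof -
  have o: "pos c t \<in> overlap c d" by (intro overlapI domD t)
  have p: "(pos c has_derivative (\<lambda>h. h *\<^sub>R vc c t)) (at t within X)"
    using has_vector_derivative_within_subset[OF pos_has_derivative[OF c(1) t(1)] X]
    unfolding has_vector_derivative_def .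
  have lin: "linear (\<lambda>u. Htr c d (pos c t) u v)"
    using Dtr_has_derivative[OF c o] has_derivative_linear by blast
  show ?thesis
    using has_derivative_compose[OF p Dtr_has_derivative[OF c o, of v]] by (simp add: linear_scale[OF lin])
qed

text \<open>Differentiating the transition differential along \<gamma> produces an
  \<open>Htr\<close> term, which cancels the one from \<open>christoffel_change\<close>.\<close>

lemma cov_at_change:
  assumes c: "c \<in> charts M" "d \<in> charts M" and t: "t \<in> dom c" "t \<in> dom d" "t \<in> X" and X: "X \<subseteq> {a..b}"
    and cov: "cov_at c X t J Y"
  shows "cov_at d X t J Y"
proof -
  let ?x = "\<lambda>s. tcoord M c (\<gamma> s) (J s)"
  have o: "pos c s \<in> overlap c d" if "s \<in> dom c" "s \<in> dom d" for s using that by (intro overlapI domD)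
  let ?X = "X \<inter> dom c \<inter> dom d"
  have w: "at t within ?X = at t within X"
    using at_within_dom[OF c(2) t(2), of "X \<inter> dom c"] at_within_dom[OF c(1) t(1) X] X by auto
  have sub: "?X \<subseteq> {a..b}" using X by auto
  have "((\<lambda>s. Dtr c d (pos c s) (?x s)) has_derivative
    (\<lambda>h. h *\<^sub>R Htr c d (pos c t) (vc c t) (?x t) + Dtr c d (pos c t) (h *\<^sub>R
      (tcoord M c (\<gamma> t) Y - \<Gamma> c (pos c t) (vc c t) (?x t))))) (at t within ?X)"
  proof (rule has_derivative_linear_apply[where A = "\<lambda>s. Dtr c d (pos c s)"])
    show "linear (Dtr c d (pos c s))" if "s \<in> ?X" for s using that by (intro Dtr_linear c o) auto
    show "t \<in> ?X" using t by simp
    show "((\<lambda>s. Dtr c d (pos c s) v) has_derivative (\<lambda>h. h *\<^sub>R Htr c d (pos c t) (vc c t) v)) (at t within ?X)" for v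
      by (rule Dtr_along[OF c t(1,2) sub])
    show "(?x has_derivative (\<lambda>h. h *\<^sub>R (tcoord M c (\<gamma> t) Y - \<Gamma> c (pos c t) (vc c t) (?x t)))) (at t within ?X)"
      using cov unfolding cov_at_def has_vector_derivative_def w .
  qed
  also have "(\<lambda>h. h *\<^sub>R Htr c d (pos c t) (vc c t) (?x t) + Dtr c d (pos c t) (h *\<^sub>R
      (tcoord M c (\<gamma> t) Y - \<Gamma> c (pos c t) (vc c t) (?x t)))) =
    (\<lambda>h. h *\<^sub>R (tcoord M d (\<gamma> t) Y - \<Gamma> d (pos d t) (vc d t) (tcoord M d (\<gamma> t) (J t))))"
  proof
    fix h
    note L = Dtr_linear[OF c o[OF t(1,2)]] and p = domD(2)[OF t(1)] domD(2)[OF t(2)]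
    show "h *\<^sub>R Htr c d (pos c t) (vc c t) (?x t) + Dtr c d (pos c t) (h *\<^sub>R
        (tcoord M c (\<gamma> t) Y - \<Gamma> c (pos c t) (vc c t) (?x t))) =
      h *\<^sub>R (tcoord M d (\<gamma> t) Y - \<Gamma> d (pos d t) (vc d t) (tcoord M d (\<gamma> t) (J t)))"
      unfolding linear_scale[OF L] linear_diff[OF L] christoffel_change[OF c p] tcoord_change[OF c p]
      by (simp add: algebra_simps)
  qed
  finally have 1: "((\<lambda>s. Dtr c d (pos c s) (?x s)) has_derivative
    (\<lambda>h. h *\<^sub>R (tcoord M d (\<gamma> t) Y - \<Gamma> d (pos d t) (vc d t) (tcoord M d (\<gamma> t) (J t))))) (at t within ?X)" .
  have "((\<lambda>s. tcoord M d (\<gamma> s) (J s)) has_derivative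
    (\<lambda>h. h *\<^sub>R (tcoord M d (\<gamma> t) Y - \<Gamma> d (pos d t) (vc d t) (tcoord M d (\<gamma> t) (J t))))) (at t within ?X)"
    by (rule has_derivative_transform[OF _ _ 1]) (use t tcoord_change[OF c domD(2) domD(2), symmetric] in auto)
  then show ?thesis unfolding cov_at_def has_vector_derivative_def w .
qed

text \<open>In a chart, the derivative of the metric coefficients supplies exactly the Christoffel
  terms missing from the ordinary derivatives of the components.\<close>

lemma metric_product_rule:
  assumes "has_cov_derivative M {a..b} \<gamma> X X'" "has_cov_derivative M {a..b} \<gamma> Y Y'" and t: "t \<in> {a..b}"
  shows "((\<lambda>s. metric M (\<gamma> s) (X s) (Y s)) has_vector_derivative
    metric M (\<gamma> t) (X' t) (Y t) + metric M (\<gamma> t) (X t) (Y' t)) (at t within {a..b})"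
proof -
  let ?c = "chart_at M (\<gamma> t)"
  have c: "?c \<in> charts M" and tc: "t \<in> dom ?c" using chart_at dom_chart_at[OF t] by blast+
  let ?x = "\<lambda>s. tcoord M ?c (\<gamma> s) (X s)" and ?y = "\<lambda>s. tcoord M ?c (\<gamma> s) (Y s)"
  let ?x' = "tcoord M ?c (\<gamma> t) (X' t) - \<Gamma> ?c (pos ?c t) (vc ?c t) (?x t)"
  let ?y' = "tcoord M ?c (\<gamma> t) (Y' t) - \<Gamma> ?c (pos ?c t) (vc ?c t) (?y t)"
  have w: "at t within dom ?c = at t within {a..b}"
    using at_within_dom[OF c tc, of "{a..b}"] domD(1) by (metis Int_absorb1 subsetI)
  have p: "(pos ?c has_derivative (\<lambda>h. h *\<^sub>R vc ?c t)) (at t within dom ?c)"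
    using pos_has_derivative[OF c tc] unfolding has_vector_derivative_def w .
  note x = pos_image[OF tc]
  have "((\<lambda>s. g ?c (pos ?c s) (?x s) (?y s)) has_derivative
    (\<lambda>h. h * dg ?c (pos ?c t) (vc ?c t) (?x t) (?y t) + g ?c (pos ?c t) (h *\<^sub>R ?x') (?y t)
      + g ?c (pos ?c t) (?x t) (h *\<^sub>R ?y'))) (at t within dom ?c)"
  proof (rule has_derivative_bilinear_apply[where B = "\<lambda>s. g ?c (pos ?c s)"])
    show "bilinear (g ?c (pos ?c s))" if "s \<in> dom ?c" for s by (rule g_bilinear[OF c pos_image[OF that]])
    show "((\<lambda>s. g ?c (pos ?c s) u v) has_derivative (\<lambda>h. h * dg ?c (pos ?c t) (vc ?c t) u v)) (at t within dom ?c)" for u v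
      using has_derivative_compose[OF p g_has_derivative[OF c x, of u v]] linear_scale[OF dg_linear1[OF c x]] by simp
    show "(?x has_derivative (\<lambda>h. h *\<^sub>R ?x')) (at t within dom ?c)" "(?y has_derivative (\<lambda>h. h *\<^sub>R ?y')) (at t within dom ?c)"
      using assms(1,2) c tc unfolding has_cov_derivative_iff cov_at_def has_vector_derivative_def w by blast+
  qed (rule tc)
  also have "(\<lambda>h. h * dg ?c (pos ?c t) (vc ?c t) (?x t) (?y t) + g ?c (pos ?c t) (h *\<^sub>R ?x') (?y t)
      + g ?c (pos ?c t) (?x t) (h *\<^sub>R ?y')) =
    (\<lambda>h. h *\<^sub>R (metric M (\<gamma> t) (X' t) (Y t) + metric M (\<gamma> t) (X t) (Y' t)))"
    unfolding metric_compatible[OF c x] metric_tcoord[OF c domD(2)[OF tc]]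
    by (simp add: g_simps[OF c x] algebra_simps)
  finally have 1: "((\<lambda>s. g ?c (pos ?c s) (?x s) (?y s)) has_derivative
    (\<lambda>h. h *\<^sub>R (metric M (\<gamma> t) (X' t) (Y t) + metric M (\<gamma> t) (X t) (Y' t)))) (at t within dom ?c)" .
  have "((\<lambda>s. metric M (\<gamma> s) (X s) (Y s)) has_derivative
    (\<lambda>h. h *\<^sub>R (metric M (\<gamma> t) (X' t) (Y t) + metric M (\<gamma> t) (X t) (Y' t)))) (at t within dom ?c)"
    by (rule has_derivative_transform[OF tc _ 1]) (rule metric_tcoord[OF c domD(2)])
  then show ?thesis unfolding has_vector_derivative_def w .
qed

section \<open>Jacobi fields\<close>

text \<open>A Jacobi field is treated as the first-order state (J, DJ/dt). \<open>FJ\<close> reads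
  this state in the chart \<open>c\<close>, and \<open>AJ\<close> is the right-hand side of the
  resulting system.\<close>

definition FJ where "FJ c t z = (tcoord M c (\<gamma> t) (fst z), tcoord M c (\<gamma> t) (snd z))"

definition AJ where
  "AJ c t z = (snd z - \<Gamma> c (pos c t) (vc c t) (fst z),
     Rc c (pos c t) (vc c t) (fst z) (vc c t) - \<Gamma> c (pos c t) (vc c t) (snd z))"

abbreviation "acc t v \<equiv> riemann M (\<gamma> t) (vel t) v (vel t)"

lemma jacobi_equation_chart:
  assumes "c \<in> charts M" "t \<in> dom c"
  shows "((\<lambda>s. FJ c s (Z s)) has_vector_derivative AJ c t (FJ c t (Z t))) (at t within X) \<longleftrightarrow>
    cov_at c X t (\<lambda>s. fst (Z s)) (snd (Z t)) \<and> cov_at c X t (\<lambda>s. snd (Z s)) (acc t (fst (Z t)))"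
proof -
  have pair: "((\<lambda>s. (f s, h s)) has_vector_derivative (f', h')) (at t within X) \<longleftrightarrow>
    (f has_vector_derivative f') (at t within X) \<and> (h has_vector_derivative h') (at t within X)"
    for f h :: "real \<Rightarrow> real ^ 'n" and f' h'
    using bounded_linear.has_vector_derivative[OF bounded_linear_fst, of "\<lambda>s. (f s, h s)" "(f', h')" "at t within X"]
      bounded_linear.has_vector_derivative[OF bounded_linear_snd, of "\<lambda>s. (f s, h s)" "(f', h')" "at t within X"]
      has_vector_derivative_Pair[of f f' t X h h'] by auto
  show ?thesis
    unfolding FJ_def AJ_def fst_conv snd_conv pair cov_at_def tcoord_riemann[OF assms(1) domD(2)[OF assms(2)]] ..
qed

text \<open>This provides \<open>jac.flow z\<close>, the Jacobi field with initial data
  \<open>z\<close> paired with its covariant derivative.\<close>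

sublocale jac: linear_ode_bundle a b "charts M" dom FJ AJ
proof (rule linear_ode_bundle.intro)
  show "a \<le> b" using ab by simp
  show "\<exists>c\<in>charts M. t \<in> dom c" if "t \<in> {a..b}" for t using dom_chart_at[OF that] chart_at by blast
  fix c assume c: "c \<in> charts M"
  show "openin (top_of_set {a..b}) (dom c)" by (rule openin_dom[OF c])
  show "continuous_on (dom c) (\<lambda>t. AJ c t v)" for v
  proof -
    have sub: "pos c ` dom c \<subseteq> cmap c ` cdom c" using pos_image by blast
    have \<Gamma>c: "continuous_on (dom c) (\<lambda>t. \<Gamma> c (pos c t) (p t) (q t))"
      if "continuous_on (dom c) p" "continuous_on (dom c) q" for p q
      by (rule continuous_on_bilinear_apply[where B = "\<lambda>t. \<Gamma> c (pos c t)", OF _ _ that])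
        (use christoffel_bilinear[OF c pos_image] continuous_on_compose2[OF continuous_christoffel[OF c] continuous_pos[OF c] sub] in auto)
    have D: "continuous_on (dom c) (\<lambda>t. D\<Gamma> c (pos c t) h u v)" for h u v
      by (rule continuous_on_compose2[OF continuous_D\<Gamma>[OF c] continuous_pos[OF c] sub])
    have D\<Gamma>c: "continuous_on (dom c) (\<lambda>t. D\<Gamma> c (pos c t) (h t) (p t) (q t))"
      if h: "continuous_on (dom c) h" and p: "continuous_on (dom c) p" and q: "continuous_on (dom c) q" for h p q
    proof (rule continuous_on_linear_apply[where A = "\<lambda>t. D\<Gamma> c (pos c t) (h t) (p t)", OF _ _ q])
      show "linear (D\<Gamma> c (pos c s) (h s) (p s))" if "s \<in> dom c" for s
        by (rule D\<Gamma>_linear3[OF c pos_image[OF that]])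
      show "continuous_on (dom c) (\<lambda>t. D\<Gamma> c (pos c t) (h t) (p t) w)" for w
      proof (rule continuous_on_linear_apply[where A = "\<lambda>t u. D\<Gamma> c (pos c t) (h t) u w", OF _ _ p])
        show "linear (\<lambda>u. D\<Gamma> c (pos c s) (h s) u w)" if "s \<in> dom c" for s
          by (rule D\<Gamma>_linear2[OF c pos_image[OF that]])
        show "continuous_on (dom c) (\<lambda>t. D\<Gamma> c (pos c t) (h t) u w)" for u
          by (rule continuous_on_linear_apply[where A = "\<lambda>t h. D\<Gamma> c (pos c t) h u w", OF _ D h])
            (rule D\<Gamma>_linear1[OF c pos_image])
      qed
    qed
    show ?thesis unfolding AJ_def Rc_def
      by (intro continuous_on_Pair continuous_on_diff continuous_on_add continuous_on_const \<Gamma>c D\<Gamma>c continuous_vc c)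
  qed
  fix t assume t: "t \<in> dom c"
  note L = tcoord_linear[OF c domD(2)[OF t]] and x = pos_image[OF t]
  show lF: "linear (FJ c t)"
    by (rule linearI) (simp_all add: FJ_def linear_add[OF L] linear_scale[OF L])
  have "z = 0" if "FJ c t z = 0" for z
  proof -
    have "tcoord M c (\<gamma> t) (fst z) = 0" "tcoord M c (\<gamma> t) (snd z) = 0" using that by (simp_all add: FJ_def zero_prod_def)
    then have "fst z = 0" "snd z = 0"
      using tvec_tcoord[OF c domD(2)[OF t]] linear_0[OF tvec_linear[OF c domD(2)[OF t]]] by metis+
    then show ?thesis by (simp add: prod_eq_iff)
  qed
  then show "inj (FJ c t)" using linear_injective_0[OF lF] by blast
  show "linear (AJ c t)"
    by (rule linearI) (simp_all add: AJ_def linear_add[OF Rc_linear(2)[OF c x]] linear_scale[OF Rc_linear(2)[OF c x]]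
        bilinear_radd[OF christoffel_bilinear[OF c x]] bilinear_rmul[OF christoffel_bilinear[OF c x]] algebra_simps)
next
  fix c d t X Z
  assume h: "c \<in> charts M" "d \<in> charts M" "t \<in> dom c" "t \<in> dom d" "t \<in> X" "X \<subseteq> {a..b}"
    "((\<lambda>s. FJ c s (Z s)) has_vector_derivative AJ c t (FJ c t (Z t))) (at t within X)"
  then show "((\<lambda>s. FJ d s (Z s)) has_vector_derivative AJ d t (FJ d t (Z t))) (at t within X)"
    unfolding jacobi_equation_chart[OF h(1,3)] jacobi_equation_chart[OF h(2,4)]
    using cov_at_change[OF h(1-6)] by blast
qed

lemma jacobi_field_iff:
  "jacobi_field M {a..b} \<gamma> J DJ \<longleftrightarrow> jac.sol {a..b} (\<lambda>t. (J t, DJ t))"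
proof -
  have "jacobi_field M {a..b} \<gamma> J DJ \<longleftrightarrow>
    has_cov_derivative M {a..b} \<gamma> J DJ \<and> has_cov_derivative M {a..b} \<gamma> DJ (\<lambda>t. acc t (J t))"
    unfolding jacobi_field_def has_cov_derivative_iff using domD(1) by (fastforce)
  also have "\<dots> \<longleftrightarrow> jac.sol {a..b} (\<lambda>t. (J t, DJ t))"
    unfolding has_cov_derivative_iff jac.sol_def using jacobi_equation_chart[of _ _ "\<lambda>t. (J t, DJ t)" "{a..b}"] domD(1)
    by auto
  finally show ?thesis .
qed

text \<open>Existence and uniqueness of Jacobi fields turn the existential definition into the
  kernel of a linear map.\<close>

lemma lag_curve_eq:
  assumes t: "t \<in> {a..b}"
  shows "lag_curve M \<gamma> a b t = {z. fst (jac.flow z t) = 0}"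
proof (rule set_eqI)
  fix z :: "(real ^ 'n) \<times> (real ^ 'n)"
  have "z \<in> lag_curve M \<gamma> a b t \<longleftrightarrow> (\<exists>Z. jac.sol {a..b} Z \<and> Z a = z \<and> fst (Z t) = 0)"
  proof
    assume "z \<in> lag_curve M \<gamma> a b t"
    then obtain J DJ where "jacobi_field M {a..b} \<gamma> J DJ" "z = (J a, DJ a)" "J t = 0"
      unfolding lag_curve_def by auto
    then show "\<exists>Z. jac.sol {a..b} Z \<and> Z a = z \<and> fst (Z t) = 0"
      unfolding jacobi_field_iff by (intro exI[of _ "\<lambda>t. (J t, DJ t)"]) simp
  next
    assume "\<exists>Z. jac.sol {a..b} Z \<and> Z a = z \<and> fst (Z t) = 0"
    then obtain Z where "jac.sol {a..b} Z" "Z a = z" "fst (Z t) = 0" by blast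
    then have "\<exists>J DJ. jac.sol {a..b} (\<lambda>t. (J t, DJ t)) \<and> J a = fst z \<and> DJ a = snd z \<and> J t = 0"
      by (intro exI[of _ "\<lambda>t. fst (Z t)"] exI[of _ "\<lambda>t. snd (Z t)"]) simp
    then show "z \<in> lag_curve M \<gamma> a b t"
      unfolding lag_curve_def jacobi_field_iff by (simp add: case_prod_beta)
  qed
  also have "\<dots> \<longleftrightarrow> fst (jac.flow z t) = 0"
    using jac.flow_unique[OF _ t] jac.flow by metis
  finally show "z \<in> lag_curve M \<gamma> a b t \<longleftrightarrow> z \<in> {z. fst (jac.flow z t) = 0}" by simp
qed

text \<open>In the derivative of the form the products of first derivatives cancel by symmetry of
  the metric, and the curvature terms cancel by \<open>g_Rc_sym\<close>.\<close>

lemma jacobi_form_constant: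
  assumes J: "jacobi_field M {a..b} \<gamma> J1 DJ1" "jacobi_field M {a..b} \<gamma> J2 DJ2" and t: "t \<in> {a..b}"
  shows "phase_form M (\<gamma> a) (J1 a, DJ1 a) (J2 a, DJ2 a) = phase_form M (\<gamma> t) (J1 t, DJ1 t) (J2 t, DJ2 t)"
proof -
  let ?W = "\<lambda>s. metric M (\<gamma> s) (J2 s) (DJ1 s) - metric M (\<gamma> s) (J1 s) (DJ2 s)"
  obtain DDJ1 DDJ2 where c: "has_cov_derivative M {a..b} \<gamma> J1 DJ1" "has_cov_derivative M {a..b} \<gamma> DJ1 DDJ1"
    "has_cov_derivative M {a..b} \<gamma> J2 DJ2" "has_cov_derivative M {a..b} \<gamma> DJ2 DDJ2"
    and acc: "\<And>s. s \<in> {a..b} \<Longrightarrow> DDJ1 s = acc s (J1 s)" "\<And>s. s \<in> {a..b} \<Longrightarrow> DDJ2 s = acc s (J2 s)"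
    using J unfolding jacobi_field_def by auto
  have "(?W has_derivative (\<lambda>h. 0)) (at s within {a..b})" if s: "s \<in> {a..b}" for s
  proof -
    have "(?W has_vector_derivative
      (metric M (\<gamma> s) (DJ2 s) (DJ1 s) + metric M (\<gamma> s) (J2 s) (DDJ1 s))
      - (metric M (\<gamma> s) (DJ1 s) (DJ2 s) + metric M (\<gamma> s) (J1 s) (DDJ2 s))) (at s within {a..b})"
      by (intro has_vector_derivative_diff metric_product_rule c s)
    moreover have "metric M (\<gamma> s) (J2 s) (acc s (J1 s)) = metric M (\<gamma> s) (J1 s) (acc s (J2 s))"
    proof -
      let ?c = "chart_at M (\<gamma> s)"
      have m: "metric M (\<gamma> s) u v = g ?c (pos ?c s) u v" for u v
        using metric_tcoord[OF chart_at(1,2), of "\<gamma> s" u v] by (simp add: tcoord_chart_at)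
      have x: "pos ?c s \<in> cmap ?c ` cdom ?c" using chart_at by blast
      show ?thesis
        unfolding m riemann_Rc using g_Rc_sym[OF chart_at(1) x] g_sym by metis
    qed
    ultimately show ?thesis using metric(2)[of "\<gamma> s" "DJ1 s" "DJ2 s"]
      unfolding acc(1)[OF s] acc(2)[OF s] has_vector_derivative_def by simp
  qed
  then obtain k where k: "\<And>s. s \<in> {a..b} \<Longrightarrow> ?W s = k"
    using has_derivative_zero_constant[of "{a..b}" ?W] by auto
  have "a \<in> {a..b}" using ab by simp
  then show ?thesis using k[of a] k[OF t] by (simp add: phase_form_def)
qed

lemma flow_bij:
  assumes "t \<in> {a..b}"
  shows "surj (\<lambda>z. jac.flow z t)"
  by (rule linear_inj_imp_surj[OF jac.flow_linear[OF assms] jac.flow_inj[OF assms]])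

text \<open>The flow at time \<open>t\<close> is an isomorphism that carries the subspace onto
  \<open>{0} \<times> UNIV\<close>, which gives the dimension. Isotropy is tested at time
  \<open>t\<close>, where both Jacobi fields vanish.\<close>

lemma lag_curve_lagrangian:
  assumes t: "t \<in> {a..b}"
  shows "lagrangian (phase_form M (\<gamma> a)) (lag_curve M \<gamma> a b t)"
  unfolding lagrangian_def
proof (intro conjI ballI)
  note L = jac.flow_linear[OF t]
  have Lf: "linear (\<lambda>z. fst (jac.flow z t))"
    using linear_compose[OF L linear_fst] by (simp add: comp_def)
  show sub: "subspace (lag_curve M \<gamma> a b t)"
    unfolding lag_curve_eq[OF t] by (rule linear_subspace_kernel[OF Lf])
  have lin0: "linear (\<lambda>w :: real ^ 'n. (0 :: real ^ 'n, w))"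
    by (rule linearI) simp_all
  have "(\<lambda>z. jac.flow z t) ` lag_curve M \<gamma> a b t = (\<lambda>w. (0, w)) ` UNIV"
  proof
    show "(\<lambda>w. (0, w)) ` UNIV \<subseteq> (\<lambda>z. jac.flow z t) ` lag_curve M \<gamma> a b t"
    proof
      fix y :: "(real ^ 'n) \<times> (real ^ 'n)" assume y: "y \<in> (\<lambda>w. (0, w)) ` UNIV"
      obtain z where "y = jac.flow z t" using flow_bij[OF t] by (metis surjD)
      then show "y \<in> (\<lambda>z. jac.flow z t) ` lag_curve M \<gamma> a b t" using y unfolding lag_curve_eq[OF t] by auto
    qed
    show "(\<lambda>z. jac.flow z t) ` lag_curve M \<gamma> a b t \<subseteq> (\<lambda>w. (0, w)) ` UNIV"
      unfolding lag_curve_eq[OF t] by (auto intro!: image_eqI[where x = "snd (jac.flow _ t)"] simp: prod_eq_iff)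
  qed
  moreover have "dim ((\<lambda>z. jac.flow z t) ` lag_curve M \<gamma> a b t) = dim (lag_curve M \<gamma> a b t)"
    by (rule dim_image_eq[OF L inj_on_subset[OF jac.flow_inj[OF t]]]) simp
  moreover have "dim ((\<lambda>w :: real ^ 'n. (0 :: real ^ 'n, w)) ` UNIV) = dim (UNIV :: (real ^ 'n) set)"
    by (rule dim_image_eq[OF lin0]) (auto simp: inj_on_def)
  ultimately show "2 * dim (lag_curve M \<gamma> a b t) = DIM((real ^ 'n) \<times> (real ^ 'n))" by simp
  fix z1 z2 assume "z1 \<in> lag_curve M \<gamma> a b t" "z2 \<in> lag_curve M \<gamma> a b t"
  then obtain J1 DJ1 J2 DJ2 where J: "jacobi_field M {a..b} \<gamma> J1 DJ1" "z1 = (J1 a, DJ1 a)" "J1 t = 0"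
    "jacobi_field M {a..b} \<gamma> J2 DJ2" "z2 = (J2 a, DJ2 a)" "J2 t = 0"
    unfolding lag_curve_def by auto
  have "phase_form M (\<gamma> a) z1 z2 = phase_form M (\<gamma> t) (J1 t, DJ1 t) (J2 t, DJ2 t)"
    unfolding J(2,5) by (rule jacobi_form_constant[OF J(1,4) t])
  also have "\<dots> = 0" by (simp add: phase_form_def J(3,6) bilinear_lzero[OF metric(1)])
  finally show "phase_form M (\<gamma> a) z1 z2 = 0" .
qed

text \<open>The values \<open>jac.flow z s\<close> refer to charts that vary with s, so they are
  first read in one fixed chart near \<open>t\<close>. The injective \<open>tcoord\<close> leaves
  the kernel unchanged.\<close>

lemma lag_curve_continuous: "continuous_on {a..b} (\<lambda>t. closest_point (lag_curve M \<gamma> a b t) x)"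
  unfolding continuous_on_eq_continuous_within
proof
  fix t assume t: "t \<in> {a..b}"
  let ?c = "chart_at M (\<gamma> t)"
  have c: "?c \<in> charts M" and tc: "t \<in> dom ?c" using chart_at dom_chart_at[OF t] by blast+
  have w: "at t within dom ?c = at t within {a..b}"
    using at_within_dom[OF c tc, of "{a..b}"] domD(1) by (metis Int_absorb1 subsetI)
  let ?X = "\<lambda>s z. tcoord M ?c (\<gamma> s) (fst (jac.flow z s))"
  have "continuous_on (dom ?c) (\<lambda>s. closest_point {z. ?X s z = 0} x)"
  proof (rule continuous_on_kernel_projection)
    fix s assume s: "s \<in> dom ?c"
    note L = tcoord_linear[OF c domD(2)[OF s]]
    show "linear (?X s)"
      using linear_compose[OF linear_compose[OF jac.flow_linear[OF domD(1)[OF s]] linear_fst] L] by (simp add: comp_def)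
    show "surj (?X s)"
      unfolding surj_def
    proof
      fix y
      obtain z where "jac.flow z s = (tvec M ?c (\<gamma> s) y, 0)" using flow_bij[OF domD(1)[OF s]] by (metis surjD)
      then show "\<exists>z. y = ?X s z" using tcoord_tvec[OF c domD(2)[OF s]] by (intro exI[of _ z]) simp
    qed
  next
    fix z
    show "continuous_on (dom ?c) (\<lambda>s. ?X s z)"
    proof (rule continuous_on_vector_derivative)
      fix s assume s: "s \<in> dom ?c"
      have "((\<lambda>r. FJ ?c r (jac.flow z r)) has_vector_derivative AJ ?c s (FJ ?c s (jac.flow z s))) (at s within {a..b})"
        using jac.flow(2)[of z] c s domD(1) unfolding jac.sol_def by blast
      from bounded_linear.has_vector_derivative[OF bounded_linear_fst this]
      show "((\<lambda>s. ?X s z) has_vector_derivative fst (AJ ?c s (FJ ?c s (jac.flow z s)))) (at s within dom ?c)"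
        unfolding FJ_def fst_conv by (rule has_vector_derivative_within_subset) (auto dest: domD)
    qed
  qed
  moreover have "closest_point {z. ?X s z = 0} x = closest_point (lag_curve M \<gamma> a b s) x" if s: "s \<in> dom ?c" for s
  proof -
    have "tcoord M ?c (\<gamma> s) v = 0 \<longleftrightarrow> v = 0" for v
      using tvec_tcoord[OF c domD(2)[OF s]] linear_0[OF tvec_linear[OF c domD(2)[OF s]]]
        linear_0[OF tcoord_linear[OF c domD(2)[OF s]]] by metis
    then show ?thesis using lag_curve_eq[OF domD(1)[OF s]] by simp
  qed
  ultimately have "continuous_on (dom ?c) (\<lambda>s. closest_point (lag_curve M \<gamma> a b s) x)"
    by (simp cong: continuous_on_cong)
  then show "continuous (at t within {a..b}) (\<lambda>s. closest_point (lag_curve M \<gamma> a b s) x)"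
    using tc w unfolding continuous_on_eq_continuous_within by metis
qed

end

section \<open>Submanifolds and their Lagrangians\<close>

context semi_riem begin

text \<open>In the slice chart a curve in \<open>P\<close> stays in \<open>W\<close>, so any
  component of its velocity orthogonal to \<open>W\<close> is the derivative of 0. Conversely,
  straight lines in \<open>W\<close> realise all directions.\<close>

lemma tangent_space_of_slice:
  assumes c: "c \<in> charts M" and p: "p \<in> P" "p \<in> cdom c" and W: "subspace W"
    and slice: "cmap c ` (P \<inter> cdom c) = cmap c ` cdom c \<inter> W"
  shows "tangent_space_of M P p = tvec M c p ` W"
proof
  let ?e = "chart_at M p"
  show "tangent_space_of M P p \<subseteq> tvec M c p ` W"
  proof
    fix v assume "v \<in> tangent_space_of M P p"
    then obtain \<sigma> :: "real \<Rightarrow> 'm" where \<sigma>: "range \<sigma> \<subseteq> P" "\<sigma> 0 = p" "isCont \<sigma> 0"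
      "((\<lambda>s. cmap ?e (\<sigma> s)) has_vector_derivative v) (at 0)"
      unfolding tangent_space_of_def by blast
    have d: "((\<lambda>s. cmap c (\<sigma> s)) has_vector_derivative tcoord M c p v) (at 0)"
      using curve_in_chart[where \<sigma> = \<sigma> and t = 0 and X = UNIV and v = v, OF c] \<sigma> p by simp
    obtain y z where yz: "y \<in> span W" "\<And>w. w \<in> span W \<Longrightarrow> orthogonal z w" "tcoord M c p v = y + z"
      using orthogonal_subspace_decomp_exists[of W "tcoord M c p v"] by metis
    have W': "span W = W" using W by (simp only: span_eq_iff)
    have 1: "((\<lambda>s. z \<bullet> cmap c (\<sigma> s)) has_vector_derivative z \<bullet> tcoord M c p v) (at 0)"
      by (rule bounded_linear.has_vector_derivative[OF bounded_linear_inner_right d])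
    have "(\<sigma> \<longlongrightarrow> p) (at 0)" using \<sigma>(2,3) by (simp add: isCont_def)
    from topological_tendstoD[OF this open_cdom[OF c] p(2)]
    obtain r where r: "r > 0" "\<And>s. s \<noteq> 0 \<Longrightarrow> dist s 0 < r \<Longrightarrow> \<sigma> s \<in> cdom c"
      unfolding eventually_at by auto
    have 2: "((\<lambda>s. 0) has_vector_derivative z \<bullet> tcoord M c p v) (at 0)"
    proof (rule has_vector_derivative_transform_within[OF 1 r(1)])
      fix s :: real assume "dist s 0 < r"
      then have "\<sigma> s \<in> cdom c" using r(2) p(2) \<sigma>(2) by (cases "s = 0") auto
      then have "cmap c (\<sigma> s) \<in> W" using \<sigma>(1) slice by blast
      then show "z \<bullet> cmap c (\<sigma> s) = 0" using yz(2) W' by (simp add: orthogonal_def)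
    qed simp
    have "z \<bullet> tcoord M c p v = 0" by (rule vector_derivative_unique_at[OF 2 has_vector_derivative_const])
    then have "z \<bullet> z = 0" using yz(2)[OF yz(1)] by (simp add: yz(3) inner_add_right orthogonal_def)
    then have "tcoord M c p v \<in> W" using yz(1,3) W' by simp
    then show "v \<in> tvec M c p ` W" using tvec_tcoord[OF c p(2), of v] by (metis imageI)
  qed
  show "tvec M c p ` W \<subseteq> tangent_space_of M P p"
  proof
    fix v assume "v \<in> tvec M c p ` W"
    then obtain w where w: "w \<in> W" "v = tvec M c p w" by blast
    let ?x = "cmap c p"
    \<comment> \<open>Where the line leaves the chart the curve is set to \<open>p\<close>, so that
      its whole range lies in \<open>P\<close>; near 0 this case does not occur.\<close>
    define \<sigma> where "\<sigma> s = (if ?x + s *\<^sub>R w \<in> cmap c ` cdom c then cinv c (?x + s *\<^sub>R w) else p)" for s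
    have xW: "?x \<in> W" using p slice by blast
    have ran: "range \<sigma> \<subseteq> P"
    proof
      fix q assume "q \<in> range \<sigma>"
      then obtain s where q: "q = \<sigma> s" by blast
      show "q \<in> P"
      proof (cases "?x + s *\<^sub>R w \<in> cmap c ` cdom c")
        case True
        then have "?x + s *\<^sub>R w \<in> cmap c ` (P \<inter> cdom c)"
          unfolding slice using W xW w(1) by (simp add: subspace_add subspace_scale)
        then obtain q' where "q' \<in> P" "q' \<in> cdom c" "?x + s *\<^sub>R w = cmap c q'" by blast
        then show ?thesis using True q by (simp add: \<sigma>_def cinv_cmap[OF c])
      qed (use q p in \<open>simp add: \<sigma>_def\<close>)
    qed
    have \<sigma>0: "\<sigma> 0 = p" using p(2) by (simp add: \<sigma>_def cinv_cmap[OF c])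
    let ?h = "\<lambda>s::real. ?x + s *\<^sub>R w"
    have hc: "continuous_on UNIV ?h" by (intro continuous_intros)
    have oU: "open (?h -` (cmap c ` cdom c))" by (rule open_vimage[OF open_image[OF c] hc])
    have U0: "0 \<in> ?h -` (cmap c ` cdom c)" using p(2) by simp
    have "continuous_on (?h -` (cmap c ` cdom c)) (\<lambda>s. cinv c (?h s))"
      by (rule continuous_on_compose2[OF homeomorphism_cont2[OF homeo[OF c]] continuous_on_subset[OF hc]]) auto
    then have "continuous_on (?h -` (cmap c ` cdom c)) \<sigma>"
      by (rule continuous_on_eq) (simp add: \<sigma>_def)
    then have cont: "isCont \<sigma> 0" using oU U0 by (simp add: continuous_on_eq_continuous_at)
    have o: "?x \<in> overlap c ?e" by (intro overlapI p chart_at)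
    have hd: "(?h has_derivative (\<lambda>s. s *\<^sub>R w)) (at 0)" by (auto intro!: derivative_eq_intros)
    have "((\<lambda>s. (cmap ?e \<circ> cinv c) (?h s)) has_derivative (\<lambda>s. Dtr c ?e ?x (s *\<^sub>R w))) (at 0)"
      by (rule has_derivative_compose[OF hd, where g = "cmap ?e \<circ> cinv c" and g' = "Dtr c ?e ?x"])
        (use transition_has_derivative[OF c chart_at(1) o] in simp)
    then have "((\<lambda>s. (cmap ?e \<circ> cinv c) (?h s)) has_derivative (\<lambda>s. s *\<^sub>R v)) (at 0)"
      by (simp add: w(2) tvec_Dtr linear_scale[OF Dtr_linear[OF c chart_at(1) o]])
    then have "((\<lambda>s. cmap ?e (\<sigma> s)) has_derivative (\<lambda>s. s *\<^sub>R v)) (at 0)"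
      by (rule has_derivative_transform_within_open[OF _ oU U0]) (simp add: \<sigma>_def)
    then show "v \<in> tangent_space_of M P p"
      unfolding tangent_space_of_def has_vector_derivative_def using ran \<sigma>0 cont by blast
  qed
qed

lemma tangent_space_of_submanifold:
  assumes "submanifold M d P" "p \<in> P"
  shows "subspace (tangent_space_of M P p)" "dim (tangent_space_of M P p) \<le> d"
proof -
  obtain c W where c: "c \<in> charts M" "p \<in> cdom c" "subspace W" "dim W = d"
    "cmap c ` (P \<inter> cdom c) = cmap c ` cdom c \<inter> W"
    using assms unfolding submanifold_def by blast
  note T = tangent_space_of_slice[OF c(1) assms(2) c(2,3,5)] and L = tvec_linear[OF c(1,2)]
  show "subspace (tangent_space_of M P p)" unfolding T by (rule linear_subspace_image[OF L c(3)])
  show "dim (tangent_space_of M P p) \<le> d" unfolding T using dim_image_le[OF L, of W] c(4) by simp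
qed

section \<open>The symplectic form and the Lagrangians of the point and the submanifold\<close>

lemma phase_form_symplectic: "symplectic_form (phase_form M p)"
proof
  note m = metric(1)[of p]
  note s = bilinear_ladd[OF m] bilinear_radd[OF m] bilinear_lmul[OF m] bilinear_rmul[OF m]
  show "bilinear (phase_form M p)"
    unfolding bilinear_def by (auto intro!: linearI simp: phase_form_def s algebra_simps)
  show "phase_form M p x y = - phase_form M p y x" for x y
    by (simp add: phase_form_def metric(2))
  show "x = 0" if h: "\<And>y. phase_form M p x y = 0" for x
  proof -
    have "fst x = 0"
      by (rule metric(3)[of p]) (use h[of "(0, _)"] in \<open>simp add: phase_form_def bilinear_lzero[OF m]\<close>)
    moreover have "snd x = 0"
      by (rule metric(3)[of p]) (use h[of "(_, 0)"] in \<open>simp add: phase_form_def bilinear_lzero[OF m] bilinear_rzero[OF m] metric(2)\<close>)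
    ultimately show ?thesis by (simp add: prod_eq_iff)
  qed
qed

lemma subspace_metric_perp: "subspace (metric_perp M p T)"
  unfolding subspace_def metric_perp_def
  by (simp add: bilinear_radd[OF metric(1)] bilinear_rmul[OF metric(1)] bilinear_rzero[OF metric(1)])

text \<open>The metric complement of \<open>T\<close> is the Euclidean orthogonal complement of its
  image under the injective map \<open>form_vector (metric M p)\<close>.\<close>

lemma dim_metric_perp:
  assumes "subspace T"
  shows "dim (metric_perp M p T) + dim T = CARD('n)"
proof -
  let ?G = "form_vector (metric M p)"
  have G: "linear ?G" "inj ?G"
    using linear_form_vector[OF metric(1), of p] inj_form_vector[OF metric(1), of p] metric(3)[of p] by blast+
  have "metric_perp M p T = {y \<in> UNIV. \<forall>x\<in>?G ` T. orthogonal x y}"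
    by (simp add: metric_perp_def orthogonal_def inner_form_vector[OF metric(1)])
  moreover have "dim (?G ` T) = dim T" by (rule dim_image_eq[OF G(1) inj_on_subset[OF G(2) subset_UNIV]])
  ultimately show ?thesis
    using dim_subspace_orthogonal_to_vectors[OF linear_subspace_image[OF G(1) assms], of UNIV] by simp
qed

lemma lag_point_lagrangian: "lagrangian (phase_form M p) lag_point"
  unfolding lagrangian_def lag_point_def
proof (intro conjI ballI)
  show "subspace ({0 :: real ^ 'n} \<times> (UNIV :: (real ^ 'n) set))"
    by (intro subspace_Times subspace_single_0 subspace_UNIV)
  show "2 * dim ({0 :: real ^ 'n} \<times> (UNIV :: (real ^ 'n) set)) = DIM((real ^ 'n) \<times> (real ^ 'n))"
    by (simp add: dim_Times[OF subspace_single_0 subspace_UNIV])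
qed (auto simp: phase_form_def bilinear_lzero[OF metric(1)])

text \<open>The auxiliary complement \<open>L2\<close> of \<open>maslov_index_bound\<close> for the
  case that \<open>L1\<close> is \<open>lag_point\<close>.\<close>

lemma lag_point_complement: "lagrangian (phase_form M p) (UNIV \<times> {0})" "transverse lag_point (UNIV \<times> {0 :: real ^ 'n})"
proof -
  show "lagrangian (phase_form M p) (UNIV \<times> {0})"
    unfolding lagrangian_def
  proof (intro conjI ballI)
    show "subspace ((UNIV :: (real ^ 'n) set) \<times> {0 :: real ^ 'n})"
      by (intro subspace_Times subspace_single_0 subspace_UNIV)
    show "2 * dim ((UNIV :: (real ^ 'n) set) \<times> {0 :: real ^ 'n}) = DIM((real ^ 'n) \<times> (real ^ 'n))"
      by (simp add: dim_Times[OF subspace_UNIV subspace_single_0])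
  qed (auto simp: phase_form_def bilinear_rzero[OF metric(1)])
  show "transverse lag_point (UNIV \<times> {0 :: real ^ 'n})"
    by (auto simp: transverse_def lag_point_def zero_prod_def)
qed

context
  fixes P :: "'m set" and p :: 'm and S :: "real ^ 'n \<Rightarrow> real ^ 'n" and T
  defines "T \<equiv> tangent_space_of M P p"
  assumes subT: "subspace T" and nondegT: "nondegenerate_on T (metric M p)"
    and linS: "linear S"
    and Ssym: "\<And>v v'. v \<in> T \<Longrightarrow> v' \<in> T \<Longrightarrow> metric M p (S v) v' = metric M p v (S v')"
begin

lemma lag_submanifold_iff:
  "(v, w) \<in> lag_submanifold M P p S \<longleftrightarrow> v \<in> T \<and> w + S v \<in> metric_perp M p T"
  by (simp add: lag_submanifold_def T_def)

lemma tangent_perp_trivial: "v \<in> T \<Longrightarrow> v \<in> metric_perp M p T \<Longrightarrow> v = 0"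
  using nondegT metric(2)[of p v] unfolding nondegenerate_on_def metric_perp_def by auto

lemma perpD: "w \<in> metric_perp M p T \<Longrightarrow> u \<in> T \<Longrightarrow> metric M p u w = 0"
  unfolding metric_perp_def by blast

lemma dim_product: "2 * dim (T \<times> metric_perp M p T) = DIM((real ^ 'n) \<times> (real ^ 'n))"
  using dim_metric_perp[OF subT, of p] by (simp add: dim_Times[OF subT subspace_metric_perp])

text \<open>The subspace is a shear by -S of the product of \<open>T\<close> and its metric
  complement, which fixes its dimension. The terms that the shear adds to the form cancel by
  symmetry of \<open>S\<close>.\<close>

lemma lag_submanifold_lagrangian: "lagrangian (phase_form M p) (lag_submanifold M P p S)"
  unfolding lagrangian_def
proof (intro conjI ballI)
  define h where "h z = (fst z, snd z - S (fst z))" for z :: "(real ^ 'n) \<times> (real ^ 'n)"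
  have linh: "linear h"
    by (rule linearI) (simp_all add: h_def linear_add[OF linS] linear_scale[OF linS] algebra_simps)
  have injh: "inj h" by (auto simp: inj_def h_def)
  have im: "lag_submanifold M P p S = h ` (T \<times> metric_perp M p T)"
  proof (intro set_eqI iffI)
    fix z :: "(real ^ 'n) \<times> (real ^ 'n)" assume "z \<in> lag_submanifold M P p S"
    then have "(fst z, snd z + S (fst z)) \<in> T \<times> metric_perp M p T"
      using lag_submanifold_iff[of "fst z" "snd z"] by simp
    then show "z \<in> h ` (T \<times> metric_perp M p T)" by (rule rev_image_eqI) (simp add: h_def)
  qed (auto simp: h_def lag_submanifold_iff)
  show "subspace (lag_submanifold M P p S)"
    unfolding im by (intro linear_subspace_image linh subspace_Times subT subspace_metric_perp)
  show "2 * dim (lag_submanifold M P p S) = DIM((real ^ 'n) \<times> (real ^ 'n))"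
    unfolding im dim_image_eq[OF linh inj_on_subset[OF injh subset_UNIV]] by (rule dim_product)
  fix x y assume "x \<in> lag_submanifold M P p S" "y \<in> lag_submanifold M P p S"
  then obtain v1 n1 v2 n2 where xy: "v1 \<in> T" "v2 \<in> T" "n1 \<in> metric_perp M p T" "n2 \<in> metric_perp M p T"
    "x = (v1, n1 - S v1)" "y = (v2, n2 - S v2)"
    unfolding im h_def by auto
  have "metric M p v2 (S v1) = metric M p v1 (S v2)"
    using Ssym[OF xy(1,2)] metric(2)[of p "S v1" v2] by simp
  then show "phase_form M p x y = 0"
    by (simp add: phase_form_def xy bilinear_rsub[OF metric(1)] perpD)
qed

lemma perp_tangent_lagrangian: "lagrangian (phase_form M p) (metric_perp M p T \<times> T)"
  unfolding lagrangian_def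
proof (intro conjI ballI)
  show "subspace (metric_perp M p T \<times> T)" by (intro subspace_Times subT subspace_metric_perp)
  show "2 * dim (metric_perp M p T \<times> T) = DIM((real ^ 'n) \<times> (real ^ 'n))"
    using dim_product by (simp add: dim_Times subT subspace_metric_perp)
  fix x y assume "x \<in> metric_perp M p T \<times> T" "y \<in> metric_perp M p T \<times> T"
  then have "metric M p (snd x) (fst y) = 0" "metric M p (snd y) (fst x) = 0"
    by (auto intro: perpD)
  then show "phase_form M p x y = 0" by (simp add: phase_form_def metric(2))
qed

text \<open>Nondegeneracy on \<open>T\<close> enters here: first v, then w lies both in
  \<open>T\<close> and in its metric complement. The product thus serves as \<open>L2\<close> when
  \<open>L1\<close> is the Lagrangian of the submanifold.\<close>

lemma lag_submanifold_transverse: "transverse (lag_submanifold M P p S) (metric_perp M p T \<times> T)"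
proof -
  have "v = 0 \<and> w = 0"
    if h: "v \<in> T" "w + S v \<in> metric_perp M p T" "v \<in> metric_perp M p T" "w \<in> T" for v w
  proof -
    have "v = 0" using tangent_perp_trivial h by blast
    then show ?thesis using tangent_perp_trivial[of w] h by (simp add: linear_0[OF linS])
  qed
  moreover have "(0, 0) \<in> lag_submanifold M P p S" "(0, 0) \<in> metric_perp M p T \<times> T"
    using subT subspace_metric_perp by (simp_all add: lag_submanifold_iff subspace_0 linear_0[OF linS])
  ultimately show ?thesis unfolding transverse_def by (auto simp: lag_submanifold_iff zero_prod_def)
qed

text \<open>For v = 0 the defining condition says that w lies in the metric complement of
  \<open>T\<close>.\<close>

lemma codim_lag_point_Int: "CARD('n) - dim (lag_point \<inter> lag_submanifold M P p S) = dim T"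
proof -
  have "lag_point \<inter> lag_submanifold M P p S = {0} \<times> metric_perp M p T"
    using subspace_0[OF subT] by (auto simp: lag_point_def lag_submanifold_iff linear_0[OF linS])
  then have "dim (lag_point \<inter> lag_submanifold M P p S) = dim (metric_perp M p T)"
    by (simp add: dim_Times[OF subspace_single_0 subspace_metric_perp])
  then show ?thesis using dim_metric_perp[OF subT, of p] by simp
qed

end

end

lemma lagrangian_dim:
  fixes L :: "((real ^ 'n::finite) \<times> (real ^ 'n)) set"
  shows "lagrangian \<omega> L \<Longrightarrow> dim L = CARD('n)"
  unfolding lagrangian_def by simp

theorem corollary4p4:
  fixes M :: "('m::{t2_space, second_countable_topology}, 'n::finite) semi_riemannian"
    and \<gamma> :: "real \<Rightarrow> 'm" and a b \<alpha> \<beta> :: real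
    and P :: "'m set" and d :: nat
    and S :: "real ^ 'n \<Rightarrow> real ^ 'n"
    and \<mu> :: "((real ^ 'n) \<times> (real ^ 'n)) set \<Rightarrow> real \<Rightarrow> real \<Rightarrow>
                (real \<Rightarrow> ((real ^ 'n) \<times> (real ^ 'n)) set) \<Rightarrow> int"
  assumes "semi_riemannian_manifold M"
    and "a < b" and "geodesic M {a..b} \<gamma>"
    and "submanifold M d P" and "connected P" and "\<gamma> a \<in> P"
    and "velocity M {a..b} \<gamma> a \<in> metric_perp M (\<gamma> a) (tangent_space_of M P (\<gamma> a))"
    and "nondegenerate_on (tangent_space_of M P (\<gamma> a)) (metric M (\<gamma> a))"
    and "second_fundamental_operator M P (\<gamma> a) (velocity M {a..b} \<gamma> a) S"
    and "is_maslov_index (phase_form M (\<gamma> a)) \<mu>"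
    and "a < \<alpha>" and "\<alpha> \<le> \<beta>" and "\<beta> \<le> b"
  shows "(\<bar>\<mu> lag_point \<alpha> \<beta> (lag_curve M \<gamma> a b)\<bar> > int d \<longrightarrow>
            (\<exists>t\<in>{\<alpha>..\<beta>}. focal_instant M \<gamma> a b P S t)) \<and>
         (\<bar>\<mu> (lag_submanifold M P (\<gamma> a) S) \<alpha> \<beta> (lag_curve M \<gamma> a b)\<bar> > int d \<longrightarrow>
            (\<exists>t\<in>{\<alpha>..\<beta>}. conjugate_instant M \<gamma> a b t))"
proof -
  interpret semi_riem_geodesic M \<gamma> a b
    by (intro semi_riem_geodesic.intro semi_riem.intro semi_riem_geodesic_axioms.intro assms)
  let ?\<omega> = "phase_form M (\<gamma> a)" and ?l = "lag_curve M \<gamma> a b"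
  let ?LP = "lag_submanifold M P (\<gamma> a) S" and ?T = "tangent_space_of M P (\<gamma> a)"
  interpret symplectic_form ?\<omega> by (rule phase_form_symplectic)
  note T = tangent_space_of_submanifold[OF assms(4,6)]
  have S: "linear S"
    "\<And>v v'. v \<in> ?T \<Longrightarrow> v' \<in> ?T \<Longrightarrow> metric M (\<gamma> a) (S v) v' = metric M (\<gamma> a) v (S v')"
    using assms(9) unfolding second_fundamental_operator_def Let_def by blast+
  note LP = lag_submanifold_lagrangian[OF T(1) assms(8) S] and L0 = lag_point_lagrangian[of "\<gamma> a"]
    and codim = codim_lag_point_Int[OF T(1) assms(8) S]
  have sub: "{\<alpha>..\<beta>} \<subseteq> {a..b}" "{\<alpha>..\<beta>} \<subseteq> {a<..b}" using assms(11,13) by auto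
  have cont: "lag_continuous_on ?\<omega> {\<alpha>..\<beta>} ?l"
    unfolding lag_continuous_on_def
    using lag_curve_lagrangian lag_curve_continuous continuous_on_subset sub(1) by blast
  \<comment> \<open>Both claims are instances, with the two Lagrangians as \<open>L\<close> and
    \<open>L'\<close> in either order and a Lagrangian complement \<open>L''\<close> of
    \<open>L'\<close>.\<close>
  have bound: "\<bar>\<mu> L \<alpha> \<beta> ?l\<bar> \<le> int d"
    if "lagrangian ?\<omega> L" "lagrangian ?\<omega> L'" "lagrangian ?\<omega> L''" "transverse L' L''"
      "CARD('n) - dim (L \<inter> L') = dim ?T" "\<And>t. t \<in> {\<alpha>..\<beta>} \<Longrightarrow> transverse (?l t) L'" for L L' L''
    using maslov_index_bound[OF that(1-4) assms(10,12) cont that(6)] that(5) T(2)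
    unfolding lagrangian_dim[OF that(1)] by simp
  show ?thesis
  proof (intro conjI impI; rule ccontr)
    \<comment> \<open>All of the interval lies in \<open>{a<..b}\<close>, so the absence of focal
      instants is exactly transversality of the curve to \<open>?LP\<close>.\<close>
    assume "int d < \<bar>\<mu> lag_point \<alpha> \<beta> ?l\<bar>" "\<not> (\<exists>t\<in>{\<alpha>..\<beta>}. focal_instant M \<gamma> a b P S t)"
    moreover from this(2) have "transverse (?l t) ?LP" if "t \<in> {\<alpha>..\<beta>}" for t
      using sub(2) that unfolding focal_instant_def transverse_def by blast
    ultimately show False
      using bound[OF L0 LP perp_tangent_lagrangian[OF T(1) assms(8) S] lag_submanifold_transverse[OF T(1) assms(8) S] codim]
      by fastforce
  next
    assume "int d < \<bar>\<mu> ?LP \<alpha> \<beta> ?l\<bar>" "\<not> (\<exists>t\<in>{\<alpha>..\<beta>}. conjugate_instant M \<gamma> a b t)"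
    moreover from this(2) have "transverse (?l t) lag_point" if "t \<in> {\<alpha>..\<beta>}" for t
      using sub(2) that unfolding conjugate_instant_def transverse_def by blast
    ultimately show False
      \<comment> \<open>The codimension is the same in this order, since every Lagrangian has
        dimension \<open>CARD('n)\<close>.\<close>
      using bound[OF LP L0 lag_point_complement codim[unfolded Int_commute[of lag_point]]]
      by fastforce
  qed
qed

end
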